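(* Suppose $\widehat{H}(\mathbf{Q})$ is symmetric, and let $\sigma$ be a maximal element of $\widehat{H}(\mathbf{Q})$ with $|\sigma|=2g-2+m$ such that for every $\beta\in\mathbb{Z}^m$ one has $\beta\in\widehat{H}(\mathbf{Q})$ if and only if $\nabla(\sigma-\beta)=\emptyset$. Then the Poincaré series $P(\mathbf{t})$ associated with $\widehat{H}(\mathbf{Q})$ satisfies $$P(\mathbf{t})=(-1)^m\,\mathbf{t}^{\sigma}\,P(\mathbf{t}^{-\mathbf{1}}).$$
   Context: Let $\mathbb{F}$ be a finite field and $\mathcal{X}$ a projective, non-singular, geometrically irreducible algebraic curve of genus $g$ over $\mathbb{F}$. Let $m\geq 2$ and let $\mathbf{Q}=(Q_1,\ldots,Q_m)$ be an $m$-tuple of pairwise distinct $\mathbb{F}$-rational points of $\mathcal{X}$. Standing assumption: $\#\mathbb{F}\geq m$. Put $I=\{1,\ldots,m\}$ and $|\alpha|=\sum_i\alpha_i$ for $\alpha\in\mathbb{Z}^m$. Let $R_{\mathbf{Q}}$ be the ring of functions of $\mathcal{X}$ that are regular outside $\{Q_1,\ldots,Q_m\}$. For $f\in R_{\mathbf{Q}}\setminus\{0\}$ put $\rho_{\mathbf{Q}}(f)=(-v_{Q_1}(f),\ldots,-v_{Q_m}(f))$. The generalized Weierstrass semigroup is $\widehat{H}(\mathbf{Q})=\{\rho_{\mathbf{Q}}(f): f\in R_{\mathbf{Q}}\setminus\{0\}\}\subseteq\mathbb{Z}^m$. It is called symmetric if there exists $\gamma\in\mathbb{Z}^m\setminus\widehat{H}(\mathbf{Q})$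 with $|\gamma|=2g-1$. For $\alpha\in\mathbb{Z}^m$, put $\nabla_i(\alpha)=\{\beta\in\widehat{H}(\mathbf{Q}):\beta_i=\alpha_i,\ \beta_j<\alpha_j\ \forall j\neq i\}$ and $\nabla(\alpha)=\bigcup_{i=1}^m\nabla_i(\alpha)$. An element $\alpha\in\widehat{H}(\mathbf{Q})$ is maximal if $\nabla(\alpha)=\emptyset$. For $\alpha\in\mathbb{Z}^m$, $\ell(\alpha)$ is the $\mathbb{F}$-dimension of the Riemann-Roch space of $\sum_i\alpha_iQ_i$. For $J\subseteq I$, $\mathbf{1}_J\in\mathbb{Z}^m$ has $j$-th coordinate $1$ if $j\in J$ and $0$ otherwise; $\mathbf{1}=\mathbf{1}_I$, $\mathbf{e}_i=\mathbf{1}_{\{i\}}$. Put $d_i(\beta)=\ell(\beta)-\ell(\beta-\mathbf{e}_i)$. Write $\mathbf{t}^\alpha=t_1^{\alpha_1}\cdots t_m^{\alpha_m}$. The Poincaré series associated with $\widehat{H}(\mathbf{Q})$ is the formal series $P(\mathbf{t})=\sum_{\alpha\in\mathbb{Z}^m}p(\alpha)\mathbf{t}^\alpha$ with $$p(\alpha)=(-1)^{m-1}\sum_{J\subseteq I\setminus\{i\}}(-1)^{\#J}d_i(\alpha-\mathbf{1}+\mathbf{1}_J+\mathbf{e}_i),$$ which does not depend on the choice of $i\in I$. A formal series means a $\mathbb{Z}$-valued function on $\mathbb{Z}^m$; formal series form a module over Laurent polynomials via the usual multiplication rule. $P(\mathbf{t}^{-\mathbf{1}})$ denotes $\sum_{\alpha\in\mathbb{Z}^m}p(\alpha)\mathbf{t}^{-\alpha}$.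 *)

theory Defs
  imports
    "HOL-Analysis.Cartesian_Space"
    "HOL-Algebra.Algebraic_Closure_Type"
    "HOL-Library.Poly_Mapping"
begin

section \<open>Projective algebraic sets\<close>

text \<open>The coordinates of projective space are indexed by a finite type \<open>'n\<close>, so the ambient
  space is \<open>P^r\<close> with \<open>r + 1 = CARD('n)\<close>.\<close>

type_synonym ('n, 'a) mpoly = "('n \<Rightarrow>\<^sub>0 nat) \<Rightarrow>\<^sub>0 'a"

definition is_ring_hom :: "('a :: ring_1 \<Rightarrow> 'b :: ring_1) \<Rightarrow> bool" where
  "is_ring_hom h \<longleftrightarrow>
     h 1 = 1 \<and> (\<forall>x y. h (x + y) = h x + h y) \<and> (\<forall>x y. h (x * y) = h x * h y)"

text \<open>Evaluation of a polynomial at a vector with entries in an extension, where \<open>h\<close> embeds the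
  coefficients.\<close>

definition eval_at ::
  "('a :: zero \<Rightarrow> 'b :: comm_ring_1) \<Rightarrow> ('n :: finite, 'a) mpoly \<Rightarrow> 'b ^ 'n \<Rightarrow> 'b" where
  "eval_at h f x =
     (\<Sum>u\<in>Poly_Mapping.keys f. h (Poly_Mapping.lookup f u) * (\<Prod>i\<in>UNIV. (x $ i) ^ Poly_Mapping.lookup u i))"

definition homogeneous :: "nat \<Rightarrow> ('n :: finite, 'a :: zero) mpoly \<Rightarrow> bool" where
  "homogeneous d f \<longleftrightarrow>
     (\<forall>u\<in>Poly_Mapping.keys f. (\<Sum>i\<in>UNIV. Poly_Mapping.lookup u i) = d)"

text \<open>A point of projective space is the set of all its vectors of homogeneous coordinates.\<close>

definition proj_point :: "'a :: field ^ 'n \<Rightarrow> ('a ^ 'n) set" where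
  "proj_point x = {c *s x | c. c \<noteq> 0}"

definition proj_space :: "('a :: field ^ 'n) set set" where
  "proj_space = {proj_point x | x. x \<noteq> 0}"

definition vanishes_at ::
  "('a :: zero \<Rightarrow> 'b :: comm_ring_1) \<Rightarrow> ('n :: finite, 'a) mpoly \<Rightarrow> ('b ^ 'n) set \<Rightarrow> bool" where
  "vanishes_at h f P \<longleftrightarrow> (\<forall>x\<in>P. eval_at h f x = 0)"

definition zero_locus ::
  "('a :: zero \<Rightarrow> 'b :: field) \<Rightarrow> ('n :: finite, 'a) mpoly set \<Rightarrow> ('b ^ 'n) set set" where
  "zero_locus h S = {P \<in> proj_space. \<forall>f\<in>S. vanishes_at h f P}"

text \<open>Geometric points, i.e. points over the algebraic closure of the ground field \<open>'k\<close>.\<close>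

type_synonym ('k, 'n) geom_point = "('k alg_closure ^ 'n) set"

definition zariski_closed :: "('k :: field, 'n :: finite) geom_point set \<Rightarrow> bool" where
  "zariski_closed A \<longleftrightarrow>
     (\<exists>S :: ('n, 'k alg_closure) mpoly set. (\<forall>f\<in>S. \<exists>d. homogeneous d f) \<and> A = zero_locus id S)"

definition closed_over_ground :: "('k :: field, 'n :: finite) geom_point set \<Rightarrow> bool" where
  "closed_over_ground C \<longleftrightarrow>
     (\<exists>S :: ('n, 'k) mpoly set. (\<forall>f\<in>S. \<exists>d. homogeneous d f) \<and> C = zero_locus to_ac S)"

definition geom_irreducible :: "('k :: field, 'n :: finite) geom_point set \<Rightarrow> bool" where
  "geom_irreducible C \<longleftrightarrow> C \<noteq> {} \<and>
     \<not> (\<exists>A B. zariski_closed A \<and> zariski_closed B \<and> A \<subset> C \<and> B \<subset> C \<and> C = A \<union> B)"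

definition rational_points :: "('k :: field, 'n :: finite) geom_point set \<Rightarrow> ('k, 'n) geom_point set" where
  "rational_points C = {P \<in> C. \<exists>a :: 'k ^ 'n. P = proj_point (\<chi> i. to_ac (a $ i))}"


section \<open>Function field and local rings\<close>

text \<open>The function field of \<open>C\<close> consists of the classes of quotients of homogeneous polynomials of
  equal degree over \<open>'k\<close>, modulo the forms vanishing on \<open>C\<close>. It is realised inside an
  extension field \<open>'l\<close> of \<open>'k\<close> (embedding \<open>emb\<close>) by means of a generic point \<open>\<xi>\<close>: a form
  vanishes at \<open>\<xi>\<close> iff it vanishes on \<open>C\<close>, so sending the class of \<open>f / g\<close> to \<open>f(\<xi>) / g(\<xi>)\<close> is an
  isomorphism onto a subfield of \<open>'l\<close>.\<close>

definition generic_point ::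
  "('k :: field \<Rightarrow> 'l :: field) \<Rightarrow> 'l ^ 'n :: finite \<Rightarrow> ('k, 'n) geom_point set \<Rightarrow> bool" where
  "generic_point emb \<xi> C \<longleftrightarrow> \<xi> \<noteq> 0 \<and>
     (\<forall>d (f :: ('n, 'k) mpoly). homogeneous d f \<longrightarrow>
        (eval_at emb f \<xi> = 0 \<longleftrightarrow> (\<forall>P\<in>C. vanishes_at to_ac f P)))"

definition function_field :: "('k :: field \<Rightarrow> 'l :: field) \<Rightarrow> 'l ^ 'n :: finite \<Rightarrow> 'l set" where
  "function_field emb \<xi> = {eval_at emb f \<xi> / eval_at emb g \<xi> | d (f :: ('n, 'k) mpoly) g.
     homogeneous d f \<and> homogeneous d g \<and> eval_at emb g \<xi> \<noteq> 0}"

text \<open>For a point \<open>P\<close> of \<open>C\<close>, the condition \<open>g(P) \<noteq> 0\<close> implies \<open>g(\<xi>) \<noteq> 0\<close>.\<close>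

definition local_ring ::
  "('k :: field \<Rightarrow> 'l :: field) \<Rightarrow> 'l ^ 'n :: finite \<Rightarrow> ('k, 'n) geom_point \<Rightarrow> 'l set" where
  "local_ring emb \<xi> P = {eval_at emb f \<xi> / eval_at emb g \<xi> | d (f :: ('n, 'k) mpoly) g.
     homogeneous d f \<and> homogeneous d g \<and> \<not> vanishes_at to_ac g P}"

definition max_ideal ::
  "('k :: field \<Rightarrow> 'l :: field) \<Rightarrow> 'l ^ 'n :: finite \<Rightarrow> ('k, 'n) geom_point \<Rightarrow> 'l set" where
  "max_ideal emb \<xi> P = {eval_at emb f \<xi> / eval_at emb g \<xi> | d (f :: ('n, 'k) mpoly) g.
     homogeneous d f \<and> homogeneous d g \<and> vanishes_at to_ac f P \<and> \<not> vanishes_at to_ac g P}"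

definition uniformizer ::
  "('k :: field \<Rightarrow> 'l :: field) \<Rightarrow> 'l ^ 'n :: finite \<Rightarrow> ('k, 'n) geom_point \<Rightarrow> 'l \<Rightarrow> bool" where
  "uniformizer emb \<xi> P t \<longleftrightarrow> t \<noteq> 0 \<and> max_ideal emb \<xi> P = {t * a | a. a \<in> local_ring emb \<xi> P}"

text \<open>The local rings of a curve at its closed points have dimension 1, so they are regular iff
  the maximal ideal is generated by one (nonzero) element.\<close>

definition nonsingular_at ::
  "('k :: field \<Rightarrow> 'l :: field) \<Rightarrow> 'l ^ 'n :: finite \<Rightarrow> ('k, 'n) geom_point \<Rightarrow> bool" where
  "nonsingular_at emb \<xi> P \<longleftrightarrow> (\<exists>t. uniformizer emb \<xi> P t)"

text \<open>The valuation of a nonzero function; its value at \<open>0\<close> is irrelevant.\<close>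

definition val ::
  "('k :: field \<Rightarrow> 'l :: field) \<Rightarrow> 'l ^ 'n :: finite \<Rightarrow> ('k, 'n) geom_point \<Rightarrow> 'l \<Rightarrow> int" where
  "val emb \<xi> P f = (THE v. \<exists>t u. uniformizer emb \<xi> P t \<and>
     u \<noteq> 0 \<and> u \<in> local_ring emb \<xi> P \<and> inverse u \<in> local_ring emb \<xi> P \<and> f = u * t powi v)"

definition transcendental_over :: "('k :: field \<Rightarrow> 'l :: field) \<Rightarrow> 'l \<Rightarrow> bool" where
  "transcendental_over emb t \<longleftrightarrow> (\<forall>p :: 'k poly. p \<noteq> 0 \<longrightarrow> poly (map_poly emb p) t \<noteq> 0)"

definition simple_ext :: "('k :: field \<Rightarrow> 'l :: field) \<Rightarrow> 'l \<Rightarrow> 'l set" where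
  "simple_ext emb t = {poly (map_poly emb a) t / poly (map_poly emb b) t | a b :: 'k poly.
     poly (map_poly emb b) t \<noteq> 0}"

definition trdeg_one :: "('k :: field \<Rightarrow> 'l :: field) \<Rightarrow> 'l set \<Rightarrow> bool" where
  "trdeg_one emb K \<longleftrightarrow> (\<exists>t\<in>K. transcendental_over emb t \<and>
     (\<forall>f\<in>K. \<exists>p :: 'l poly. p \<noteq> 0 \<and> (\<forall>j. coeff p j \<in> simple_ext emb t) \<and> poly p f = 0))"

text \<open>A projective, non-singular, geometrically irreducible algebraic curve over \<open>'k\<close>, together
  with a realisation of its function field. (The field \<open>'k\<close> is perfect in the application, so
  that regularity over \<open>'k\<close> is the same as geometric regularity.)\<close>

definition nonsingular_projective_curve ::
  "('k :: {field, finite} \<Rightarrow> 'l :: field) \<Rightarrow> 'l ^ 'n :: finite \<Rightarrow> ('k, 'n) geom_point set \<Rightarrow> bool" where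
  "nonsingular_projective_curve emb \<xi> C \<longleftrightarrow>
     closed_over_ground C \<and> geom_irreducible C \<and>
     is_ring_hom emb \<and> generic_point emb \<xi> C \<and>
     trdeg_one emb (function_field emb \<xi>) \<and>
     (\<forall>P\<in>C. nonsingular_at emb \<xi> P)"


section \<open>Divisors, Riemann-Roch spaces, genus\<close>

definition galois_aut :: "('k :: field alg_closure \<Rightarrow> 'k alg_closure) \<Rightarrow> bool" where
  "galois_aut \<tau> \<longleftrightarrow> bij \<tau> \<and> is_ring_hom \<tau> \<and> (\<forall>c. \<tau> (to_ac c) = to_ac c)"

definition galois_conj ::
  "('k :: field alg_closure \<Rightarrow> 'k alg_closure) \<Rightarrow> ('k, 'n :: finite) geom_point \<Rightarrow> ('k, 'n) geom_point" where
  "galois_conj \<tau> P = (\<lambda>x. \<chi> i. \<tau> (x $ i)) ` P"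

text \<open>Divisors over the (perfect) ground field are Galois invariant divisors on the geometric
  points; a closed point of degree \<open>d\<close> is the sum of its \<open>d\<close> conjugates.\<close>

definition is_divisor :: "('k :: field, 'n :: finite) geom_point set \<Rightarrow> (('k, 'n) geom_point \<Rightarrow> int) \<Rightarrow> bool" where
  "is_divisor C D \<longleftrightarrow> {P. D P \<noteq> 0} \<subseteq> C \<and> finite {P. D P \<noteq> 0} \<and>
     (\<forall>\<tau> P. galois_aut \<tau> \<longrightarrow> P \<in> C \<longrightarrow> D (galois_conj \<tau> P) = D P)"

definition divisor_degree :: "(('k :: field, 'n :: finite) geom_point \<Rightarrow> int) \<Rightarrow> int" where
  "divisor_degree D = (\<Sum>P | D P \<noteq> 0. D P)"

definition riemann_roch_space ::
  "('k :: field \<Rightarrow> 'l :: field) \<Rightarrow> 'l ^ 'n :: finite \<Rightarrow> ('k, 'n) geom_point set \<Rightarrow>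
     (('k, 'n) geom_point \<Rightarrow> int) \<Rightarrow> 'l set" where
  "riemann_roch_space emb \<xi> C D =
     {f \<in> function_field emb \<xi>. f = 0 \<or> (\<forall>P\<in>C. val emb \<xi> P f \<ge> - D P)}"

definition rr_dim ::
  "('k :: field \<Rightarrow> 'l :: field) \<Rightarrow> 'l ^ 'n :: finite \<Rightarrow> ('k, 'n) geom_point set \<Rightarrow>
     (('k, 'n) geom_point \<Rightarrow> int) \<Rightarrow> nat" where
  "rr_dim emb \<xi> C D = vector_space.dim (\<lambda>c x. emb c * x) (riemann_roch_space emb \<xi> C D)"

text \<open>The genus is the constant of Riemann's theorem, the supremum (in fact a maximum) of
  \<open>deg D - l(D) + 1\<close> over all divisors \<open>D\<close>.\<close>

definition genus ::
  "('k :: field \<Rightarrow> 'l :: field) \<Rightarrow> 'l ^ 'n :: finite \<Rightarrow> ('k, 'n) geom_point set \<Rightarrow> int" where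
  "genus emb \<xi> C =
     Sup {divisor_degree D - int (rr_dim emb \<xi> C D) + 1 | D. is_divisor C D}"


section \<open>Generalized Weierstrass semigroups\<close>

text \<open>Tuples indexed by \<open>{1..m}\<close> are indexed by a finite type \<open>'m\<close> with \<open>m = CARD('m)\<close>.\<close>

definition size_of :: "int ^ 'm :: finite \<Rightarrow> int" where
  "size_of \<alpha> = (\<Sum>i\<in>UNIV. \<alpha> $ i)"

definition regular_outside ::
  "('k :: field \<Rightarrow> 'l :: field) \<Rightarrow> 'l ^ 'n :: finite \<Rightarrow> ('k, 'n) geom_point set \<Rightarrow>
     ('m :: finite \<Rightarrow> ('k, 'n) geom_point) \<Rightarrow> 'l set" where
  "regular_outside emb \<xi> C Q =
     {f \<in> function_field emb \<xi>. \<forall>P \<in> C - range Q. f \<in> local_ring emb \<xi> P}"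

definition weierstrass_semigroup ::
  "('k :: field \<Rightarrow> 'l :: field) \<Rightarrow> 'l ^ 'n :: finite \<Rightarrow> ('k, 'n) geom_point set \<Rightarrow>
     ('m :: finite \<Rightarrow> ('k, 'n) geom_point) \<Rightarrow> (int ^ 'm) set" where
  "weierstrass_semigroup emb \<xi> C Q =
     {(\<chi> i. - val emb \<xi> (Q i) f) | f. f \<in> regular_outside emb \<xi> C Q - {0}}"

definition symmetric_semigroup ::
  "('k :: field \<Rightarrow> 'l :: field) \<Rightarrow> 'l ^ 'n :: finite \<Rightarrow> ('k, 'n) geom_point set \<Rightarrow>
     ('m :: finite \<Rightarrow> ('k, 'n) geom_point) \<Rightarrow> bool" where
  "symmetric_semigroup emb \<xi> C Q \<longleftrightarrow>
     (\<exists>\<gamma>. \<gamma> \<notin> weierstrass_semigroup emb \<xi> C Q \<and> size_of \<gamma> = 2 * genus emb \<xi> C - 1)"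

definition nabla_at :: "(int ^ 'm :: finite) set \<Rightarrow> 'm \<Rightarrow> int ^ 'm \<Rightarrow> (int ^ 'm) set" where
  "nabla_at H i \<alpha> = {\<beta> \<in> H. \<beta> $ i = \<alpha> $ i \<and> (\<forall>j. j \<noteq> i \<longrightarrow> \<beta> $ j < \<alpha> $ j)}"

definition nabla :: "(int ^ 'm :: finite) set \<Rightarrow> int ^ 'm \<Rightarrow> (int ^ 'm) set" where
  "nabla H \<alpha> = (\<Union>i. nabla_at H i \<alpha>)"

definition maximal_elements :: "(int ^ 'm :: finite) set \<Rightarrow> (int ^ 'm) set" where
  "maximal_elements H = {\<alpha> \<in> H. nabla H \<alpha> = {}}"

definition divisor_of ::
  "('m :: finite \<Rightarrow> ('k :: field, 'n :: finite) geom_point) \<Rightarrow> int ^ 'm \<Rightarrow> ('k, 'n) geom_point \<Rightarrow> int" where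
  "divisor_of Q \<alpha> P = (\<Sum>i\<in>UNIV. if P = Q i then \<alpha> $ i else 0)"

definition ell ::
  "('k :: field \<Rightarrow> 'l :: field) \<Rightarrow> 'l ^ 'n :: finite \<Rightarrow> ('k, 'n) geom_point set \<Rightarrow>
     ('m :: finite \<Rightarrow> ('k, 'n) geom_point) \<Rightarrow> int ^ 'm \<Rightarrow> int" where
  "ell emb \<xi> C Q \<alpha> = int (rr_dim emb \<xi> C (divisor_of Q \<alpha>))"

definition ell_diff ::
  "('k :: field \<Rightarrow> 'l :: field) \<Rightarrow> 'l ^ 'n :: finite \<Rightarrow> ('k, 'n) geom_point set \<Rightarrow>
     ('m :: finite \<Rightarrow> ('k, 'n) geom_point) \<Rightarrow> 'm \<Rightarrow> int ^ 'm \<Rightarrow> int" where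
  "ell_diff emb \<xi> C Q i \<beta> = ell emb \<xi> C Q \<beta> - ell emb \<xi> C Q (\<beta> - axis i 1)"


section \<open>Formal series and the Poincare series\<close>

text \<open>A formal series is identified with its coefficient function, a Laurent polynomial with a
  finitely supported coefficient function.\<close>

type_synonym 'm formal_series = "int ^ 'm \<Rightarrow> int"
type_synonym 'm laurent_poly = "int ^ 'm \<Rightarrow>\<^sub>0 int"

definition laurent_times :: "('m :: finite) laurent_poly \<Rightarrow> 'm formal_series \<Rightarrow> 'm formal_series" where
  "laurent_times L A = (\<lambda>\<alpha>. \<Sum>\<beta>\<in>Poly_Mapping.keys L. Poly_Mapping.lookup L \<beta> * A (\<alpha> - \<beta>))"

text \<open>The substitution \<open>t \<mapsto> t^(-1)\<close>.\<close>

definition invert_vars :: "('m :: finite) formal_series \<Rightarrow> 'm formal_series" where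
  "invert_vars A = (\<lambda>\<alpha>. A (- \<alpha>))"

definition ind_vec :: "'m set \<Rightarrow> int ^ 'm :: finite" where
  "ind_vec J = (\<chi> j. if j \<in> J then 1 else 0)"

text \<open>The auxiliary index \<open>i\<close> does not matter, see the next lemma.\<close>

definition poincare_series ::
  "('k :: field \<Rightarrow> 'l :: field) \<Rightarrow> 'l ^ 'n :: finite \<Rightarrow> ('k, 'n) geom_point set \<Rightarrow>
     ('m :: finite \<Rightarrow> ('k, 'n) geom_point) \<Rightarrow> 'm \<Rightarrow> 'm formal_series" where
  "poincare_series emb \<xi> C Q i = (\<lambda>\<alpha>. (-1) ^ (CARD('m) - 1) *
     (\<Sum>J\<in>Pow (UNIV - {i}). (-1) ^ card J *
        ell_diff emb \<xi> C Q i (\<alpha> - ind_vec UNIV + ind_vec J + axis i 1)))"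

lemma poincare_series_index_irrelevant:
  fixes Q :: "'m :: finite \<Rightarrow> ('k :: field, 'n :: finite) geom_point"
  shows "poincare_series emb \<xi> C Q i = poincare_series emb \<xi> C Q j"
proof -
  have "poincare_series emb \<xi> C Q i \<alpha> =
      - ((-1) ^ (CARD('m) - 1)) * (\<Sum>J\<in>UNIV. (-1) ^ card J * ell emb \<xi> C Q (\<alpha> - ind_vec UNIV + ind_vec J))"
    for i :: 'm and \<alpha>
  proof -
    define F where "F J = (-1) ^ card J * ell emb \<xi> C Q (\<alpha> - ind_vec UNIV + ind_vec J)" for J
    have disj: "Pow (UNIV - {i}) \<inter> insert i ` Pow (UNIV - {i}) = {}" by auto
    have un: "Pow (UNIV - {i}) \<union> insert i ` Pow (UNIV - {i}) = UNIV"
      using Pow_insert[of i "UNIV - {i}"] by (simp add: insert_absorb)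
    have inj: "inj_on (insert i) (Pow (UNIV - {i}))"
      by (auto simp: inj_on_def)
    have "sum F UNIV = sum F (Pow (UNIV - {i})) + sum F (insert i ` Pow (UNIV - {i}))"
      using sum.union_disjoint[of "Pow (UNIV - {i})" "insert i ` Pow (UNIV - {i})" F] disj un by simp
    also have "sum F (insert i ` Pow (UNIV - {i})) = (\<Sum>J\<in>Pow (UNIV - {i}). F (insert i J))"
      using inj by (simp add: sum.reindex)
    finally have split: "sum F UNIV = (\<Sum>J\<in>Pow (UNIV - {i}). F J + F (insert i J))"
      by (simp add: sum.distrib)
    have "F J + F (insert i J) = - ((-1) ^ card J *
        ell_diff emb \<xi> C Q i (\<alpha> - ind_vec UNIV + ind_vec J + axis i 1))"
      if "J \<in> Pow (UNIV - {i})" for J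
    proof -
      have ni: "i \<notin> J" using that by auto
      have "ind_vec (insert i J) = ind_vec J + axis i 1"
        using ni by (auto simp: ind_vec_def axis_def vec_eq_iff)
      then show ?thesis
        using ni by (simp add: F_def ell_diff_def algebra_simps)
    qed
    then have "sum F UNIV = - (\<Sum>J\<in>Pow (UNIV - {i}). (-1) ^ card J *
        ell_diff emb \<xi> C Q i (\<alpha> - ind_vec UNIV + ind_vec J + axis i 1))"
      unfolding split by (simp add: sum_negf)
    then show ?thesis
      by (simp add: poincare_series_def F_def)
  qed
  then show ?thesis by (intro ext) simp
qed

end

theory Submission
  imports Defs
begin

text \<open>Write \<open>d i \<beta>\<close> for the jump \<open>ell \<beta> - ell (\<beta> - e_i)\<close>. Up to a sign, the coefficient of the Poincare
  series at \<open>\<alpha>\<close> is the alternating sum of \<open>d i (\<alpha> - 1 + 1_J + e_i)\<close> over the subsets \<open>J\<close> of the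
  indices other than \<open>i\<close>. Passing from \<open>J\<close> to its complement turns the coefficient at \<open>\<sigma> - \<alpha>\<close> into
  the same sum with \<open>d i \<beta>\<close> replaced by \<open>d i (\<sigma> - 1 - \<beta> + e_i)\<close>. Hence the functional equation follows
  from the duality \<open>d i \<beta> + d i (\<sigma> - 1 - \<beta> + e_i) = 1\<close>: the constant \<open>1\<close> disappears in an alternating
  sum over the subsets of a nonempty set (\<open>alternating_sum_dual\<close>).

  The residue field at a rational point is the ground field, so of two functions with the same pole
  order at \<open>Q i\<close> one is a scalar multiple of the other up to a smaller pole order. Therefore
  \<open>d i \<beta>\<close> is \<open>1\<close> if some element of the semigroup \<open>H\<close> lies below \<open>\<beta>\<close> and agrees with \<open>\<beta>\<close> at \<open>i\<close>, and
  \<open>0\<close> otherwise (\<open>ell_diff_eq\<close>), and the duality becomes a statement about \<open>H\<close> alone: such an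
  element exists if and only if \<open>nabla_at H i (\<sigma> - \<beta>)\<close> is empty (\<open>attained_dual\<close>). One direction is
  immediate from the self-duality of \<open>H\<close>. For the other, \<open>\<beta>\<close> is lowered away from \<open>i\<close> as far
  as \<open>nabla_at H i (\<sigma> - \<beta>)\<close> stays empty. At a minimal \<open>\<beta>\<close>, for each \<open>j \<noteq> i\<close> some element of \<open>H\<close>
  meets \<open>\<sigma> - \<beta>\<close> exactly at \<open>i\<close> and \<open>j\<close> and is smaller elsewhere; if \<open>nabla_at H j (\<sigma> - \<beta>)\<close>
  had an element, cancelling the two against each other at \<open>j\<close> would produce one in
  \<open>nabla_at H i (\<sigma> - \<beta>)\<close>. So all of \<open>nabla H (\<sigma> - \<beta>)\<close> is empty, and \<open>\<beta>\<close> itself belongs to \<open>H\<close>.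

  Two geometric facts are used. First, the local rings of the curve are discrete valuation rings.
  The point is that a function divisible by all powers of a uniformizer \<open>t\<close> is zero: it satisfies a
  polynomial relation with \<open>t\<close> because the function field has transcendence degree one
  (\<open>exists_algebraic_relation\<close>), and the lowest coefficient of the relation would be a unit
  divisible by \<open>t\<close>. Secondly, only finitely many elements of \<open>H\<close> lie below a given tuple, because Riemann-Roch
  spaces are finite; this comes down to the fact that a nonzero function with a zero has a pole
  (\<open>no_zero_without_pole\<close>). For such a function \<open>f\<close>, a place sending \<open>1 / f\<close> to \<open>0\<close> has a valuation
  ring as its domain; it specializes the generic point, scaled by its coordinate of
  largest value, to a point of the curve, and there \<open>f\<close> cannot be regular.\<close>


section \<open>Forms and their values\<close>

lemma ring_hom_zero: "is_ring_hom h \<Longrightarrow> h 0 = 0"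
  unfolding is_ring_hom_def by (metis add_cancel_right_right)

lemma ring_hom_uminus: "is_ring_hom h \<Longrightarrow> h (- x) = - h x"
  using ring_hom_zero[of h] unfolding is_ring_hom_def by (metis add_eq_0_iff)

lemma field_hom_nonzero:
  fixes h :: "'a :: field \<Rightarrow> 'b :: field"
  shows "is_ring_hom h \<Longrightarrow> x \<noteq> 0 \<Longrightarrow> h x \<noteq> 0"
  unfolding is_ring_hom_def by (metis mult_zero_left one_neq_zero right_inverse)

lemma field_hom_inverse:
  fixes h :: "'a :: field \<Rightarrow> 'b :: field"
  assumes "is_ring_hom h"
  shows "h (inverse x) = inverse (h x)"
proof (cases "x = 0")
  case False
  then have "h x * h (inverse x) = 1"
    using assms unfolding is_ring_hom_def by (metis right_inverse)
  then show ?thesis by (metis inverse_unique)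
qed (simp add: ring_hom_zero[OF assms])

lemma is_ring_hom_to_ac: "is_ring_hom to_ac"
  by (simp add: is_ring_hom_def)

abbreviation monomial_value :: "('n :: finite \<Rightarrow>\<^sub>0 nat) \<Rightarrow> 'b :: comm_ring_1 ^ 'n \<Rightarrow> 'b" where
  "monomial_value u x \<equiv> (\<Prod>i\<in>UNIV. (x $ i) ^ Poly_Mapping.lookup u i)"

text \<open>Sums and products of polynomials have different supports, so their values are compared over a
  common finite set of exponents.\<close>

lemma eval_at_superset:
  assumes "is_ring_hom h" "finite A" "Poly_Mapping.keys f \<subseteq> A"
  shows "eval_at h f x = (\<Sum>u\<in>A. h (Poly_Mapping.lookup f u) * monomial_value u x)"
  unfolding eval_at_def
  by (rule sum.mono_neutral_left)
     (use assms in \<open>auto simp: ring_hom_zero in_keys_iff\<close>)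

lemma eval_at_zero [simp]: "eval_at h 0 x = 0"
  by (simp add: eval_at_def)

lemma eval_at_add:
  assumes "is_ring_hom h"
  shows "eval_at h (f + g) x = eval_at h f x + eval_at h g x"
proof -
  let ?A = "Poly_Mapping.keys f \<union> Poly_Mapping.keys g"
  have A: "finite ?A" by simp
  have *: "eval_at h p x = (\<Sum>u\<in>?A. h (Poly_Mapping.lookup p u) * monomial_value u x)"
    if "Poly_Mapping.keys p \<subseteq> ?A" for p
    by (rule eval_at_superset[OF assms A that])
  show ?thesis
    using assms Poly_Mapping.keys_add[of f g]
    by (simp add: * lookup_add is_ring_hom_def distrib_right sum.distrib)
qed

lemma eval_at_uminus:
  assumes "is_ring_hom h"
  shows "eval_at h (- f) x = - eval_at h f x"
  by (simp add: eval_at_def ring_hom_uminus[OF assms] sum_negf)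

lemma eval_at_diff:
  assumes "is_ring_hom h"
  shows "eval_at h (f - g) x = eval_at h f x - eval_at h g x"
  using eval_at_add[OF assms, of f "- g" x] by (simp add: eval_at_uminus[OF assms])

lemma eval_at_sum:
  assumes "is_ring_hom h"
  shows "eval_at h (sum F A) x = (\<Sum>a\<in>A. eval_at h (F a) x)"
  by (induction A rule: infinite_finite_induct) (auto simp: eval_at_add[OF assms])

lemma eval_at_single:
  assumes "is_ring_hom h"
  shows "eval_at h (Poly_Mapping.single u c) x = h c * monomial_value u x"
  by (cases "c = 0") (auto simp: eval_at_def ring_hom_zero[OF assms])

lemma poly_mapping_sum_singles:
  fixes f :: "'a \<Rightarrow>\<^sub>0 'b :: comm_monoid_add"
  shows "f = (\<Sum>u\<in>Poly_Mapping.keys f. Poly_Mapping.single u (Poly_Mapping.lookup f u))"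
proof (rule poly_mapping_eqI)
  fix k
  have "(\<Sum>u\<in>Poly_Mapping.keys f. Poly_Mapping.lookup (Poly_Mapping.single u (Poly_Mapping.lookup f u)) k)
      = (\<Sum>u\<in>Poly_Mapping.keys f. if u = k then Poly_Mapping.lookup f k else 0)"
    by (rule sum.cong) (auto simp: lookup_single when_def)
  then show "Poly_Mapping.lookup f k = Poly_Mapping.lookup
      (\<Sum>u\<in>Poly_Mapping.keys f. Poly_Mapping.single u (Poly_Mapping.lookup f u)) k"
    by (auto simp: lookup_sum sum.delta in_keys_iff)
qed

lemma eval_at_mult:
  fixes f g :: "('n :: finite, 'a :: comm_ring_1) mpoly"
  assumes h: "is_ring_hom h"
  shows "eval_at h (f * g) x = eval_at h f x * eval_at h g x"
proof -
  let ?s = "\<lambda>f u. Poly_Mapping.single u (Poly_Mapping.lookup f u)"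
  have mv: "monomial_value (u + v) x = monomial_value u x * monomial_value v x" for u v
    by (simp add: lookup_add power_add prod.distrib)
  have "f * g = (\<Sum>u\<in>Poly_Mapping.keys f. ?s f u) * (\<Sum>v\<in>Poly_Mapping.keys g. ?s g v)"
    using poly_mapping_sum_singles[of f] poly_mapping_sum_singles[of g] by simp
  also have "\<dots> = (\<Sum>u\<in>Poly_Mapping.keys f. \<Sum>v\<in>Poly_Mapping.keys g.
      Poly_Mapping.single (u + v) (Poly_Mapping.lookup f u * Poly_Mapping.lookup g v))"
    by (simp add: sum_product mult_single)
  finally have "eval_at h (f * g) x = (\<Sum>u\<in>Poly_Mapping.keys f. \<Sum>v\<in>Poly_Mapping.keys g.
      h (Poly_Mapping.lookup f u * Poly_Mapping.lookup g v) * monomial_value (u + v) x)"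
    by (simp add: eval_at_sum[OF h] eval_at_single[OF h])
  also have "\<dots> = eval_at h f x * eval_at h g x"
    unfolding eval_at_def sum_product
    using h by (intro sum.cong refl) (simp add: mv is_ring_hom_def mult_ac)
  finally show ?thesis .
qed

lemma homogeneous_add: "homogeneous d f \<Longrightarrow> homogeneous d g \<Longrightarrow> homogeneous d (f + g)"
  using Poly_Mapping.keys_add[of f g] by (auto simp: homogeneous_def)

lemma homogeneous_diff:
  fixes f g :: "('n :: finite, 'a :: comm_ring_1) mpoly"
  shows "homogeneous d f \<Longrightarrow> homogeneous d g \<Longrightarrow> homogeneous d (f - g)"
  using homogeneous_add[of d f "- g"] by (simp add: homogeneous_def in_keys_iff)

lemma homogeneous_mult:
  fixes f g :: "('n :: finite, 'a :: comm_ring_1) mpoly"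
  assumes "homogeneous d f" "homogeneous e g"
  shows "homogeneous (d + e) (f * g)"
  unfolding homogeneous_def
proof
  fix w assume "w \<in> Poly_Mapping.keys (f * g)"
  then obtain u v where "u \<in> Poly_Mapping.keys f" "v \<in> Poly_Mapping.keys g" "w = u + v"
    using Poly_Mapping.keys_mult[of f g] by blast
  then show "(\<Sum>i\<in>UNIV. Poly_Mapping.lookup w i) = d + e"
    using assms by (simp add: homogeneous_def lookup_add sum.distrib)
qed

definition coordinate_power :: "'n :: finite \<Rightarrow> nat \<Rightarrow> 'a :: comm_ring_1 \<Rightarrow> ('n, 'a) mpoly" where
  "coordinate_power l d c = Poly_Mapping.single (Poly_Mapping.single l d) c"

lemma homogeneous_coordinate_power: "homogeneous d (coordinate_power l d c)"
  by (simp add: homogeneous_def coordinate_power_def lookup_single when_def sum.delta)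

lemma eval_at_coordinate_power:
  assumes "is_ring_hom h"
  shows "eval_at h (coordinate_power l d c) x = h c * (x $ l) ^ d"
proof -
  have "monomial_value (Poly_Mapping.single l d) x = (\<Prod>i\<in>UNIV. if i = l then (x $ l) ^ d else 1)"
    by (rule prod.cong) (auto simp: lookup_single when_def)
  then show ?thesis
    by (simp add: coordinate_power_def eval_at_single[OF assms] prod.delta)
qed

lemma eval_at_scale:
  assumes "homogeneous d f"
  shows "eval_at h f (c *s x) = c ^ d * eval_at h f x"
proof -
  have "monomial_value u (c *s x) = c ^ d * monomial_value u x" if "u \<in> Poly_Mapping.keys f" for u
  proof -
    have "monomial_value u (c *s x) = (\<Prod>i\<in>UNIV. c ^ Poly_Mapping.lookup u i) * monomial_value u x"
      by (simp add: power_mult_distrib prod.distrib)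
    also have "(\<Prod>i\<in>UNIV. c ^ Poly_Mapping.lookup u i) = c ^ d"
      using assms that by (simp add: homogeneous_def power_sum[symmetric])
    finally show ?thesis .
  qed
  then show ?thesis
    by (simp add: eval_at_def sum_distrib_left mult_ac cong: sum.cong)
qed

lemma vanishes_at_proj_point:
  assumes "homogeneous d f"
  shows "vanishes_at h f (proj_point x) \<longleftrightarrow> eval_at h f x = 0"
proof
  assume "vanishes_at h f (proj_point x)"
  moreover have "x \<in> proj_point x"
    by (auto simp: proj_point_def intro!: exI[of _ 1])
  ultimately show "eval_at h f x = 0" by (simp add: vanishes_at_def)
next
  assume "eval_at h f x = 0"
  then show "vanishes_at h f (proj_point x)"
    by (auto simp: vanishes_at_def proj_point_def eval_at_scale[OF assms])
qed


section \<open>Duality in the semigroup\<close>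

text \<open>This says that \<open>\<beta>\<close> is the pole bound of a function whose pole order at the \<open>i\<close>-th point is exactly
  \<open>\<beta> $ i\<close>; for the semigroup of a curve it means that the jump of \<open>ell\<close> at \<open>\<beta>\<close> in direction \<open>i\<close> is \<open>1\<close>.\<close>

definition attained :: "(int ^ 'm :: finite) set \<Rightarrow> 'm \<Rightarrow> int ^ 'm \<Rightarrow> bool" where
  "attained H i \<beta> \<longleftrightarrow> (\<exists>\<gamma>\<in>H. (\<forall>j. \<gamma> $ j \<le> \<beta> $ j) \<and> \<gamma> $ i = \<beta> $ i)"

lemma nabla_at_empty_iff_not_attained:
  "nabla_at H i \<alpha> = {} \<longleftrightarrow> \<not> attained H i (\<alpha> - ind_vec UNIV + axis i 1)"
proof -
  have "\<beta> $ i = \<alpha> $ i \<and> (\<forall>j. j \<noteq> i \<longrightarrow> \<beta> $ j < \<alpha> $ j) \<longleftrightarrow>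
      (\<forall>j. \<beta> $ j \<le> (\<alpha> - ind_vec UNIV + axis i 1) $ j) \<and> \<beta> $ i = (\<alpha> - ind_vec UNIV + axis i 1) $ i"
    for \<beta> :: "int ^ 'a"
    by (auto simp: ind_vec_def axis_def)
  then show ?thesis
    by (auto simp: nabla_at_def attained_def)
qed

text \<open>The combinatorial content of the semigroup of a curve: subtracting a suitable multiple of one
  function from another lowers a common pole order, and pole orders bounded above form a finite set.\<close>

locale self_dual_semigroup =
  fixes H :: "(int ^ 'm :: finite) set" and \<sigma> :: "int ^ 'm"
  assumes cancel: "\<And>\<gamma> \<delta> i. \<gamma> \<in> H \<Longrightarrow> \<delta> \<in> H \<Longrightarrow> \<gamma> \<noteq> \<delta> \<Longrightarrow> \<gamma> $ i = \<delta> $ i \<Longrightarrow>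
      \<exists>\<epsilon>\<in>H. \<epsilon> $ i < \<gamma> $ i \<and> (\<forall>j. \<epsilon> $ j \<le> max (\<gamma> $ j) (\<delta> $ j)) \<and>
        (\<forall>j. \<gamma> $ j \<noteq> \<delta> $ j \<longrightarrow> \<epsilon> $ j = max (\<gamma> $ j) (\<delta> $ j))"
    and finite_below: "\<And>\<alpha>. finite {\<beta> \<in> H. \<forall>j. \<beta> $ j \<le> \<alpha> $ j}"
    and dual: "\<And>\<beta>. \<beta> \<in> H \<longleftrightarrow> nabla H (\<sigma> - \<beta>) = {}"
begin

text \<open>An element below \<open>\<beta>\<close> with the same \<open>i\<close>-th entry has a larger reflection, whose \<open>nabla\<close> is empty by
  duality.\<close>

lemma nabla_at_empty_of_attained:
  assumes "attained H i \<beta>"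
  shows "nabla_at H i (\<sigma> - \<beta>) = {}"
proof -
  obtain \<gamma> where \<gamma>: "\<gamma> \<in> H" "\<And>j. \<gamma> $ j \<le> \<beta> $ j" "\<gamma> $ i = \<beta> $ i"
    using assms by (auto simp: attained_def)
  have "nabla_at H i (\<sigma> - \<beta>) \<subseteq> nabla_at H i (\<sigma> - \<gamma>)"
  proof
    fix \<delta> assume \<delta>: "\<delta> \<in> nabla_at H i (\<sigma> - \<beta>)"
    have "\<delta> $ j < \<sigma> $ j - \<gamma> $ j" if "j \<noteq> i" for j
    proof -
      have "\<delta> $ j < \<sigma> $ j - \<beta> $ j"
        using \<delta> that by (simp add: nabla_at_def)
      then show ?thesis using \<gamma>(2)[of j] by linarith
    qed
    then show "\<delta> \<in> nabla_at H i (\<sigma> - \<gamma>)"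
      using \<delta> \<gamma>(3) by (simp add: nabla_at_def)
  qed
  also have "nabla_at H i (\<sigma> - \<gamma>) = {}"
    using \<gamma>(1) dual[of \<gamma>] by (auto simp: nabla_def)
  finally show ?thesis by simp
qed

text \<open>Raising a single entry of \<open>\<beta>\<close> far enough pushes \<open>\<sigma> - \<beta>\<close> below the finitely many elements that
  could belong to its \<open>nabla\<close>. This bounds the descent below.\<close>

lemma contains_far_in_direction:
  obtains N where "\<And>\<gamma>. N \<le> \<gamma> $ j \<Longrightarrow> (\<And>k. k \<noteq> j \<Longrightarrow> \<gamma> $ k = \<beta> $ k) \<Longrightarrow> \<gamma> \<in> H"
proof -
  define S where "S = {\<delta> \<in> H. \<forall>k. \<delta> $ k \<le> (\<sigma> - \<beta>) $ k}"
  have "finite ((\<lambda>\<delta>. \<delta> $ j) ` S)"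
    unfolding S_def using finite_below by (rule finite_imageI)
  then obtain b where b: "\<And>\<delta>. \<delta> \<in> S \<Longrightarrow> b \<le> \<delta> $ j"
    using bdd_below_finite[of "(\<lambda>\<delta>. \<delta> $ j) ` S"] by (auto simp: bdd_below_def)
  show thesis
  proof (rule that[of "max (\<beta> $ j) (\<sigma> $ j - b + 1)"])
    fix \<gamma> assume \<gamma>: "max (\<beta> $ j) (\<sigma> $ j - b + 1) \<le> \<gamma> $ j" "\<And>k. k \<noteq> j \<Longrightarrow> \<gamma> $ k = \<beta> $ k"
    have False if "\<delta> \<in> nabla_at H k (\<sigma> - \<gamma>)" for \<delta> k
    proof -
      have le: "\<delta> $ l \<le> \<sigma> $ l - \<gamma> $ l" for l
        using that by (cases "l = k") (auto simp: nabla_at_def less_imp_le)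
      have "\<delta> $ l \<le> \<sigma> $ l - \<beta> $ l" for l
        using le[of l] \<gamma> by (cases "l = j") auto
      then have "\<delta> \<in> S"
        using that by (simp add: S_def nabla_at_def)
      then show False
        using b[of \<delta>] le[of j] \<gamma>(1) by simp
    qed
    then show "\<gamma> \<in> H"
      using dual[of \<gamma>] by (auto simp: nabla_def)
  qed
qed

text \<open>The minimal tuple in the descent is a member of \<open>H\<close>: an element of \<open>nabla_at H j\<close> could be
  cancelled at \<open>j\<close> against the obstruction to lowering the \<open>j\<close>-th entry.\<close>

lemma attained_of_nabla_at_empty:
  assumes "nabla_at H i (\<sigma> - \<beta>) = {}"
  shows "attained H i \<beta>"
proof -
  define T where "T = {\<beta>'. (\<forall>j. \<beta>' $ j \<le> \<beta> $ j) \<and> \<beta>' $ i = \<beta> $ i \<and> nabla_at H i (\<sigma> - \<beta>') = {}}"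
  have "\<exists>c. \<forall>\<beta>'\<in>T. c \<le> \<beta>' $ j" for j
  proof (cases "j = i")
    case True
    then show ?thesis by (auto simp: T_def)
  next
    case False
    \<comment> \<open>Raised at \<open>j\<close>, this tuple lies in \<open>H\<close> and obstructs every member of \<open>T\<close> that is too small at \<open>j\<close>.\<close>
    define \<delta>\<^sub>0 where "\<delta>\<^sub>0 = (\<chi> k. if k = i then \<sigma> $ i - \<beta> $ i else \<sigma> $ k - \<beta> $ k - 1)"
    obtain N where N: "\<And>\<gamma>. N \<le> \<gamma> $ j \<Longrightarrow> (\<And>k. k \<noteq> j \<Longrightarrow> \<gamma> $ k = \<delta>\<^sub>0 $ k) \<Longrightarrow> \<gamma> \<in> H"
      using contains_far_in_direction by blast
    define \<delta> where "\<delta> = (\<chi> k. if k = j then N else \<delta>\<^sub>0 $ k)"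
    have \<delta>: "\<delta> \<in> H" by (rule N) (auto simp: \<delta>_def)
    have "\<sigma> $ j - N \<le> \<beta>' $ j" if \<beta>': "\<beta>' \<in> T" for \<beta>'
    proof (rule ccontr)
      assume lt: "\<not> \<sigma> $ j - N \<le> \<beta>' $ j"
      have "\<delta> $ k < \<sigma> $ k - \<beta>' $ k" if "k \<noteq> i" for k
      proof -
        have "\<beta>' $ k \<le> \<beta> $ k" using \<beta>' by (simp add: T_def)
        then show ?thesis using lt that by (auto simp: \<delta>_def \<delta>\<^sub>0_def)
      qed
      then have "\<delta> \<in> nabla_at H i (\<sigma> - \<beta>')"
        using \<delta> \<beta>' False by (simp add: nabla_at_def T_def \<delta>_def \<delta>\<^sub>0_def)
      then show False using \<beta>' by (auto simp: T_def)
    qed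
    then show ?thesis by blast
  qed
  then obtain c where c: "\<And>j \<beta>'. \<beta>' \<in> T \<Longrightarrow> c j \<le> \<beta>' $ j" by metis
  define \<mu> where "\<mu> \<beta>' = (\<Sum>j\<in>UNIV. \<beta>' $ j - c j)" for \<beta>'
  have \<mu>_nonneg: "0 \<le> \<mu> \<beta>'" if "\<beta>' \<in> T" for \<beta>'
    unfolding \<mu>_def using c[OF that] by (intro sum_nonneg) simp
  have "\<beta> \<in> T" using assms by (simp add: T_def)
  then obtain \<beta>' where \<beta>': "\<beta>' \<in> T" and min: "\<And>\<gamma>. \<gamma> \<in> T \<Longrightarrow> nat (\<mu> \<beta>') \<le> nat (\<mu> \<gamma>)"
    using ex_has_least_nat[of "\<lambda>\<gamma>. \<gamma> \<in> T" \<beta> "\<lambda>\<gamma>. nat (\<mu> \<gamma>)"] by blast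
  have "nabla_at H j (\<sigma> - \<beta>') = {}" for j
  proof (cases "j = i")
    case True
    then show ?thesis using \<beta>' by (simp add: T_def)
  next
    case False
    \<comment> \<open>By minimality \<open>\<beta>'\<close> cannot be lowered at \<open>j\<close>; the obstruction \<open>\<delta>\<close> touches \<open>\<sigma> - \<beta>'\<close> at \<open>i\<close> and \<open>j\<close>.\<close>
    define \<gamma> where "\<gamma> = \<beta>' - axis j 1"
    have "\<mu> \<beta>' = \<mu> \<gamma> + 1"
      by (simp add: \<mu>_def \<gamma>_def sum_subtractf axis_def sum.delta)
    then have "\<gamma> \<notin> T"
      using min[of \<gamma>] \<mu>_nonneg[of \<gamma>] by auto
    moreover have "\<gamma> $ k \<le> \<beta> $ k" for k
      using \<beta>' by (auto simp: \<gamma>_def axis_def T_def intro: order_trans[of _ "\<beta>' $ k"])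
    moreover have "\<gamma> $ i = \<beta> $ i"
      using False \<beta>' by (simp add: \<gamma>_def axis_def T_def)
    ultimately obtain \<delta> where \<delta>: "\<delta> \<in> nabla_at H i (\<sigma> - \<gamma>)"
      by (auto simp: T_def)
    have \<delta>_lt: "\<delta> $ k < \<sigma> $ k - \<beta>' $ k" if "k \<noteq> i" "k \<noteq> j" for k
      using \<delta> that by (auto simp: nabla_at_def \<gamma>_def axis_def)
    have \<delta>_i: "\<delta> $ i = \<sigma> $ i - \<beta>' $ i"
      using \<delta> False by (auto simp: nabla_at_def \<gamma>_def axis_def)
    have "\<delta> $ j \<le> \<sigma> $ j - \<beta>' $ j"
      using \<delta> False by (auto simp: nabla_at_def \<gamma>_def axis_def dest: spec[of _ j])
    moreover have "\<not> \<delta> $ j < \<sigma> $ j - \<beta>' $ j"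
    proof
      assume "\<delta> $ j < \<sigma> $ j - \<beta>' $ j"
      then have "\<delta> \<in> nabla_at H i (\<sigma> - \<beta>')"
        using \<delta> \<delta>_lt \<delta>_i by (auto simp: nabla_at_def)
      then show False using \<beta>' by (simp add: T_def)
    qed
    ultimately have \<delta>_j: "\<delta> $ j = \<sigma> $ j - \<beta>' $ j" by simp
    have False if \<delta>': "\<delta>' \<in> nabla_at H j (\<sigma> - \<beta>')" for \<delta>'
    proof -
      have \<delta>'_lt: "\<delta>' $ k < \<sigma> $ k - \<beta>' $ k" if "k \<noteq> j" for k
        using \<delta>' that by (auto simp: nabla_at_def)
      have ne: "\<delta> $ i \<noteq> \<delta>' $ i"
        using \<delta>'_lt[of i] \<delta>_i False by simp
      have "\<delta> $ j = \<delta>' $ j" using \<delta>_j \<delta>' by (simp add: nabla_at_def)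
      then obtain \<epsilon> where \<epsilon>: "\<epsilon> \<in> H" "\<epsilon> $ j < \<delta> $ j" "\<And>k. \<epsilon> $ k \<le> max (\<delta> $ k) (\<delta>' $ k)"
        "\<And>k. \<delta> $ k \<noteq> \<delta>' $ k \<Longrightarrow> \<epsilon> $ k = max (\<delta> $ k) (\<delta>' $ k)"
        using cancel[of \<delta> \<delta>' j] \<delta> \<delta>' ne unfolding nabla_at_def by blast
      have "\<epsilon> $ i = \<sigma> $ i - \<beta>' $ i"
        using \<epsilon>(4)[OF ne] \<delta>_i \<delta>'_lt[of i] False by simp
      moreover have "\<epsilon> $ k < \<sigma> $ k - \<beta>' $ k" if "k \<noteq> i" for k
      proof (cases "k = j")
        case True
        then show ?thesis using \<epsilon>(2) \<delta>_j by simp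
      next
        case False
        then show ?thesis using \<epsilon>(3)[of k] \<delta>_lt[of k] \<delta>'_lt[of k] that by linarith
      qed
      ultimately have "\<epsilon> \<in> nabla_at H i (\<sigma> - \<beta>')"
        using \<epsilon>(1) by (simp add: nabla_at_def)
      then show False using \<beta>' by (simp add: T_def)
    qed
    then show ?thesis by blast
  qed
  then have "\<beta>' \<in> H"
    using dual[of \<beta>'] by (simp add: nabla_def)
  then show ?thesis
    using \<beta>' by (auto simp: attained_def T_def)
qed

lemma attained_dual:
  "attained H i \<beta> \<longleftrightarrow> \<not> attained H i (\<sigma> - \<beta> - ind_vec UNIV + axis i 1)"
  using nabla_at_empty_of_attained attained_of_nabla_at_empty
    nabla_at_empty_iff_not_attained[of H i "\<sigma> - \<beta>"] by blast

end

lemma sum_alternating_Pow: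
  assumes "finite A" "A \<noteq> {}"
  shows "(\<Sum>J\<in>Pow A. (-1) ^ card J) = (0 :: int)"
proof -
  have "card {J. J \<subseteq> A \<and> even (card J)} = card {J. J \<subseteq> A \<and> odd (card J)}"
    using card_subsupersets_even_odd[of A "{}"] assms by auto
  then show ?thesis
    using assms by (intro sum_alternating_cancels) auto
qed

text \<open>The complement of \<open>J\<close> among the indices other than \<open>i\<close> corresponds to the reflection
  \<open>\<beta> \<mapsto> \<sigma> - 1 - \<beta> + e_i\<close>; the assumption on the number of indices makes this index set nonempty, so
  that the contribution of the constant \<open>1\<close> cancels.\<close>

lemma alternating_sum_dual:
  fixes d :: "int ^ 'm :: finite \<Rightarrow> int"
  assumes dual: "\<And>\<beta>. d \<beta> + d (\<sigma> - \<beta> - ind_vec UNIV + axis i 1) = 1"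
    and m: "CARD('m) \<ge> 2"
  defines "p \<equiv> (\<lambda>\<alpha>. \<Sum>J\<in>Pow (UNIV - {i}). (-1) ^ card J * d (\<alpha> - ind_vec UNIV + ind_vec J + axis i 1))"
  shows "p \<alpha> = (-1) ^ CARD('m) * p (\<sigma> - \<alpha>)"
proof -
  let ?I = "UNIV - {i}"
  have cI: "card ?I = CARD('m) - 1" by simp
  have ne: "?I \<noteq> {}" 
  proof
    assume "?I = {}"
    then have "card ?I = 0" by (simp only: card.empty)
    then show False using m cI by linarith
  qed
  define F where "F J = (-1) ^ card J * d (\<alpha> - ind_vec UNIV + ind_vec J + axis i 1)" for J
  have bij: "bij_betw (\<lambda>J. ?I - J) (Pow ?I) (Pow ?I)"
    by (rule bij_betwI[of _ _ _ "\<lambda>J. ?I - J"]) auto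
  have "p (\<sigma> - \<alpha>) = (\<Sum>J\<in>Pow ?I. (-1) ^ card (?I - J) * d (\<sigma> - \<alpha> - ind_vec UNIV + ind_vec (?I - J) + axis i 1))"
    unfolding p_def by (rule sum.reindex_bij_betw[OF bij, symmetric])
  also have "\<dots> = (\<Sum>J\<in>Pow ?I. (-1) ^ CARD('m) * F J - (-1) ^ CARD('m) * (-1) ^ card J)"
  proof (rule sum.cong)
    fix J assume J: "J \<in> Pow ?I"
    then have le: "card J \<le> CARD('m) - 1"
      using card_mono[of ?I J] cI by simp
    have "card (?I - J) = CARD('m) - 1 - card J"
      using J cI by (simp add: card_Diff_subset)
    then have "CARD('m) + card J = Suc (card (?I - J) + 2 * card J)"
      using le m by simp
    then have eq: "CARD('m) + card J = Suc (card (?I - J) + 2 * card J)" .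
    have "(-1::int) ^ CARD('m) * (-1) ^ card J = (-1) ^ (CARD('m) + card J)"
      by (simp only: power_add)
    also have "\<dots> = (-1) ^ Suc (card (?I - J) + 2 * card J)"
      by (simp only: eq)
    also have "\<dots> = - ((-1) ^ card (?I - J))"
      by (simp add: power_add power_mult)
    finally have sign: "(-1::int) ^ card (?I - J) = - ((-1) ^ CARD('m) * (-1) ^ card J)"
      by simp
    have "ind_vec (?I - J) = ind_vec UNIV - ind_vec J - axis i 1"
      using J by (auto simp: ind_vec_def axis_def vec_eq_iff)
    then have "\<sigma> - \<alpha> - ind_vec UNIV + ind_vec (?I - J) + axis i 1 =
        \<sigma> - (\<alpha> - ind_vec UNIV + ind_vec J + axis i 1) - ind_vec UNIV + axis i 1"
      by (simp add: algebra_simps)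
    note eq_arg = this
    have "d (\<sigma> - \<alpha> - ind_vec UNIV + ind_vec (?I - J) + axis i 1) =
        1 - d (\<alpha> - ind_vec UNIV + ind_vec J + axis i 1)"
      using dual[of "\<alpha> - ind_vec UNIV + ind_vec J + axis i 1"] unfolding eq_arg by linarith
    note D = this
    show "(-1) ^ card (?I - J) * d (\<sigma> - \<alpha> - ind_vec UNIV + ind_vec (?I - J) + axis i 1)
        = (-1) ^ CARD('m) * F J - (-1) ^ CARD('m) * (-1) ^ card J"
      unfolding D sign F_def by (simp only: right_diff_distrib mult_minus_left mult_1_right mult.assoc)
  qed simp
  also have "\<dots> = (-1) ^ CARD('m) * p \<alpha>"
    using sum_alternating_Pow[of ?I] ne
    by (simp add: sum_subtractf p_def F_def sum_distrib_left[symmetric])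
  finally show ?thesis by simp
qed


section \<open>Algebraic dependence of two functions\<close>

definition poly_values :: "('k :: field \<Rightarrow> 'l :: field) \<Rightarrow> 'l \<Rightarrow> 'l set" where
  "poly_values emb t = {poly p t | p. \<forall>n. coeff p n \<in> range emb}"

context
  fixes emb :: "'k :: field \<Rightarrow> 'l :: field"
  assumes emb: "is_ring_hom emb"
begin

lemma range_emb_closed:
  "0 \<in> range emb" "1 \<in> range emb"
  "a \<in> range emb \<Longrightarrow> b \<in> range emb \<Longrightarrow> a + b \<in> range emb"
  "a \<in> range emb \<Longrightarrow> b \<in> range emb \<Longrightarrow> a * b \<in> range emb"
  "a \<in> range emb \<Longrightarrow> - a \<in> range emb"
proof -
  show "0 \<in> range emb" using ring_hom_zero[OF emb] by (metis rangeI)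
  show "1 \<in> range emb" using emb unfolding is_ring_hom_def by (metis rangeI)
  show "a \<in> range emb \<Longrightarrow> b \<in> range emb \<Longrightarrow> a + b \<in> range emb"
    using emb unfolding is_ring_hom_def by (metis (no_types, lifting) imageE rangeI)
  show "a \<in> range emb \<Longrightarrow> b \<in> range emb \<Longrightarrow> a * b \<in> range emb"
    using emb unfolding is_ring_hom_def by (metis (no_types, lifting) imageE rangeI)
  show "a \<in> range emb \<Longrightarrow> - a \<in> range emb"
    using ring_hom_uminus[OF emb] by (metis (no_types, lifting) imageE rangeI)
qed

lemma range_emb_sum: "(\<And>a. a \<in> A \<Longrightarrow> f a \<in> range emb) \<Longrightarrow> sum f A \<in> range emb"
  by (induction A rule: infinite_finite_induct) (simp_all add: range_emb_closed)

lemma poly_values_mult: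
  assumes "a \<in> poly_values emb t" "b \<in> poly_values emb t"
  shows "a * b \<in> poly_values emb t"
proof -
  obtain p q where p: "a = poly p t" "\<And>n. coeff p n \<in> range emb"
    and q: "b = poly q t" "\<And>n. coeff q n \<in> range emb"
    using assms unfolding poly_values_def by blast
  have "coeff (p * q) n \<in> range emb" for n
    unfolding coeff_mult by (intro range_emb_sum range_emb_closed(4) p(2) q(2))
  then show ?thesis
    unfolding poly_values_def using p(1) q(1) by (auto intro!: exI[of _ "p * q"])
qed

lemma poly_values_zero: "0 \<in> poly_values emb t"
  unfolding poly_values_def using range_emb_closed(1) by (auto intro!: exI[of _ 0])

lemma poly_values_one: "1 \<in> poly_values emb t"
  unfolding poly_values_def using range_emb_closed(1,2)
  by (auto intro!: exI[of _ 1] simp: coeff_1)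

lemma poly_values_uminus: "a \<in> poly_values emb t \<Longrightarrow> - a \<in> poly_values emb t"
proof -
  assume "a \<in> poly_values emb t"
  then obtain p where p: "a = poly p t" "\<And>n. coeff p n \<in> range emb"
    unfolding poly_values_def by blast
  have "coeff (- p) n \<in> range emb" for n
    using range_emb_closed(5)[OF p(2)] by simp
  then show ?thesis
    unfolding poly_values_def using p(1) by (auto intro!: exI[of _ "- p"])
qed

lemma poly_values_power: "a \<in> poly_values emb t \<Longrightarrow> a ^ n \<in> poly_values emb t"
  by (induction n) (simp_all add: poly_values_one poly_values_mult)

lemma simple_ext_fraction:
  assumes "x \<in> simple_ext emb t"
  obtains a b where "a \<in> poly_values emb t" "b \<in> poly_values emb t" "b \<noteq> 0" "x = a / b"
proof -
  obtain p q where pq: "x = poly (map_poly emb p) t / poly (map_poly emb q) t"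
    "poly (map_poly emb q) t \<noteq> 0"
    using assms unfolding simple_ext_def by blast
  have "poly (map_poly emb r) t \<in> poly_values emb t" for r
    unfolding poly_values_def by (auto simp: coeff_map_poly ring_hom_zero[OF emb])
  then show thesis using that pq by blast
qed

text \<open>Induction on the coefficients, multiplying the denominators together.\<close>

lemma common_denominator:
  fixes P :: "'l poly"
  assumes "\<And>j. coeff P j \<in> simple_ext emb t"
  shows "\<exists>d\<in>poly_values emb t. d \<noteq> 0 \<and> (\<forall>j. d * coeff P j \<in> poly_values emb t)"
  using assms
proof (induction P)
  case 0
  then show ?case using poly_values_zero poly_values_one by (intro bexI[of _ 1]) simp_all
next
  case (pCons a P)
  have "coeff P j \<in> simple_ext emb t" for j
    using pCons.prems[of "Suc j"] by simp
  then obtain d where d: "d \<in> poly_values emb t" "d \<noteq> 0"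
    "\<And>j. d * coeff P j \<in> poly_values emb t"
    using pCons.IH by blast
  obtain b c where bc: "b \<in> poly_values emb t" "c \<in> poly_values emb t" "c \<noteq> 0" "a = b / c"
    using simple_ext_fraction pCons.prems[of 0] by (metis coeff_pCons_0)
  have "c * d * coeff (pCons a P) j \<in> poly_values emb t" for j
  proof (cases j)
    case 0
    have "c * d * coeff (pCons a P) j = b * d" using bc(3,4) 0 by simp
    then show ?thesis using poly_values_mult[OF bc(1) d(1)] by (simp only:)
  next
    case (Suc k)
    have "c * d * coeff (pCons a P) j = c * (d * coeff P k)" using Suc by simp
    then show ?thesis using poly_values_mult[OF bc(2) d(3)] by (simp only:)
  qed
  then show ?case
    using poly_values_mult[OF bc(2) d(1)] bc(3) d(2) by (intro bexI[of _ "c * d"]) auto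
qed

text \<open>Multiplying by a leading coefficient turns an algebraic element into an integral one.\<close>

lemma integral_multiple:
  fixes P :: "'l poly"
  assumes "P \<noteq> 0" "\<And>j. coeff P j \<in> simple_ext emb t" "poly P f = 0"
  obtains a c r where "a > 0" "c \<noteq> 0" "c \<in> poly_values emb t"
    "\<And>v. r v \<in> poly_values emb t" "(c * f) ^ a = (\<Sum>v<a. r v * (c * f) ^ v)"
proof -
  obtain d where d: "d \<in> poly_values emb t" "d \<noteq> 0"
    "\<And>j. d * coeff P j \<in> poly_values emb t"
    using common_denominator[of P t, OF assms(2)] by (elim bexE conjE) (rule that; blast)
  define a where "a = Polynomial.degree P"
  have a: "a > 0"
  proof (rule ccontr)
    assume "\<not> a > 0"
    then have "Polynomial.degree P = 0" unfolding a_def by simp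
    then obtain b where b: "P = [:b:]" by (rule degree_eq_zeroE)
    then show False using assms(1,3) unfolding b by simp
  qed
  define q where "q v = d * coeff P v" for v
  define c where "c = q a"
  define r where "r v = - (q v * c ^ (a - 1 - v))" for v
  have c: "c \<noteq> 0" "c \<in> poly_values emb t"
    using d assms(1) by (simp_all add: c_def q_def a_def)
  have r: "r v \<in> poly_values emb t" for v
    unfolding r_def using d(3) c(2)
    by (intro poly_values_uminus poly_values_mult poly_values_power) (simp_all add: q_def)
  have "d * poly P f = (\<Sum>v\<le>a. q v * f ^ v)"
    by (simp only: poly_altdef q_def a_def sum_distrib_left mult.assoc)
  also have "\<dots> = (\<Sum>v<a. q v * f ^ v) + c * f ^ a"
    by (simp only: lessThan_Suc_atMost[symmetric] sum.lessThan_Suc c_def)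
  finally have "c * f ^ a + (\<Sum>v<a. q v * f ^ v) = 0"
    using assms(3) by (simp add: add.commute)
  then have top: "c * f ^ a = - (\<Sum>v<a. q v * f ^ v)"
    by (rule eq_neg_iff_add_eq_0[THEN iffD2])
  have "(c * f) ^ a = c ^ (a - 1) * (c * f ^ a)"
    unfolding power_mult_distrib power_minus_mult[OF a, of c, symmetric] by (simp only: mult_ac)
  also have "\<dots> = (\<Sum>v<a. - (c ^ (a - 1) * (q v * f ^ v)))"
    unfolding top by (simp only: sum_distrib_left sum_negf mult_minus_right)
  also have "\<dots> = (\<Sum>v<a. r v * (c * f) ^ v)"
  proof (rule sum.cong)
    fix v assume "v \<in> {..<a}"
    then have "a - 1 = (a - 1 - v) + v" by simp
    then have "c ^ (a - 1) = c ^ (a - 1 - v) * c ^ v" by (metis power_add)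
    then show "- (c ^ (a - 1) * (q v * f ^ v)) = r v * (c * f) ^ v"
      by (simp add: r_def power_mult_distrib)
  qed simp
  finally show thesis by (rule that[OF a c r])
qed

interpretation V: vector_space "\<lambda>c x. emb c * x"
proof
  fix a b :: 'k and x y :: 'l
  have "emb (a + b) = emb a + emb b" "emb (a * b) = emb a * emb b" "emb 1 = 1"
    using emb unfolding is_ring_hom_def by blast+
  then show "emb a * (x + y) = emb a * x + emb a * y" "emb (a + b) * x = emb a * x + emb b * x"
    "emb a * (emb b * x) = emb (a * b) * x" "emb 1 * x = x"
    by (simp_all add: algebra_simps)
qed

lemma vector_space_emb: "vector_space (\<lambda>c x. emb c * x)"
  by (rule V.vector_space_axioms)

lemma span_mult:
  assumes "x \<in> V.span B" "\<And>b. b \<in> B \<Longrightarrow> y * b \<in> V.span B'"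
  shows "y * x \<in> V.span B'"
  using assms(1)
proof (induction rule: V.span_induct_alt)
  case base
  then show ?case by (simp add: V.span_zero)
next
  case (step c b z)
  have "y * (emb c * b + z) = emb c * (y * b) + y * z" by (simp add: algebra_simps)
  then show ?case
    using V.span_add[OF V.span_scale[OF assms(2)[OF step(1)]] step(2)] by simp
qed

text \<open>Up to multiples, \<open>f\<close> and \<open>t\<close> are integral over the polynomials in a transcendence basis \<open>\<tau>\<close>. Hence
  the multiples by a fixed factor of the \<open>(M + 1)^2\<close> monomials \<open>f^i t^j\<close>, \<open>i, j \<le> M\<close>, lie in a space
  whose dimension grows only linearly in \<open>M\<close>.\<close>

lemma exists_algebraic_relation:
  assumes trdeg: "trdeg_one emb K" and "f \<in> K" "t \<in> K"
  obtains M c where "\<exists>i\<le>M. \<exists>j\<le>M. c i j \<noteq> 0"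
    "(\<Sum>i\<le>M. \<Sum>j\<le>M. emb (c i j) * (f ^ i * t ^ j)) = 0"
proof -
  obtain \<tau> where alg: "\<forall>x\<in>K.
      \<exists>p :: 'l poly. p \<noteq> 0 \<and> (\<forall>j. coeff p j \<in> simple_ext emb \<tau>) \<and> poly p x = 0"
    using trdeg unfolding trdeg_one_def by (elim bexE conjE) (rule that)
  obtain P :: "'l poly" where P: "P \<noteq> 0" "\<And>j. coeff P j \<in> simple_ext emb \<tau>" "poly P f = 0"
    using bspec[OF alg \<open>f \<in> K\<close>] by (elim exE conjE) (rule that; simp)
  obtain a c\<^sub>1 r where a: "a > 0" "c\<^sub>1 \<noteq> 0" "c\<^sub>1 \<in> poly_values emb \<tau>"
    "\<And>v. r v \<in> poly_values emb \<tau>" "(c\<^sub>1 * f) ^ a = (\<Sum>v<a. r v * (c\<^sub>1 * f) ^ v)"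
    by (rule integral_multiple[OF P]) (rule that; assumption)
  obtain P' :: "'l poly" where P': "P' \<noteq> 0" "\<And>j. coeff P' j \<in> simple_ext emb \<tau>" "poly P' t = 0"
    using bspec[OF alg \<open>t \<in> K\<close>] by (elim exE conjE) (rule that; simp)
  obtain b c\<^sub>2 s where b: "b > 0" "c\<^sub>2 \<noteq> 0" "c\<^sub>2 \<in> poly_values emb \<tau>"
    "\<And>v. s v \<in> poly_values emb \<tau>" "(c\<^sub>2 * t) ^ b = (\<Sum>v<b. s v * (c\<^sub>2 * t) ^ v)"
    by (rule integral_multiple[OF P']) (rule that; assumption)
  define g where "g = c\<^sub>1 * f"
  define h where "h = c\<^sub>2 * t"
  \<comment> \<open>The span of \<open>B N\<close> consists of the combinations of the \<open>g^u h^v\<close> whose coefficients are polynomials in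
    \<open>\<tau>\<close> of degree at most \<open>N\<close>.\<close>
  define B where "B N = (\<lambda>(e, u, v). \<tau> ^ e * g ^ u * h ^ v) ` ({..N} \<times> {..<a} \<times> {..<b})" for N
  have fin: "finite (B N)" for N unfolding B_def by simp
  have card_B: "card (B N) \<le> (N + 1) * (a * b)" for N
  proof -
    have "card (B N) \<le> card ({..N} \<times> {..<a} \<times> {..<b})"
      unfolding B_def by (rule card_image_le) simp
    then show ?thesis by (simp add: card_cartesian_product)
  qed
  have B_mem: "\<tau> ^ e * g ^ u * h ^ v \<in> B N" if "e \<le> N" "u < a" "v < b" for e u v N
    unfolding B_def using that by (intro image_eqI[of _ _ "(e, u, v)"]) auto
  have B_E: "\<exists>e u v. x = \<tau> ^ e * g ^ u * h ^ v \<and> e \<le> N \<and> u < a \<and> v < b" if "x \<in> B N" for x N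
    using that unfolding B_def by auto
  have B_mono: "V.span (B N) \<subseteq> V.span (B N')" if "N \<le> N'" for N N'
    unfolding B_def using that by (intro V.span_mono image_mono Sigma_mono) auto
  \<comment> \<open>Multiplication by \<open>y\<close> raises the degree in \<open>\<tau>\<close> by at most \<open>D\<close>.\<close>
  define raises where "raises D y \<longleftrightarrow> (\<forall>N. \<forall>x\<in>V.span (B N). y * x \<in> V.span (B (N + D)))" for D y
  have raisesD: "y * x \<in> V.span (B (N + D))" if "raises D y" "x \<in> V.span (B N)" for D y x N
    using that unfolding raises_def by blast
  have raises_mono: "raises D' y" if "raises D y" "D \<le> D'" for D D' y
    unfolding raises_def
  proof (intro allI ballI)
    fix N x assume "x \<in> V.span (B N)"
    then have "y * x \<in> V.span (B (N + D))" using that(1) by (simp add: raises_def)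
    then show "y * x \<in> V.span (B (N + D'))" using B_mono[of "N + D" "N + D'"] that(2) by auto
  qed
  have raises_gen: "raises D y" if "\<And>N x. x \<in> B N \<Longrightarrow> y * x \<in> V.span (B (N + D))" for D y
    unfolding raises_def using span_mult that by blast
  have raises_poly: "\<exists>D. raises D y" if y: "y \<in> poly_values emb \<tau>" for y
  proof -
    obtain p where p: "y = poly p \<tau>" "\<And>n. coeff p n \<in> range emb"
      using y unfolding poly_values_def by blast
    have "raises (Polynomial.degree p) y"
    proof (rule raises_gen)
      fix N x assume "x \<in> B N"
      then obtain e u v where x: "x = \<tau> ^ e * g ^ u * h ^ v" "e \<le> N" "u < a" "v < b"
        using B_E by blast
      have "y * x = (\<Sum>i\<le>Polynomial.degree p. coeff p i * (\<tau> ^ (e + i) * g ^ u * h ^ v))"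
        unfolding p(1) x(1) poly_altdef sum_distrib_right by (simp add: power_add mult_ac)
      also have "\<dots> \<in> V.span (B (N + Polynomial.degree p))"
      proof (rule V.span_sum)
        fix i assume "i \<in> {..Polynomial.degree p}"
        then have "\<tau> ^ (e + i) * g ^ u * h ^ v \<in> V.span (B (N + Polynomial.degree p))"
          using x by (intro V.span_base B_mem) auto
        moreover obtain c where "coeff p i = emb c" using p(2)[of i] by blast
        ultimately show "coeff p i * (\<tau> ^ (e + i) * g ^ u * h ^ v) \<in> V.span (B (N + Polynomial.degree p))"
          using V.span_scale by simp
      qed
      finally show "y * x \<in> V.span (B (N + Polynomial.degree p))" .
    qed
    then show ?thesis by blast
  qed
  have raises_uniform: "\<exists>D. \<forall>v<n. raises D (w v)" if "\<And>v. w v \<in> poly_values emb \<tau>" for n :: nat and w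
  proof -
    have "\<exists>D. raises D (w v)" for v using raises_poly[OF that] .
    then obtain F where F: "\<And>v. raises (F v) (w v)" by metis
    have "raises (\<Sum>v<n. F v) (w v)" if "v < n" for v
      using member_le_sum[of v "{..<n}" F] finite_lessThan[of n] that by (intro raises_mono[OF F]) simp
    then show ?thesis by blast
  qed
  obtain D\<^sub>1 where D\<^sub>1: "\<And>v. v < a \<Longrightarrow> raises D\<^sub>1 (r v)" using raises_uniform[of r a] a(4) by blast
  obtain D\<^sub>2 where D\<^sub>2: "\<And>v. v < b \<Longrightarrow> raises D\<^sub>2 (s v)" using raises_uniform[of s b] b(4) by blast
  have g_raises: "raises D\<^sub>1 g"
  proof (rule raises_gen)
    fix N x assume "x \<in> B N"
    then obtain e u v where x: "x = \<tau> ^ e * g ^ u * h ^ v" "e \<le> N" "u < a" "v < b"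
      using B_E by blast
    show "g * x \<in> V.span (B (N + D\<^sub>1))"
    proof (cases "Suc u < a")
      case True
      have "g * x = \<tau> ^ e * g ^ Suc u * h ^ v" unfolding x(1) by simp
      also have "\<dots> \<in> V.span (B (N + D\<^sub>1))" using x(2,4) True by (intro V.span_base B_mem) simp_all
      finally show ?thesis .
    next
      case False
      then have "g ^ a = g * g ^ u" using x(3) by (metis Suc_lessI power_Suc)
      then have "g * x = g ^ a * (\<tau> ^ e * h ^ v)" unfolding x(1) by (simp only: mult_ac)
      also have "\<dots> = (\<Sum>w<a. r w * (\<tau> ^ e * g ^ w * h ^ v))"
        using a(5) unfolding g_def[symmetric] by (simp add: sum_distrib_right sum_distrib_left mult_ac)
      also have "\<dots> \<in> V.span (B (N + D\<^sub>1))"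
        by (intro V.span_sum raisesD[OF D\<^sub>1] V.span_base B_mem x(2,4)) simp_all
      finally show ?thesis .
    qed
  qed
  have h_raises: "raises D\<^sub>2 h"
  proof (rule raises_gen)
    fix N x assume "x \<in> B N"
    then obtain e u v where x: "x = \<tau> ^ e * g ^ u * h ^ v" "e \<le> N" "u < a" "v < b"
      using B_E by blast
    show "h * x \<in> V.span (B (N + D\<^sub>2))"
    proof (cases "Suc v < b")
      case True
      have "h * x = \<tau> ^ e * g ^ u * h ^ Suc v" unfolding x(1) by simp
      also have "\<dots> \<in> V.span (B (N + D\<^sub>2))" using x(2,3) True by (intro V.span_base B_mem) simp_all
      finally show ?thesis .
    next
      case False
      then have "h ^ b = h * h ^ v" using x(4) by (metis Suc_lessI power_Suc)
      then have "h * x = h ^ b * (\<tau> ^ e * g ^ u)" unfolding x(1) by (simp only: mult_ac)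
      also have "\<dots> = (\<Sum>w<b. s w * (\<tau> ^ e * g ^ u * h ^ w))"
        using b(5) unfolding h_def[symmetric] by (simp add: sum_distrib_right sum_distrib_left mult_ac)
      also have "\<dots> \<in> V.span (B (N + D\<^sub>2))"
        by (intro V.span_sum raisesD[OF D\<^sub>2] V.span_base B_mem x(2,3)) simp_all
      finally show ?thesis .
    qed
  qed
  obtain D\<^sub>3 D\<^sub>4 where D\<^sub>3: "raises D\<^sub>3 c\<^sub>1" and D\<^sub>4: "raises D\<^sub>4 c\<^sub>2"
    using raises_poly a(3) b(3) by blast
  define D where "D = D\<^sub>1 + D\<^sub>2 + D\<^sub>3 + D\<^sub>4"
  have raises_D: "raises D g" "raises D h" "raises D c\<^sub>1" "raises D c\<^sub>2"
    using raises_mono[OF g_raises, of D] raises_mono[OF h_raises, of D] raises_mono[OF D\<^sub>3, of D]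
      raises_mono[OF D\<^sub>4, of D] unfolding D_def by simp_all
  have raises_power: "y ^ k * x \<in> V.span (B (N + k * D))" if "raises D y" "x \<in> V.span (B N)" for y k x N
  proof (induction k)
    case (Suc k)
    then have "y * (y ^ k * x) \<in> V.span (B (N + k * D + D))" by (rule raisesD[OF that(1)])
    then show ?case by (simp add: mult.assoc add_ac)
  qed (simp add: that(2))
  \<comment> \<open>With this value, \<open>(2 M D + 1) a b \<le> M^2 < (M + 1)^2\<close>, so there are more monomials than generators.\<close>
  define M where "M = 2 * (D + 1) * (a * b)"
  \<comment> \<open>The factor makes each \<open>y (i, j)\<close> a product of \<open>2 M\<close> factors among \<open>g\<close>, \<open>h\<close>, \<open>c\<^sub>1\<close> and \<open>c\<^sub>2\<close>.\<close>
  define y where "y = (\<lambda>(i, j). c\<^sub>1 ^ M * c\<^sub>2 ^ M * (f ^ i * t ^ j))"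
  define I where "I = {..M} \<times> {..M}"
  have y_span: "y ij \<in> V.span (B (2 * M * D))" if ij: "ij \<in> I" for ij
  proof -
    obtain i j where "ij = (i, j)" "i \<le> M" "j \<le> M" using ij unfolding I_def by auto
    have "1 \<in> B 0" using B_mem[of 0 0 0 0] a(1) b(1) by simp
    then have "h ^ j * 1 \<in> V.span (B (0 + j * D))"
      by (intro raises_power raises_D V.span_base)
    then have "c\<^sub>2 ^ (M - j) * (h ^ j * 1) \<in> V.span (B (0 + j * D + (M - j) * D))"
      by (rule raises_power[OF raises_D(4)])
    then have "g ^ i * (c\<^sub>2 ^ (M - j) * (h ^ j * 1)) \<in> V.span (B (0 + j * D + (M - j) * D + i * D))"
      by (rule raises_power[OF raises_D(1)])
    then have "c\<^sub>1 ^ (M - i) * (g ^ i * (c\<^sub>2 ^ (M - j) * (h ^ j * 1)))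
        \<in> V.span (B (0 + j * D + (M - j) * D + i * D + (M - i) * D))"
      by (rule raises_power[OF raises_D(3)])
    moreover have "0 + j * D + (M - j) * D + i * D + (M - i) * D = 2 * M * D"
    proof -
      have "j * D + (M - j) * D = M * D" "i * D + (M - i) * D = M * D"
        using \<open>i \<le> M\<close> \<open>j \<le> M\<close> by (simp_all flip: distrib_right)
      then show ?thesis by simp
    qed
    moreover have "c\<^sub>1 ^ (M - i) * (g ^ i * (c\<^sub>2 ^ (M - j) * (h ^ j * 1))) = y ij"
    proof -
      have pow: "c\<^sub>1 ^ M = c\<^sub>1 ^ (M - i) * c\<^sub>1 ^ i" "c\<^sub>2 ^ M = c\<^sub>2 ^ (M - j) * c\<^sub>2 ^ j"
        using \<open>i \<le> M\<close> \<open>j \<le> M\<close> power_add[of c\<^sub>1 "M - i" i] power_add[of c\<^sub>2 "M - j" j] by simp_all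
      show ?thesis
        unfolding y_def g_def h_def \<open>ij = (i, j)\<close> split pow
        by (simp only: power_mult_distrib mult_ac mult_1_left)
    qed
    ultimately show ?thesis by (simp only:)
  qed
  have card_lt: "card (B (2 * M * D)) < card I"
  proof -
    have M: "M \<ge> 1" using mult_pos_pos[OF a(1) b(1)] unfolding M_def by (simp add: Suc_le_eq)
    have "card (B (2 * M * D)) \<le> (2 * M * D + 1) * (a * b)" by (rule card_B)
    also have "\<dots> \<le> (2 * M * D + 2 * M) * (a * b)" using M by (intro mult_right_mono) simp_all
    also have "\<dots> = M * (2 * (D + 1) * (a * b))" by (simp only: algebra_simps)
    also have "\<dots> = M * M" by (simp only: M_def)
    also have "\<dots> < (M + 1) * (M + 1)" by simp
    also have "\<dots> = card I" by (simp add: I_def)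
    finally show ?thesis .
  qed
  have "\<exists>c. (\<exists>ij\<in>I. c ij \<noteq> 0) \<and> (\<Sum>ij\<in>I. emb (c ij) * y ij) = 0"
  proof (cases "inj_on y I")
    case True
    have "\<not> V.independent (y ` I)"
    proof
      assume "V.independent (y ` I)"
      then have "card (y ` I) \<le> card (B (2 * M * D))"
        using V.independent_span_bound[OF fin] y_span by blast
      then show False using card_image[OF True] card_lt by simp
    qed
    moreover have "finite (y ` I)" by (simp add: I_def)
    ultimately obtain u where u: "\<exists>v\<in>y ` I. u v \<noteq> 0" "(\<Sum>v\<in>y ` I. emb (u v) * v) = 0"
      using V.dependent_finite by blast
    then have "(\<Sum>ij\<in>I. emb (u (y ij)) * y ij) = 0"
      by (simp add: sum.reindex[OF True])
    then show ?thesis using u(1) by (intro exI[of _ "u \<circ> y"]) auto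
  next
    case False
    then obtain p q where pq: "p \<in> I" "q \<in> I" "p \<noteq> q" "y p = y q"
      by (auto simp: inj_on_def)
    define c where "c ij = (if ij = p then 1 else if ij = q then - 1 else 0 :: 'k)" for ij
    have "(\<Sum>ij\<in>I. emb (c ij) * y ij) = (\<Sum>ij\<in>{p, q}. emb (c ij) * y ij)"
      using pq by (intro sum.mono_neutral_right) (auto simp: c_def I_def ring_hom_zero[OF emb])
    also have "\<dots> = 0"
      using pq emb by (simp add: c_def ring_hom_uminus[OF emb] is_ring_hom_def)
    finally show ?thesis using pq(1) by (intro exI[of _ c]) (auto simp: c_def)
  qed
  then obtain c where c: "\<exists>ij\<in>I. c ij \<noteq> 0" "(\<Sum>ij\<in>I. emb (c ij) * y ij) = 0" by blast
  have "(\<Sum>ij\<in>I. emb (c ij) * y ij) = c\<^sub>1 ^ M * c\<^sub>2 ^ M * (\<Sum>(i, j)\<in>I. emb (c (i, j)) * (f ^ i * t ^ j))"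
    unfolding sum_distrib_left by (intro sum.cong) (auto simp: y_def)
  then have "(\<Sum>(i, j)\<in>I. emb (c (i, j)) * (f ^ i * t ^ j)) = 0"
    using c(2) a(2) b(2) by simp
  then have "(\<Sum>i\<le>M. \<Sum>j\<le>M. emb (c (i, j)) * (f ^ i * t ^ j)) = 0"
    unfolding I_def by (simp add: sum.cartesian_product)
  moreover have "\<exists>i\<le>M. \<exists>j\<le>M. c (i, j) \<noteq> 0"
    using c(1) unfolding I_def by auto
  ultimately show thesis using that[of M "\<lambda>i j. c (i, j)"] by blast
qed

end


section \<open>Places of the function field\<close>

text \<open>A homomorphism over the ground field from a subring of \<open>'l\<close> to the algebraic closure, encoded by its graph,
  so that extension is inclusion and the union of a chain is again a graph. Single-valuedness only
  needs to be required at \<open>0\<close>.\<close>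

definition residue_graph ::
  "('k :: field \<Rightarrow> 'l :: field) \<Rightarrow> ('l \<times> 'k alg_closure) set \<Rightarrow> bool" where
  "residue_graph emb G \<longleftrightarrow>
     (\<forall>c. (emb c, to_ac c) \<in> G) \<and>
     (\<forall>x y x' y'. (x, y) \<in> G \<longrightarrow> (x', y') \<in> G \<longrightarrow> (x + x', y + y') \<in> G \<and> (x * x', y * y') \<in> G) \<and>
     (\<forall>y. (0, y) \<in> G \<longrightarrow> y = 0)"

text \<open>The coefficientwise image of \<open>p\<close> under the homomorphism is \<open>q\<close>.\<close>

definition coeffs_related ::
  "('l :: field \<times> 'k :: field) set \<Rightarrow> 'l poly \<Rightarrow> 'k poly \<Rightarrow> bool" where
  "coeffs_related G p q \<longleftrightarrow> (\<forall>n. (coeff p n, coeff q n) \<in> G)"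

text \<open>The candidate for the extension of the homomorphism that sends \<open>x\<close> to \<open>y\<close>.\<close>

definition adjoin_pair ::
  "('l :: field \<times> 'k :: field) set \<Rightarrow> 'l \<Rightarrow> 'k \<Rightarrow> ('l \<times> 'k) set" where
  "adjoin_pair G x y = {(poly p x, poly q y) | p q. coeffs_related G p q}"

text \<open>A subring of the product that contains the graph of the constants; it need not be single-valued.\<close>

locale graph_over =
  fixes emb :: "'k :: field \<Rightarrow> 'l :: field"
    and G :: "('l \<times> 'k alg_closure) set"
  assumes emb: "is_ring_hom emb"
    and const: "(emb c, to_ac c) \<in> G"
    and add: "(x, y) \<in> G \<Longrightarrow> (x', y') \<in> G \<Longrightarrow> (x + x', y + y') \<in> G"
    and mult: "(x, y) \<in> G \<Longrightarrow> (x', y') \<in> G \<Longrightarrow> (x * x', y * y') \<in> G"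
begin

lemma zero: "(0, 0) \<in> G"
  using const[of 0] ring_hom_zero[OF emb] by simp

lemma one: "(1, 1) \<in> G"
  using const[of 1] emb by (simp add: is_ring_hom_def)

lemma uminus: "(x, y) \<in> G \<Longrightarrow> (- x, - y) \<in> G"
  using mult[OF const[of "- 1"], of x y] emb
  by (simp add: ring_hom_uminus[OF emb] is_ring_hom_def)

lemma diff: "(x, y) \<in> G \<Longrightarrow> (x', y') \<in> G \<Longrightarrow> (x - x', y - y') \<in> G"
  using add[OF _ uminus, of x y x' y'] by simp

lemma sum: "(\<And>a. a \<in> A \<Longrightarrow> (f a, g a) \<in> G) \<Longrightarrow> (sum f A, sum g A) \<in> G"
  by (induction A rule: infinite_finite_induct) (auto intro: zero add)

lemma power: "(x, y) \<in> G \<Longrightarrow> (x ^ n, y ^ n) \<in> G"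
  by (induction n) (auto intro: one mult)

lemma prod: "(\<And>a. a \<in> A \<Longrightarrow> (f a, g a) \<in> G) \<Longrightarrow> (prod f A, prod g A) \<in> G"
  by (induction A rule: infinite_finite_induct) (auto intro: one mult)

lemma coeffs_related_add:
  "coeffs_related G p q \<Longrightarrow> coeffs_related G p' q' \<Longrightarrow> coeffs_related G (p + p') (q + q')"
  by (auto simp: coeffs_related_def intro: add)

lemma coeffs_related_diff:
  "coeffs_related G p q \<Longrightarrow> coeffs_related G p' q' \<Longrightarrow> coeffs_related G (p - p') (q - q')"
  by (auto simp: coeffs_related_def intro: diff)

lemma coeffs_related_mult:
  "coeffs_related G p q \<Longrightarrow> coeffs_related G p' q' \<Longrightarrow> coeffs_related G (p * p') (q * q')"
  by (auto simp: coeffs_related_def coeff_mult intro: sum mult)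

lemma coeffs_related_smult:
  "(x, y) \<in> G \<Longrightarrow> coeffs_related G p q \<Longrightarrow> coeffs_related G (smult x p) (smult y q)"
  by (auto simp: coeffs_related_def intro: mult)

lemma coeffs_related_monom: "(x, y) \<in> G \<Longrightarrow> coeffs_related G (monom x n) (monom y n)"
  by (auto simp: coeffs_related_def intro: zero)

lemma coeffs_related_const: "(x, y) \<in> G \<Longrightarrow> coeffs_related G [:x:] [:y:]"
  using coeffs_related_monom[of x y 0] by (simp add: monom_0)

lemma adjoin_pair_superset: "G \<subseteq> adjoin_pair G x y"
proof
  fix a assume "a \<in> G"
  then have "coeffs_related G [:fst a:] [:snd a:]" by (intro coeffs_related_const) simp
  then show "a \<in> adjoin_pair G x y"
    by (auto simp: adjoin_pair_def intro!: exI[of _ "[:fst a:]"] exI[of _ "[:snd a:]"])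
qed

lemma mem_adjoin_pair: "(x, y) \<in> adjoin_pair G x y"
  using coeffs_related_monom[OF one, of 1]
  by (auto simp: adjoin_pair_def poly_monom intro!: exI[of _ "monom 1 1"])

text \<open>The extension is well defined as soon as \<open>y\<close> is a root of the images of all polynomials that vanish at
  \<open>x\<close>.\<close>

lemma residue_graph_adjoin_pair:
  assumes "\<And>p q. coeffs_related G p q \<Longrightarrow> poly p x = 0 \<Longrightarrow> poly q y = 0"
  shows "residue_graph emb (adjoin_pair G x y)"
proof -
  have "(a + a', b + b') \<in> adjoin_pair G x y \<and> (a * a', b * b') \<in> adjoin_pair G x y"
    if ab: "(a, b) \<in> adjoin_pair G x y" "(a', b') \<in> adjoin_pair G x y" for a b a' b'
  proof -
    obtain p q where pq: "coeffs_related G p q" "a = poly p x" "b = poly q y"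
      using ab(1) by (auto simp: adjoin_pair_def)
    obtain p' q' where pq': "coeffs_related G p' q'" "a' = poly p' x" "b' = poly q' y"
      using ab(2) by (auto simp: adjoin_pair_def)
    have "(poly (p + p') x, poly (q + q') y) \<in> adjoin_pair G x y"
      "(poly (p * p') x, poly (q * q') y) \<in> adjoin_pair G x y"
      using coeffs_related_add[OF pq(1) pq'(1)] coeffs_related_mult[OF pq(1) pq'(1)]
      unfolding adjoin_pair_def by blast+
    then show ?thesis by (simp add: pq pq')
  qed
  moreover have "(emb c, to_ac c) \<in> adjoin_pair G x y" for c
    using adjoin_pair_superset const by blast
  moreover have "b = 0" if "(0, b) \<in> adjoin_pair G x y" for b
    using that assms by (auto simp: adjoin_pair_def)
  ultimately show ?thesis
    unfolding residue_graph_def by blast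
qed

end

lemma graph_over_residue_graph:
  "is_ring_hom emb \<Longrightarrow> residue_graph emb G \<Longrightarrow> graph_over emb G"
  by unfold_locales (auto simp: residue_graph_def)

lemma residue_graph_zero: "residue_graph emb G \<Longrightarrow> (0, y) \<in> G \<Longrightarrow> y = 0"
  by (simp add: residue_graph_def)

locale maximal_residue_graph =
  fixes emb :: "'k :: field \<Rightarrow> 'l :: field"
    and G :: "('l \<times> 'k alg_closure) set"
  assumes hom: "is_ring_hom emb"
    and graph: "residue_graph emb G"
    and maximal: "\<And>G'. residue_graph emb G' \<Longrightarrow> G \<subseteq> G' \<Longrightarrow> G' = G"
begin

sublocale graph_over emb G
  using graph_over_residue_graph[OF hom graph] .

lemma value_zero: "(0, y) \<in> G \<Longrightarrow> y = 0"
  using graph by (rule residue_graph_zero)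

lemma value_unique: "(x, y) \<in> G \<Longrightarrow> (x, y') \<in> G \<Longrightarrow> y = y'"
  using diff[of x y x y'] value_zero[of "y - y'"] by simp

text \<open>Otherwise the homomorphism would extend to the localization at its kernel.\<close>

lemma inverse_mem:
  assumes "(x, y) \<in> G" "y \<noteq> 0"
  shows "(inverse x, inverse y) \<in> G"
proof -
  define G' where "G' = {(a / s, b / r) | a b s r. (a, b) \<in> G \<and> (s, r) \<in> G \<and> r \<noteq> 0}"
  have nz: "s \<noteq> 0" if "(s, r) \<in> G" "r \<noteq> 0" for s r
    using that value_zero by blast
  have "G \<subseteq> G'"
  proof
    fix a assume "a \<in> G"
    then have "(fst a / 1, snd a / 1) \<in> G'"
      using one zero_neq_one unfolding G'_def by (metis (mono_tags, lifting) mem_Collect_eq prod.collapse)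
    then show "a \<in> G'" by simp
  qed
  moreover have "residue_graph emb G'"
  proof -
    have "(u + u', v + v') \<in> G' \<and> (u * u', v * v') \<in> G'"
      if uv: "(u, v) \<in> G'" "(u', v') \<in> G'" for u v u' v'
    proof -
      obtain a b s r where 1: "u = a / s" "v = b / r" "(a, b) \<in> G" "(s, r) \<in> G" "r \<noteq> 0"
        using uv(1) by (auto simp: G'_def)
      obtain a' b' s' r' where 2: "u' = a' / s'" "v' = b' / r'" "(a', b') \<in> G" "(s', r') \<in> G" "r' \<noteq> 0"
        using uv(2) by (auto simp: G'_def)
      have "u + u' = (a * s' + a' * s) / (s * s')" "v + v' = (b * r' + b' * r) / (r * r')"
        using nz[OF 1(4,5)] nz[OF 2(4,5)] 1 2 by (auto simp: field_simps)
      moreover have "u * u' = (a * a') / (s * s')" "v * v' = (b * b') / (r * r')"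
        using 1 2 by auto
      moreover have "(a * s' + a' * s, b * r' + b' * r) \<in> G" "(s * s', r * r') \<in> G" "r * r' \<noteq> 0"
        "(a * a', b * b') \<in> G"
        using 1 2 by (auto intro: add mult)
      ultimately show ?thesis
        unfolding G'_def by blast
    qed
    moreover have "y = 0" if y: "(0, y) \<in> G'" for y
    proof -
      obtain a b s r where "0 = a / s" "y = b / r" "(a, b) \<in> G" "(s, r) \<in> G" "r \<noteq> 0"
        using y by (auto simp: G'_def)
      then show ?thesis using nz[of s r] value_zero[of b] by auto
    qed
    moreover have "(emb c, to_ac c) \<in> G'" for c
      using \<open>G \<subseteq> G'\<close> const by blast
    ultimately show ?thesis
      unfolding residue_graph_def by blast
  qed
  ultimately have "G' = G" by (rule maximal[rotated])
  moreover have "(1 / x, 1 / y) \<in> G'"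
    using assms one unfolding G'_def by blast
  ultimately show ?thesis by (simp add: inverse_eq_divide)
qed

text \<open>The images of the polynomials that vanish at \<open>x\<close> are the multiples of one of least degree. If that one had a
  root in the algebraic closure, \<open>x\<close> could be adjoined; hence it is a nonzero constant.\<close>

lemma relation_of_not_in_domain:
  assumes "x \<notin> Domain G"
  obtains p c where "coeffs_related G p [:c:]" "c \<noteq> 0" "poly p x = 0"
proof -
  define I where "I = {q. \<exists>p. coeffs_related G p q \<and> poly p x = 0}"
  have no_common_root: "\<exists>q\<in>I. poly q y \<noteq> 0" for y
  proof (rule ccontr)
    assume "\<not> (\<exists>q\<in>I. poly q y \<noteq> 0)"
    then have "residue_graph emb (adjoin_pair G x y)"
      by (intro residue_graph_adjoin_pair) (auto simp: I_def)
    then have "adjoin_pair G x y = G"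
      by (rule maximal) (rule adjoin_pair_superset)
    then show False
      using mem_adjoin_pair[of x y] assms by (auto simp: Domain_iff)
  qed
  obtain q' where "q' \<in> I" "poly q' 0 \<noteq> 0"
    using no_common_root[of 0] by blast
  then have "q' \<in> I \<and> q' \<noteq> 0" by auto
  then obtain q where q: "q \<in> I" "q \<noteq> 0"
    and min: "\<And>r. r \<in> I \<Longrightarrow> r \<noteq> 0 \<Longrightarrow> Polynomial.degree q \<le> Polynomial.degree r"
    using ex_has_least_nat[of "\<lambda>r. r \<in> I \<and> r \<noteq> 0" q' Polynomial.degree] by blast
  obtain p where p: "coeffs_related G p q" "poly p x = 0"
    using q(1) by (auto simp: I_def)
  have dvd: "q dvd r" if "r \<in> I" for r
    using that
  proof (induction "Polynomial.degree r" arbitrary: r rule: less_induct)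
    case less
    show ?case
    proof (cases "r = 0")
      case False
      let ?n = "Polynomial.degree r" and ?d = "Polynomial.degree q"
      have le: "?d \<le> ?n" using min[OF less.prems False] .
      \<comment> \<open>One step of pseudo-division, which needs no inverses of leading coefficients.\<close>
      define r' where "r' = smult (lead_coeff q) r - monom (lead_coeff r) (?n - ?d) * q"
      obtain s where s: "coeffs_related G s r" "poly s x = 0"
        using less.prems by (auto simp: I_def)
      define s' where "s' = smult (coeff p ?d) s - monom (coeff s ?n) (?n - ?d) * p"
      have mem: "(coeff p ?d, lead_coeff q) \<in> G" "(coeff s ?n, lead_coeff r) \<in> G"
        using p(1) s(1) by (simp_all only: coeffs_related_def)
      have "coeffs_related G s' r'"
        unfolding r'_def s'_def
        by (intro coeffs_related_diff coeffs_related_smult coeffs_related_mult coeffs_related_monom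
            mem p(1) s(1))
      moreover have "poly s' x = 0"
        by (simp add: s'_def p(2) s(2))
      ultimately have r'I: "r' \<in> I"
        unfolding I_def by blast
      have "q dvd r'"
      proof (cases "?n = 0")
        case True
        then have "is_unit q" using le is_unit_iff_degree[OF q(2)] by simp
        then show ?thesis by (rule unit_imp_dvd)
      next
        case False
        have "coeff r' k = 0" if "k > ?n - 1" for k
        proof (cases "k = ?n")
          case True
          then show ?thesis using le by (simp add: r'_def coeff_monom_mult)
        next
          case False
          then have "k > ?n" using that by simp
          then show ?thesis using le by (simp add: r'_def coeff_monom_mult coeff_eq_0)
        qed
        then have "Polynomial.degree r' \<le> ?n - 1" by (intro degree_le) auto
        then show ?thesis using less.hyps[OF _ r'I] False by simp
      qed
      then have "q dvd r' + monom (lead_coeff r) (?n - ?d) * q" by simp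
      then have "q dvd smult (lead_coeff q) r" by (simp add: r'_def)
      then show ?thesis using q(2) by (simp add: dvd_smult_iff)
    qed simp
  qed
  have "Polynomial.degree q = 0"
  proof (rule ccontr)
    assume "Polynomial.degree q \<noteq> 0"
    then obtain y where "poly q y = 0"
      using alg_closed_imp_poly_has_root[of q] by auto
    moreover obtain r where "r \<in> I" "poly r y \<noteq> 0"
      using no_common_root by blast
    moreover from this obtain s where "r = q * s"
      using dvd by (blast elim: dvdE)
    ultimately show False by simp
  qed
  then obtain c where c: "q = [:c:]" by (rule degree_eq_zeroE)
  show thesis
  proof (rule that)
    show "coeffs_related G p [:c:]" using p(1) unfolding c .
    show "poly p x = 0" by (rule p(2))
    show "c \<noteq> 0" using q(2) unfolding c by auto
  qed
qed

text \<open>Reversing the coefficients of the relation for \<open>inverse x\<close> gives a polynomial that vanishes at \<open>x\<close>, whose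
  leading coefficient has nonzero residue and whose other coefficients have residue zero. It serves to
  eliminate the leading term of the relation for \<open>x\<close>.\<close>

lemma shorten_relation:
  assumes "x \<noteq> 0"
    and p: "coeffs_related G p [:c:]" "c \<noteq> 0" "poly p x = 0"
    and p': "coeffs_related G p' [:c':]" "c' \<noteq> 0" "poly p' (inverse x) = 0"
    and le: "Polynomial.degree p' \<le> Polynomial.degree p"
  obtains p'' c'' where "coeffs_related G p'' [:c'':]" "c'' \<noteq> 0" "poly p'' x = 0"
    "Polynomial.degree p'' < Polynomial.degree p"
proof -
  let ?n = "Polynomial.degree p" and ?m = "Polynomial.degree p'"
  have n: "?n \<noteq> 0"
  proof
    assume "?n = 0"
    then obtain b where "p = [:b:]" by (rule degree_eq_zeroE)
    then have "(0, c) \<in> G" using p by (auto simp: coeffs_related_def dest: spec[of _ 0])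
    then show False using value_zero p(2) by blast
  qed
  define R where "R = reflect_poly p'"
  have R: "coeffs_related G R (monom c' ?m)"
    unfolding coeffs_related_def
  proof
    fix k
    have "(coeff p' (?m - k), coeff [:c':] (?m - k)) \<in> G"
      using p'(1) by (simp add: coeffs_related_def)
    then show "(coeff R k, coeff (monom c' ?m) k) \<in> G"
      using zero by (auto simp: R_def coeff_reflect_poly coeff_pCons split: nat.splits)
  qed
  have R0: "poly R x = 0"
    using poly_reflect_poly_nz[of x p'] assms(1) p'(3) by (simp add: R_def)
  define p'' where "p'' = smult (coeff p' 0) p - monom (coeff p ?n) (?n - ?m) * R"
  have "coeffs_related G p'' (smult c' [:c:] - monom 0 (?n - ?m) * monom c' ?m)"
    unfolding p''_def
  proof (intro coeffs_related_diff coeffs_related_smult coeffs_related_mult coeffs_related_monom R p(1))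
    show "(coeff p' 0, c') \<in> G"
      using p'(1) by (auto simp: coeffs_related_def dest: spec[of _ 0])
    show "(coeff p ?n, 0) \<in> G"
    proof -
      obtain k where k: "?n = Suc k" using n not0_implies_Suc by blast
      have "(coeff p (Suc k), coeff [:c:] (Suc k)) \<in> G"
        using p(1) by (simp only: coeffs_related_def)
      then show ?thesis by (simp add: k)
    qed
  qed
  then have 1: "coeffs_related G p'' [:c' * c:]" by simp
  have 2: "poly p'' x = 0"
    by (simp add: p''_def p(3) R0)
  have "coeff p'' k = 0" if "k > ?n - 1" for k
  proof (cases "k = ?n")
    case True
    then show ?thesis using le by (simp add: p''_def R_def coeff_monom_mult coeff_reflect_poly)
  next
    case False
    then have "k > ?n" using that by simp
    then show ?thesis
      using le by (simp add: p''_def R_def coeff_monom_mult coeff_eq_0 coeff_reflect_poly)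
  qed
  then have "Polynomial.degree p'' \<le> ?n - 1" by (intro degree_le) auto
  then show thesis using that[OF 1 _ 2] n p(2) p'(2) by auto
qed

text \<open>If both \<open>x\<close> and its inverse were missing, the shortest relations for the two could be shortened
  further.\<close>

lemma valuation_ring:
  assumes "x \<noteq> 0"
  shows "x \<in> Domain G \<or> inverse x \<in> Domain G"
proof (rule ccontr)
  assume *: "\<not> ?thesis"
  define R where "R x n \<longleftrightarrow>
    (\<exists>p c. coeffs_related G p [:c:] \<and> c \<noteq> 0 \<and> poly p x = 0 \<and> Polynomial.degree p = n)" for x n
  have ex: "\<exists>n. R x n" if "x \<notin> Domain G" for x
    using relation_of_not_in_domain[OF that] unfolding R_def by metis
  have shorten: "\<exists>k<n. R x k" if "x \<noteq> 0" "R x n" "R (inverse x) m" "m \<le> n" for x n m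
    using that shorten_relation[of x] unfolding R_def by metis
  define n where "n = (LEAST n. R x n)"
  define m where "m = (LEAST m. R (inverse x) m)"
  have n: "R x n" and m: "R (inverse x) m"
    using * ex unfolding n_def m_def by (metis LeastI_ex)+
  have "\<not> R x k" if "k < n" for k
    using that not_less_Least unfolding n_def by blast
  moreover have "\<not> R (inverse x) k" if "k < m" for k
    using that not_less_Least unfolding m_def by blast
  ultimately show False
    using shorten[of x n m] shorten[of "inverse x" m n] n m assms by (cases "m \<le> n") auto
qed

text \<open>A valuation ring orders elements by divisibility, so a finite set has one of largest value.\<close>

lemma exists_dominating:
  assumes "finite S" "S \<noteq> {}" "0 \<notin> S"
  shows "\<exists>y\<in>S. \<forall>x\<in>S. x / y \<in> Domain G"
  using assms
proof (induction S rule: finite_ne_induct)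
  case (singleton y)
  then show ?case using DomainI[OF one] by simp
next
  case (insert z S)
  then obtain y where y: "y \<in> S" "\<And>x. x \<in> S \<Longrightarrow> x / y \<in> Domain G" by blast
  have nz: "y \<noteq> 0" "z \<noteq> 0" using insert.prems y(1) by blast+
  show ?case
  proof (cases "z / y \<in> Domain G")
    case True
    then have "\<forall>x\<in>insert z S. x / y \<in> Domain G" using y(2) by blast
    then show ?thesis using y(1) by blast
  next
    case False
    then have yz: "y / z \<in> Domain G"
      using valuation_ring[of "z / y"] nz by (simp add: field_simps)
    have "x / z \<in> Domain G" if "x \<in> S" for x
    proof -
      obtain b where b: "(x / y, b) \<in> G" using y(2)[OF \<open>x \<in> S\<close>] by (rule DomainE)
      obtain b' where b': "(y / z, b') \<in> G" using yz by (rule DomainE)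
      have "x / y * (y / z) = x / z" using nz by simp
      then show ?thesis using DomainI[OF mult[OF b b']] by (simp only:)
    qed
    moreover have "z / z \<in> Domain G"
      using DomainI[OF one] nz by simp
    ultimately have "\<forall>x\<in>insert z S. x / z \<in> Domain G" by blast
    then show ?thesis by blast
  qed
qed

text \<open>Dividing homogeneous coordinates by one of largest value brings all of them into the valuation
  ring. Their residues are the coordinates of a point, since one of them is \<open>1\<close>.\<close>

lemma center:
  fixes \<xi> :: "'l ^ 'n :: finite"
  assumes "\<xi> \<noteq> 0"
  obtains i x where "\<xi> $ i \<noteq> 0" "x \<noteq> 0" "\<And>j. (\<xi> $ j / \<xi> $ i, x $ j) \<in> G"
proof -
  define S where "S = range (\<lambda>j. \<xi> $ j) - {0}"
  obtain l where "\<xi> $ l \<noteq> 0" using assms vec_eq_iff[of \<xi> 0] unfolding zero_index by blast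
  then have "\<xi> $ l \<in> S" unfolding S_def by blast
  moreover have "finite S" "0 \<notin> S" by (simp_all add: S_def)
  ultimately obtain y where y: "y \<in> S" "\<forall>x\<in>S. x / y \<in> Domain G"
    using exists_dominating[of S] by blast
  then obtain i where i: "\<xi> $ i = y" "y \<noteq> 0" unfolding S_def by blast
  have "\<exists>y. (\<xi> $ j / \<xi> $ i, y) \<in> G" for j
  proof (cases "\<xi> $ j = 0")
    case True
    then show ?thesis using zero by auto
  next
    case False
    then have "\<xi> $ j \<in> S" unfolding S_def by blast
    then show ?thesis using y(2) i(1) by (simp add: Domain_iff)
  qed
  then obtain x where x: "\<And>j. (\<xi> $ j / \<xi> $ i, x j) \<in> G" by metis
  have "x i = 1"
    using x[of i] i one value_unique[of 1] by simp
  then have "(\<chi> j. x j) \<noteq> 0"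
    using vec_lambda_beta[of x i] zero_index[of i] zero_neq_one by metis
  then show thesis
    using that[of i "\<chi> j. x j"] i x by simp
qed

lemma eval_at_mem:
  fixes x :: "'l ^ 'n :: finite"
  assumes "\<And>j. (x $ j, y $ j) \<in> G"
  shows "(eval_at emb f x, eval_at to_ac f y) \<in> G"
  unfolding eval_at_def
  by (intro sum mult const prod power assms)

end

lemma exists_maximal_residue_graph:
  assumes hom: "is_ring_hom emb" and G: "residue_graph emb G"
  obtains G' where "G \<subseteq> G'" "maximal_residue_graph emb G'"
proof -
  define AA where "AA = {G'. residue_graph emb G' \<and> G \<subseteq> G'}"
  have "\<Union> FF \<in> AA" if chain: "FF \<noteq> {}" "subset.chain AA FF" for FF
  proof -
    have graphs: "residue_graph emb Y" "G \<subseteq> Y" if "Y \<in> FF" for Y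
      using that chain(2) by (auto simp: subset.chain_def AA_def)
    obtain Y where Y: "Y \<in> FF" using chain(1) by blast
    have "residue_graph emb (\<Union> FF)"
      unfolding residue_graph_def
    proof (intro conjI allI impI)
      fix a b a' b' assume ab: "(a, b) \<in> \<Union> FF" "(a', b') \<in> \<Union> FF"
      then obtain Y Y' where Y: "Y \<in> FF" "(a, b) \<in> Y" "Y' \<in> FF" "(a', b') \<in> Y'"
        by blast
      then have "Y \<subseteq> Y' \<or> Y' \<subseteq> Y"
        using chain(2) by (auto simp: subset_chain_def)
      then obtain Z where Z: "Z \<in> FF" and ab': "(a, b) \<in> Z" "(a', b') \<in> Z"
        using Y by blast
      have "(a + a', b + b') \<in> Z" "(a * a', b * b') \<in> Z"
        using ab' graph_over.add graph_over.mult graph_over_residue_graph[OF hom graphs(1)[OF Z]]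
        by metis+
      then show "(a + a', b + b') \<in> \<Union> FF" "(a * a', b * b') \<in> \<Union> FF"
        using Z by blast+
    next
      fix c show "(emb c, to_ac c) \<in> \<Union> FF"
        using Y graph_over.const[OF graph_over_residue_graph[OF hom graphs(1)[OF Y]]] by blast
    next
      fix y assume "(0, y) \<in> \<Union> FF"
      then obtain Z where "Z \<in> FF" "(0, y) \<in> Z" by blast
      then show "y = 0" using graphs(1)[of Z] residue_graph_zero by blast
    qed
    then show ?thesis using Y graphs(2)[OF Y] by (auto simp: AA_def)
  qed
  note chains = this
  have "AA \<noteq> {}" using G by (auto simp: AA_def)
  from subset_Zorn_nonempty[OF this chains]
  obtain G' where G': "G' \<in> AA" "\<And>Y. Y \<in> AA \<Longrightarrow> G' \<subseteq> Y \<Longrightarrow> Y = G'" by metis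
  have "maximal_residue_graph emb G'"
  proof
    show "is_ring_hom emb" "residue_graph emb G'"
      using hom G'(1) by (simp_all add: AA_def)
    show "G'' = G'" if "residue_graph emb G''" "G' \<subseteq> G''" for G''
      using that G'(1) by (intro G'(2)) (auto simp: AA_def)
  qed
  then show thesis using that[of G'] G'(1) by (auto simp: AA_def)
qed

text \<open>As \<open>f\<close> is transcendental, polynomials in \<open>inverse f\<close> can be sent to their constant terms; this
  homomorphism is then extended as far as possible.\<close>

lemma exists_place_at_pole:
  fixes emb :: "'k :: field \<Rightarrow> 'l :: field"
  assumes hom: "is_ring_hom emb" and "f \<noteq> 0"
    and transc: "\<And>p. (\<And>n. coeff p n \<in> range emb) \<Longrightarrow> poly p f = 0 \<Longrightarrow> p = 0"
  obtains G where "maximal_residue_graph emb G" "(inverse f, 0) \<in> G"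
proof -
  define G\<^sub>0 where "G\<^sub>0 = range (\<lambda>c. (emb c, to_ac c))"
  interpret graph_over emb G\<^sub>0
  proof unfold_locales
    fix x y x' y' assume "(x, y) \<in> G\<^sub>0" "(x', y') \<in> G\<^sub>0"
    then obtain c c' where "x = emb c" "y = to_ac c" "x' = emb c'" "y' = to_ac c'"
      by (auto simp: G\<^sub>0_def)
    then have "(x + x', y + y') = (emb (c + c'), to_ac (c + c'))"
      "(x * x', y * y') = (emb (c * c'), to_ac (c * c'))"
      using hom by (simp_all add: is_ring_hom_def)
    then show "(x + x', y + y') \<in> G\<^sub>0" "(x * x', y * y') \<in> G\<^sub>0"
      using rangeI[of "\<lambda>c. (emb c, to_ac c)" "c + c'"] rangeI[of "\<lambda>c. (emb c, to_ac c)" "c * c'"]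
      unfolding G\<^sub>0_def by simp_all
  qed (auto simp: hom G\<^sub>0_def)
  have "residue_graph emb (adjoin_pair G\<^sub>0 (inverse f) 0)"
  proof (rule residue_graph_adjoin_pair)
    fix p q assume pq: "coeffs_related G\<^sub>0 p q" "poly p (inverse f) = 0"
    have "poly (reflect_poly p) f = 0"
      using poly_reflect_poly_nz[of f p] pq(2) \<open>f \<noteq> 0\<close> by simp
    moreover have "coeff (reflect_poly p) n \<in> range emb" for n
    proof -
      have "coeff p k \<in> range emb" for k
        using pq(1) by (auto simp: coeffs_related_def G\<^sub>0_def)
      then show ?thesis
        using ring_hom_zero[OF hom] by (auto simp: coeff_reflect_poly intro: range_eqI[of _ _ 0])
    qed
    ultimately have "reflect_poly p = 0" by (intro transc)
    then have "p = 0" by simp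
    then have "(0, coeff q 0) \<in> G\<^sub>0"
      using pq(1) unfolding coeffs_related_def by (metis coeff_0)
    then obtain c where c: "emb c = 0" "coeff q 0 = to_ac c"
      by (auto simp: G\<^sub>0_def)
    have "c = 0" using field_hom_nonzero[OF hom, of c] c(1) by blast
    then show "poly q 0 = 0" using c(2) by (simp add: poly_0_coeff_0)
  qed
  then obtain G where "adjoin_pair G\<^sub>0 (inverse f) 0 \<subseteq> G" "maximal_residue_graph emb G"
    using exists_maximal_residue_graph[OF hom] by blast
  then show thesis
    using that[of G] mem_adjoin_pair[of "inverse f" 0] by blast
qed


section \<open>Orders with respect to a uniformizer\<close>

text \<open>A discrete valuation ring inside a field, described by a uniformizer. The last condition, that no nonzero
  element is divisible by all powers of \<open>t\<close>, is what makes the order of an element finite.\<close>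

locale uniformized_ring =
  fixes A :: "'l :: field set" and t :: 'l
  assumes one_mem: "1 \<in> A"
    and add_mem: "a \<in> A \<Longrightarrow> b \<in> A \<Longrightarrow> a + b \<in> A"
    and mult_mem: "a \<in> A \<Longrightarrow> b \<in> A \<Longrightarrow> a * b \<in> A"
    and t_mem: "t \<in> A" and t_nonzero: "t \<noteq> 0"
    and unit_or_multiple: "a \<in> A \<Longrightarrow> inverse a \<in> A \<or> (\<exists>b\<in>A. a = t * b)"
    and t_not_unit: "b \<in> A \<Longrightarrow> t * b \<noteq> 1"
    and separated: "a \<in> A \<Longrightarrow> (\<And>n. \<exists>b\<in>A. a = t ^ n * b) \<Longrightarrow> a = 0"
begin

definition unit_of :: "'l \<Rightarrow> bool" where
  "unit_of u \<longleftrightarrow> u \<noteq> 0 \<and> u \<in> A \<and> inverse u \<in> A"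

lemma power_mem: "a \<in> A \<Longrightarrow> a ^ n \<in> A"
  by (induction n) (simp_all add: one_mem mult_mem)

lemma unit_of_mult: "unit_of u \<Longrightarrow> unit_of w \<Longrightarrow> unit_of (u * w)"
  unfolding unit_of_def by (simp add: mult_mem)

lemma unit_of_inverse: "unit_of u \<Longrightarrow> unit_of (inverse u)"
  unfolding unit_of_def by simp

lemma unit_of_power_int: "unit_of u \<Longrightarrow> unit_of (u powi n)"
  using power_mem[of u "nat n"] power_mem[of "inverse u" "nat n"]
    power_mem[of u "nat (- n)"] power_mem[of "inverse u" "nat (- n)"]
  unfolding unit_of_def by (simp add: power_int_def power_inverse)

text \<open>Dividing by \<open>t\<close> as often as possible leaves an element that is not a multiple of \<open>t\<close>, hence a unit.\<close>

lemma unit_factorization: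
  assumes "a \<in> A" "a \<noteq> 0"
  obtains u n where "unit_of u" "a = u * t ^ n"
proof -
  obtain n where n: "\<not> (\<exists>b\<in>A. a = t ^ n * b)"
    using separated[OF assms(1)] assms(2) by blast
  define m where "m = (LEAST n. \<not> (\<exists>b\<in>A. a = t ^ n * b))"
  have m: "\<not> (\<exists>b\<in>A. a = t ^ m * b)"
    unfolding m_def by (rule LeastI[of _ n]) (rule n)
  have "m \<noteq> 0"
    using m assms(1) by (cases m) auto
  then obtain k where k: "m = Suc k" by (cases m) auto
  have "\<exists>b\<in>A. a = t ^ k * b"
    using not_less_Least[of k "\<lambda>n. \<not> (\<exists>b\<in>A. a = t ^ n * b)"] unfolding m_def[symmetric] k by blast
  then obtain u where u: "u \<in> A" "a = t ^ k * u" by blast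
  have "\<not> (\<exists>b\<in>A. u = t * b)"
  proof
    assume "\<exists>b\<in>A. u = t * b"
    then obtain b where "b \<in> A" "u = t * b" by blast
    then have "a = t ^ m * b" using u(2) k by (simp add: mult_ac)
    then show False using m \<open>b \<in> A\<close> by blast
  qed
  then have "inverse u \<in> A" using unit_or_multiple[OF u(1)] by blast
  moreover have "u \<noteq> 0" using u(2) assms(2) by auto
  ultimately have "unit_of u" unfolding unit_of_def using u(1) by blast
  moreover have "a = u * t ^ k" using u(2) by (simp only: mult.commute)
  ultimately show thesis by (rule that)
qed

lemma unit_factorization_fraction:
  assumes "a \<in> A" "b \<in> A" "a \<noteq> 0" "b \<noteq> 0"
  obtains u v where "unit_of u" "a / b = u * t powi v"
proof -
  obtain u n where u: "unit_of u" "a = u * t ^ n" using unit_factorization assms(1,3) .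
  obtain w k where w: "unit_of w" "b = w * t ^ k" using unit_factorization assms(2,4) .
  have "a / b = (u * inverse w) * (t powi int n / t powi int k)"
    using u(2) w(2) by (simp add: field_simps)
  also have "t powi int n / t powi int k = t powi (int n - int k)"
    using t_nonzero by (simp add: power_int_diff)
  finally show thesis using that unit_of_mult[OF u(1) unit_of_inverse[OF w(1)]] by blast
qed

lemma unit_times_power_mem_iff:
  assumes "unit_of u"
  shows "u * t powi v \<in> A \<longleftrightarrow> 0 \<le> v"
proof
  assume mem: "u * t powi v \<in> A"
  show "0 \<le> v"
  proof (rule ccontr)
    assume "\<not> 0 \<le> v"
    then obtain k where v: "v = - int (Suc k)"
      by (metis negD not_le)
    have "inverse u * (u * t powi v) * t ^ k \<in> A"
      by (intro mult_mem power_mem t_mem mem) (use assms in \<open>simp add: unit_of_def\<close>)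
    moreover have "t * (inverse u * (u * t powi v) * t ^ k) = 1"
      using assms t_nonzero unfolding unit_of_def v power_int_minus power_int_of_nat
      by (simp add: field_simps)
    ultimately show False using t_not_unit by blast
  qed
next
  assume "0 \<le> v"
  then have "t powi v = t ^ nat v" by (simp add: power_int_def)
  then show "u * t powi v \<in> A"
    using assms unfolding unit_of_def by (simp add: mult_mem power_mem t_mem)
qed

lemma order_unique:
  assumes "unit_of u" "unit_of w" "u * t powi m = w * t powi n"
  shows "m = n"
proof -
  have *: "n \<le> m" if "unit_of u" "unit_of w" "u * t powi m = w * t powi n" for u w m n
  proof -
    have "u * t powi (m - n) = w"
      using that(3) t_nonzero by (simp add: power_int_diff field_simps)
    then have "u * t powi (m - n) \<in> A" using that(2) unfolding unit_of_def by simp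
    then show ?thesis using unit_times_power_mem_iff[OF that(1)] by simp
  qed
  show ?thesis using *[OF assms] *[OF assms(2,1) assms(3)[symmetric]] by simp
qed

end

text \<open>Factoring out the lowest power of \<open>x\<close> exposes the lowest coefficient modulo \<open>x\<close>; in this way a
  polynomial relation for \<open>x\<close> says that its lowest coefficient is a multiple of \<open>x\<close>.\<close>

lemma lowest_term:
  fixes x :: "'l :: field"
  assumes A: "0 \<in> A" "\<And>a b. a \<in> A \<Longrightarrow> b \<in> A \<Longrightarrow> a + b \<in> A" "\<And>a b. a \<in> A \<Longrightarrow> b \<in> A \<Longrightarrow> a * b \<in> A" "1 \<in> A"
    and "x \<in> A" "\<And>i. R i \<in> A" and "k \<le> M" "\<And>i. i < k \<Longrightarrow> R i = 0"
  shows "\<exists>Z\<in>A. (\<Sum>i\<le>M. x ^ i * R i) = x ^ k * (R k + x * Z)"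
  using \<open>k \<le> M\<close>
proof (induction M rule: dec_induct)
  case base
  have "(\<Sum>i\<le>k. x ^ i * R i) = (\<Sum>i\<in>{k}. x ^ i * R i)"
    using assms(8) by (intro sum.mono_neutral_right) auto
  then show ?case using A(1) by (intro bexI[of _ 0]) simp_all
next
  case (step n)
  then obtain Z where Z: "Z \<in> A" "(\<Sum>i\<le>n. x ^ i * R i) = x ^ k * (R k + x * Z)" by blast
  have "x ^ n = x ^ k * x ^ (n - k)"
    using step(1) power_add[of x k "n - k"] by simp
  then have "x ^ Suc n = x ^ k * (x * x ^ (n - k))"
    by (simp only: power_Suc mult.left_commute)
  then have "(\<Sum>i\<le>Suc n. x ^ i * R i) = x ^ k * (R k + x * (Z + x ^ (n - k) * R (Suc n)))"
    unfolding sum.atMost_Suc Z(2) by (simp only: distrib_left mult.assoc add.assoc)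
  moreover have "x ^ j \<in> A" for j
    using A(3,4) assms(5) by (induction j) simp_all
  then have "Z + x ^ (n - k) * R (Suc n) \<in> A"
    using Z(1) A(2,3) assms(6) by blast
  ultimately show ?case by blast
qed


section \<open>Local rings of a curve\<close>

locale curve =
  fixes emb :: "'k :: {field, finite} \<Rightarrow> 'l :: field"
    and \<xi> :: "'l ^ 'n :: finite"
    and C :: "('k, 'n) geom_point set"
  assumes curve: "nonsingular_projective_curve emb \<xi> C"
begin

abbreviation K where "K \<equiv> function_field emb \<xi>"
abbreviation reg where "reg P \<equiv> local_ring emb \<xi> P"
abbreviation ev where "ev f \<equiv> eval_at emb f \<xi>"
abbreviation vanishes where "vanishes f P \<equiv> vanishes_at (to_ac :: 'k \<Rightarrow> 'k alg_closure) f P"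

lemma hom: "is_ring_hom emb"
  and closed: "closed_over_ground C"
  and generic: "generic_point emb \<xi> C"
  and trdeg: "trdeg_one emb K"
  and nonsingular: "P \<in> C \<Longrightarrow> nonsingular_at emb \<xi> P"
  using curve by (simp_all add: nonsingular_projective_curve_def)

lemma emb_ring: "emb (a + b) = emb a + emb b" "emb (a * b) = emb a * emb b" "emb 1 = 1" "emb 0 = 0"
  "emb (- a) = - emb a"
  using hom by (simp_all add: ring_hom_zero[OF hom] ring_hom_uminus[OF hom] is_ring_hom_def)

lemma exists_uniformizer: "P \<in> C \<Longrightarrow> \<exists>t. uniformizer emb \<xi> P t"
  using nonsingular unfolding nonsingular_at_def .

lemma point_representative:
  assumes "P \<in> C"
  obtains x where "x \<noteq> 0" "P = proj_point x"
proof -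
  obtain S :: "('n, 'k) mpoly set" where "C = zero_locus to_ac S"
    using closed unfolding closed_over_ground_def by (elim exE conjE) (rule that)
  then have "P \<in> proj_space"
    using assms by (simp add: zero_locus_def)
  then show thesis
    unfolding proj_space_def mem_Collect_eq by (elim exE conjE) (rule that)
qed

lemma ev_eq_zero_iff:
  assumes "homogeneous d g"
  shows "ev g = 0 \<longleftrightarrow> (\<forall>P\<in>C. vanishes g P)"
  using conjunct2[OF generic[unfolded generic_point_def], THEN spec, THEN spec, THEN mp, OF assms] .

lemma ev_nonzero:
  assumes "P \<in> C" "homogeneous d g" "\<not> vanishes g P"
  shows "ev g \<noteq> 0"
  unfolding ev_eq_zero_iff[OF assms(2)] using assms(1,3) by blast

lemma ev_zero_vanishes:
  assumes "P \<in> C" "homogeneous d g" "ev g = 0"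
  shows "vanishes g P"
  using ev_nonzero[OF assms(1,2)] assms(3) by blast

lemma exists_nonvanishing_form:
  assumes "P \<in> C"
  obtains h :: "('n, 'k) mpoly" where "homogeneous d h" "\<not> vanishes h P"
proof -
  obtain x where x: "x \<noteq> 0" "P = proj_point x" using point_representative[OF assms] .
  then obtain l where l: "x $ l \<noteq> 0" using vec_eq_iff[of x 0] unfolding zero_index by blast
  let ?h = "coordinate_power l d 1 :: ('n, 'k) mpoly"
  have "eval_at to_ac ?h x \<noteq> 0"
    using l by (simp add: eval_at_coordinate_power[OF is_ring_hom_to_ac])
  then have "\<not> vanishes ?h P"
    unfolding x(2) using vanishes_at_proj_point[OF homogeneous_coordinate_power] by blast
  then show thesis by (rule that[OF homogeneous_coordinate_power])
qed

lemma vanishes_mult_iff: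
  assumes "P \<in> C" "homogeneous d f" "homogeneous e g"
  shows "vanishes (f * g) P \<longleftrightarrow> vanishes f P \<or> vanishes g P"
proof -
  obtain x where x: "P = proj_point x" using point_representative[OF assms(1)] by blast
  show ?thesis
    unfolding x vanishes_at_proj_point[OF assms(2)] vanishes_at_proj_point[OF assms(3)]
      vanishes_at_proj_point[OF homogeneous_mult[OF assms(2,3)]] eval_at_mult[OF is_ring_hom_to_ac]
    by simp
qed

lemma vanishes_diff:
  assumes "P \<in> C" "homogeneous d f" "homogeneous d g" "vanishes (f - g) P" "vanishes f P"
  shows "vanishes g P"
proof -
  obtain x where x: "P = proj_point x" using point_representative[OF assms(1)] by blast
  show ?thesis
    using assms(4,5)
    unfolding x vanishes_at_proj_point[OF assms(2)] vanishes_at_proj_point[OF assms(3)]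
      vanishes_at_proj_point[OF homogeneous_diff[OF assms(2,3)]] eval_at_diff[OF is_ring_hom_to_ac]
    by simp
qed

lemma regI:
  assumes "homogeneous d a" "homogeneous d b" "\<not> vanishes b P" "f = ev a / ev b"
  shows "f \<in> reg P"
  using assms unfolding local_ring_def by blast

lemma regE:
  assumes "f \<in> reg P"
  obtains d a b where "homogeneous d a" "homogeneous d b" "\<not> vanishes b P" "f = ev a / ev b"
  using assms unfolding local_ring_def by blast

lemma reg_add:
  assumes "P \<in> C" "f \<in> reg P" "g \<in> reg P"
  shows "f + g \<in> reg P"
proof -
  obtain d a b where f: "homogeneous d a" "homogeneous d b" "\<not> vanishes b P" "f = ev a / ev b"
    using regE[OF assms(2)] .
  obtain e a' b' where g: "homogeneous e a'" "homogeneous e b'" "\<not> vanishes b' P" "g = ev a' / ev b'"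
    using regE[OF assms(3)] .
  show ?thesis
  proof (rule regI)
    show "homogeneous (d + e) (a * b' + b * a')" "homogeneous (d + e) (b * b')"
      using f g by (simp_all add: homogeneous_add homogeneous_mult)
    show "\<not> vanishes (b * b') P"
      using vanishes_mult_iff[OF assms(1) f(2) g(2)] f(3) g(3) by simp
    show "f + g = ev (a * b' + b * a') / ev (b * b')"
      using ev_nonzero[OF assms(1) f(2,3)] ev_nonzero[OF assms(1) g(2,3)]
      unfolding f(4) g(4) by (simp add: eval_at_add[OF hom] eval_at_mult[OF hom] add_frac_eq mult.commute)
  qed
qed

lemma reg_mult:
  assumes "P \<in> C" "f \<in> reg P" "g \<in> reg P"
  shows "f * g \<in> reg P"
proof -
  obtain d a b where f: "homogeneous d a" "homogeneous d b" "\<not> vanishes b P" "f = ev a / ev b"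
    using regE[OF assms(2)] .
  obtain e a' b' where g: "homogeneous e a'" "homogeneous e b'" "\<not> vanishes b' P" "g = ev a' / ev b'"
    using regE[OF assms(3)] .
  show ?thesis
  proof (rule regI)
    show "homogeneous (d + e) (a * a')" "homogeneous (d + e) (b * b')"
      using f g by (simp_all add: homogeneous_mult)
    show "\<not> vanishes (b * b') P"
      using vanishes_mult_iff[OF assms(1) f(2) g(2)] f(3) g(3) by simp
    show "f * g = ev (a * a') / ev (b * b')"
      using f(4) g(4) by (simp add: eval_at_mult[OF hom])
  qed
qed

lemma reg_const:
  assumes "P \<in> C"
  shows "emb c \<in> reg P"
proof -
  obtain h :: "('n, 'k) mpoly" where h: "homogeneous 0 h" "\<not> vanishes h P"
    using exists_nonvanishing_form[OF assms] .
  have c: "homogeneous 0 (Poly_Mapping.single 0 c)" for c :: 'k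
    by (simp add: homogeneous_def)
  have "homogeneous 0 (Poly_Mapping.single 0 c * h)"
    using homogeneous_mult[OF c h(1)] by simp
  then show ?thesis
    using h
  proof (rule regI)
    show "emb c = ev (Poly_Mapping.single 0 c * h) / ev h"
      using ev_nonzero[OF assms h] by (simp add: eval_at_mult[OF hom] eval_at_single[OF hom])
  qed
qed

lemma reg_one: "P \<in> C \<Longrightarrow> 1 \<in> reg P"
  using reg_const[of P 1] by (simp add: emb_ring)

lemma reg_zero: "P \<in> C \<Longrightarrow> 0 \<in> reg P"
  using reg_const[of P 0] by (simp add: emb_ring)

lemma reg_uminus: "P \<in> C \<Longrightarrow> f \<in> reg P \<Longrightarrow> - f \<in> reg P"
  using reg_mult[OF _ reg_const[of P "- 1"], of f] by (simp add: emb_ring)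

lemma KE:
  assumes "f \<in> K"
  obtains d and a b :: "('n, 'k) mpoly"
  where "homogeneous d a" "homogeneous d b" "ev b \<noteq> 0" "f = ev a / ev b"
  using assms unfolding function_field_def by blast

lemma KI:
  assumes "homogeneous d a" "homogeneous d b" "ev b \<noteq> 0" "f = ev a / ev b"
  shows "f \<in> K"
  using assms unfolding function_field_def by blast

lemma reg_subset_K:
  assumes "P \<in> C" "f \<in> reg P"
  shows "f \<in> K"
proof -
  obtain d a b where f: "homogeneous d a" "homogeneous d b" "\<not> vanishes b P" "f = ev a / ev b"
    using regE[OF assms(2)] .
  show ?thesis by (rule KI[OF f(1,2) ev_nonzero[OF assms(1) f(2,3)] f(4)])
qed

lemma K_add:
  assumes "f \<in> K" "g \<in> K"
  shows "f + g \<in> K"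
proof -
  obtain d a b where f: "homogeneous d a" "homogeneous d b" "ev b \<noteq> 0" "f = ev a / ev b"
    using KE[OF assms(1)] .
  obtain e a' b' where g: "homogeneous e a'" "homogeneous e b'" "ev b' \<noteq> 0" "g = ev a' / ev b'"
    using KE[OF assms(2)] .
  show ?thesis
  proof (rule KI)
    show "homogeneous (d + e) (a * b' + b * a')" "homogeneous (d + e) (b * b')"
      using f g by (simp_all add: homogeneous_add homogeneous_mult)
    show "ev (b * b') \<noteq> 0" "f + g = ev (a * b' + b * a') / ev (b * b')"
      using f(3) g(3) unfolding f(4) g(4)
      by (simp_all add: eval_at_add[OF hom] eval_at_mult[OF hom] add_frac_eq mult.commute)
  qed
qed

lemma K_const_mult:
  assumes "f \<in> K"
  shows "emb c * f \<in> K"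
proof -
  obtain d a b where f: "homogeneous d a" "homogeneous d b" "ev b \<noteq> 0" "f = ev a / ev b"
    using KE[OF assms] .
  have c: "homogeneous 0 (Poly_Mapping.single 0 c)"
    by (simp add: homogeneous_def)
  have "homogeneous d (Poly_Mapping.single 0 c * a)"
    using homogeneous_mult[OF c f(1)] by simp
  then show ?thesis
    using f(2,3)
  proof (rule KI)
    show "emb c * f = ev (Poly_Mapping.single 0 c * a) / ev b"
      using f(4) by (simp add: eval_at_mult[OF hom] eval_at_single[OF hom])
  qed
qed

lemma K_fraction_of_regular:
  assumes "P \<in> C" "f \<in> K"
  obtains a b where "a \<in> reg P" "b \<in> reg P" "b \<noteq> 0" "f = a / b"
proof -
  obtain d a b where f: "homogeneous d a" "homogeneous d b" "ev b \<noteq> 0" "f = ev a / ev b"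
    using KE[OF assms(2)] .
  obtain h :: "('n, 'k) mpoly" where h: "homogeneous d h" "\<not> vanishes h P"
    using exists_nonvanishing_form[OF assms(1)] .
  have nz: "ev h \<noteq> 0" by (rule ev_nonzero[OF assms(1) h])
  show thesis
  proof (rule that)
    show "ev a / ev h \<in> reg P" "ev b / ev h \<in> reg P"
      using f h by (auto intro: regI)
    show "ev b / ev h \<noteq> 0" "f = (ev a / ev h) / (ev b / ev h)"
      using f(3,4) nz by simp_all
  qed
qed

lemma unit_or_max_ideal:
  assumes "f \<in> reg P"
  shows "inverse f \<in> reg P \<or> f \<in> max_ideal emb \<xi> P"
proof -
  obtain d a b where f: "homogeneous d a" "homogeneous d b" "\<not> vanishes b P" "f = ev a / ev b"
    using regE[OF assms] .
  show ?thesis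
  proof (cases "vanishes a P")
    case True
    have "f \<in> max_ideal emb \<xi> P"
      unfolding max_ideal_def mem_Collect_eq by (intro exI conjI) (rule f(4) f(1) f(2) True f(3))+
    then show ?thesis ..
  next
    case False
    have "inverse f = ev b / ev a" using f(4) by simp
    then have "inverse f \<in> reg P" by (rule regI[OF f(2,1) False])
    then show ?thesis ..
  qed
qed

lemma one_not_max_ideal:
  assumes "P \<in> C"
  shows "1 \<notin> max_ideal emb \<xi> P"
proof
  assume "1 \<in> max_ideal emb \<xi> P"
  then obtain d and a b :: "('n, 'k) mpoly" where ab: "1 = ev a / ev b" "homogeneous d a"
    "homogeneous d b" "vanishes a P" "\<not> vanishes b P"
    unfolding max_ideal_def mem_Collect_eq by (elim exE conjE) (rule that)
  have "ev b \<noteq> 0" by (rule ev_nonzero[OF assms ab(3,5)])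
  then have "ev a = ev b"
    using divide_eq_1_iff[of "ev a" "ev b"] ab(1)[symmetric] by blast
  then have "ev (a - b) = 0"
    by (simp add: eval_at_diff[OF hom])
  then have "vanishes (a - b) P"
    by (rule ev_zero_vanishes[OF assms homogeneous_diff[OF ab(2,3)]])
  then have "vanishes b P"
    by (rule vanishes_diff[OF assms ab(2,3) _ ab(4)])
  then show False using ab(5) by blast
qed

lemma max_ideal_subset_reg: "max_ideal emb \<xi> P \<subseteq> reg P"
  unfolding max_ideal_def local_ring_def by blast

lemma max_ideal_multiple:
  assumes "uniformizer emb \<xi> P t"
  shows "f \<in> max_ideal emb \<xi> P \<longleftrightarrow> (\<exists>b\<in>reg P. f = t * b)"
proof -
  have "max_ideal emb \<xi> P = {t * a | a. a \<in> reg P}"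
    using assms unfolding uniformizer_def by (rule conjunct2)
  then show ?thesis by (simp only:) blast
qed

text \<open>Nonzero constants are units, and \<open>1\<close> is not in the maximal ideal.\<close>

lemma const_not_multiple:
  assumes "P \<in> C" "uniformizer emb \<xi> P t" "c \<noteq> 0" "b \<in> reg P"
  shows "emb c \<noteq> t * b"
proof
  assume eq: "emb c = t * b"
  have "emb (inverse c) * emb c = 1"
    using assms(3) by (simp flip: emb_ring(2) add: emb_ring(3))
  then have "1 = t * (emb (inverse c) * b)"
    unfolding eq by (simp add: mult_ac)
  moreover have "emb (inverse c) * b \<in> reg P"
    by (intro reg_mult reg_const assms(1,4))
  ultimately have "1 \<in> max_ideal emb \<xi> P"
    using max_ideal_multiple[OF assms(2)] by blast
  then show False using one_not_max_ideal[OF assms(1)] by blast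
qed

lemma uniformizer_mem:
  assumes "P \<in> C" "uniformizer emb \<xi> P t"
  shows "t \<in> reg P"
proof -
  have "t * 1 \<in> max_ideal emb \<xi> P"
    using max_ideal_multiple[OF assms(2)] reg_one[OF assms(1)] by blast
  then show ?thesis using max_ideal_subset_reg by auto
qed

text \<open>A polynomial relation between \<open>a\<close> and \<open>t\<close>, divided by the largest possible power of \<open>a\<close>, shows that
  a nonzero polynomial in \<open>t\<close> is a multiple of \<open>a\<close>. But such a polynomial is divisible by \<open>t\<close> only
  finitely often.\<close>

lemma infinitely_divisible_imp_zero:
  assumes P: "P \<in> C" and t: "uniformizer emb \<xi> P t"
    and a: "a \<in> reg P" "\<And>n. \<exists>b\<in>reg P. a = t ^ n * b"
  shows "a = 0"
proof (rule ccontr)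
  assume nz: "a \<noteq> 0"
  have tmem: "t \<in> reg P" by (rule uniformizer_mem[OF P t])
  have tnz: "t \<noteq> 0" using t unfolding uniformizer_def by (rule conjunct1)
  obtain M c where c: "\<exists>i\<le>M. \<exists>j\<le>M. c i j \<noteq> 0"
    "(\<Sum>i\<le>M. \<Sum>j\<le>M. emb (c i j) * (a ^ i * t ^ j)) = 0"
    by (rule exists_algebraic_relation[OF hom trdeg reg_subset_K[OF P a(1)] reg_subset_K[OF P tmem]])
  define R where "R i = (\<Sum>j\<le>M. t ^ j * emb (c i j))" for i
  have R: "R i \<in> reg P" for i
  proof -
    have "t ^ j \<in> reg P" for j
      by (induction j) (simp_all add: reg_one reg_mult P tmem)
    then have terms: "t ^ j * emb (c i j) \<in> reg P" for j
      by (intro reg_mult[OF P] reg_const[OF P])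
    have "(\<Sum>j\<in>J. t ^ j * emb (c i j)) \<in> reg P" if "finite J" for J
      using that by (induction J rule: finite_induct) (simp_all add: reg_zero reg_add P terms)
    then show ?thesis unfolding R_def by simp
  qed
  define i\<^sub>0 where "i\<^sub>0 = (LEAST i. \<exists>j\<le>M. c i j \<noteq> 0)"
  have i\<^sub>0: "\<exists>j\<le>M. c i\<^sub>0 j \<noteq> 0"
    unfolding i\<^sub>0_def by (rule LeastI_ex) (use c(1) in blast)
  obtain i\<^sub>1 where "i\<^sub>1 \<le> M" "\<exists>j\<le>M. c i\<^sub>1 j \<noteq> 0" using c(1) by blast
  then have i\<^sub>0_le: "i\<^sub>0 \<le> M"
    unfolding i\<^sub>0_def using Least_le[of "\<lambda>i. \<exists>j\<le>M. c i j \<noteq> 0" i\<^sub>1] by (meson order_trans)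
  have below: "c i j = 0" if "i < i\<^sub>0" "j \<le> M" for i j
    using not_less_Least[of i "\<lambda>i. \<exists>j\<le>M. c i j \<noteq> 0"] that unfolding i\<^sub>0_def by blast
  have R_zero: "R i = 0" if "i < i\<^sub>0" for i
    unfolding R_def using below[OF that] by (intro sum.neutral) (simp add: emb_ring)
  have "\<exists>Z\<in>reg P. (\<Sum>i\<le>M. a ^ i * R i) = a ^ i\<^sub>0 * (R i\<^sub>0 + a * Z)"
    by (rule lowest_term) (simp_all add: reg_zero reg_add reg_mult reg_one P a(1) R i\<^sub>0_le R_zero)
  then obtain Z where Z: "Z \<in> reg P" "(\<Sum>i\<le>M. a ^ i * R i) = a ^ i\<^sub>0 * (R i\<^sub>0 + a * Z)" ..
  have "(\<Sum>i\<le>M. a ^ i * R i) = 0"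
    using c(2) unfolding R_def by (simp add: sum_distrib_left mult_ac)
  then have R0: "R i\<^sub>0 = - (a * Z)"
    using Z(2) nz by (simp add: eq_neg_iff_add_eq_0)
  define j\<^sub>0 where "j\<^sub>0 = (LEAST j. c i\<^sub>0 j \<noteq> 0)"
  have j\<^sub>0: "c i\<^sub>0 j\<^sub>0 \<noteq> 0"
    unfolding j\<^sub>0_def by (rule LeastI_ex) (use i\<^sub>0 in blast)
  obtain j\<^sub>1 where "j\<^sub>1 \<le> M" "c i\<^sub>0 j\<^sub>1 \<noteq> 0" using i\<^sub>0 by blast
  then have j\<^sub>0_le: "j\<^sub>0 \<le> M"
    unfolding j\<^sub>0_def using Least_le[of "\<lambda>j. c i\<^sub>0 j \<noteq> 0" j\<^sub>1] by (meson order_trans)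
  have c_zero: "emb (c i\<^sub>0 j) = 0" if "j < j\<^sub>0" for j
    using not_less_Least[of j "\<lambda>j. c i\<^sub>0 j \<noteq> 0"] that unfolding j\<^sub>0_def by (simp add: emb_ring)
  have "\<exists>Y\<in>reg P. R i\<^sub>0 = t ^ j\<^sub>0 * (emb (c i\<^sub>0 j\<^sub>0) + t * Y)"
    unfolding R_def
    by (rule lowest_term) (simp_all add: reg_zero reg_add reg_mult reg_one reg_const P tmem j\<^sub>0_le c_zero)
  then obtain Y where Y: "Y \<in> reg P" "R i\<^sub>0 = t ^ j\<^sub>0 * (emb (c i\<^sub>0 j\<^sub>0) + t * Y)" ..
  obtain b where b: "b \<in> reg P" "a = t ^ Suc j\<^sub>0 * b" using a(2) by blast
  have "t ^ j\<^sub>0 * (emb (c i\<^sub>0 j\<^sub>0) + t * Y) = t ^ j\<^sub>0 * - (t * (b * Z))"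
    using R0 Y(2) b(2) by (simp add: mult_ac)
  then have "emb (c i\<^sub>0 j\<^sub>0) + t * Y = - (t * (b * Z))"
    using tnz by (metis mult_left_cancel power_not_zero)
  then have "emb (c i\<^sub>0 j\<^sub>0) = - (t * (b * Z)) - t * Y"
    by (rule eq_diff_eq[THEN iffD2])
  also have "\<dots> = t * (- Y + - (b * Z))"
    by (simp add: algebra_simps)
  finally have "emb (c i\<^sub>0 j\<^sub>0) = t * (- Y + - (b * Z))" .
  moreover have "- Y + - (b * Z) \<in> reg P"
    by (intro reg_add reg_uminus reg_mult P Y(1) b(1) Z(1))
  ultimately show False using const_not_multiple[OF P t j\<^sub>0] by blast
qed

lemma uniformized_ring_reg:
  assumes P: "P \<in> C" and t: "uniformizer emb \<xi> P t"
  shows "uniformized_ring (reg P) t"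
proof
  show "1 \<in> reg P" "t \<in> reg P" by (rule reg_one[OF P], rule uniformizer_mem[OF P t])
  show "t \<noteq> 0" using t unfolding uniformizer_def by (rule conjunct1)
  show "a + b \<in> reg P" if "a \<in> reg P" "b \<in> reg P" for a b
    by (rule reg_add[OF P that])
  show "a * b \<in> reg P" if "a \<in> reg P" "b \<in> reg P" for a b
    by (rule reg_mult[OF P that])
  show "inverse a \<in> reg P \<or> (\<exists>b\<in>reg P. a = t * b)" if "a \<in> reg P" for a
    using unit_or_max_ideal[OF that] max_ideal_multiple[OF t, of a] by blast
  show "t * b \<noteq> 1" if "b \<in> reg P" for b
    using const_not_multiple[OF P t one_neq_zero that] unfolding emb_ring(3) by (rule not_sym)
  show "a = 0" if "a \<in> reg P" "\<And>n. \<exists>b\<in>reg P. a = t ^ n * b" for a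
    by (rule infinitely_divisible_imp_zero[OF P t that])
qed


section \<open>Valuations\<close>

text \<open>Two uniformizers differ by a unit, so the exponent does not depend on the uniformizer.\<close>

lemma val_eq:
  assumes P: "P \<in> C" and t: "uniformizer emb \<xi> P t"
    and u: "uniformized_ring.unit_of (reg P) u"
  shows "val emb \<xi> P (u * t powi v) = v"
proof -
  interpret T: uniformized_ring "reg P" t by (rule uniformized_ring_reg[OF P t])
  show ?thesis
    unfolding val_def
  proof (rule the_equality)
    show "\<exists>t' u'. uniformizer emb \<xi> P t' \<and> u' \<noteq> 0 \<and> u' \<in> reg P \<and> inverse u' \<in> reg P \<and>
        u * t powi v = u' * t' powi v"
      by (intro exI[of _ t] exI[of _ u]) (use t u in \<open>simp add: T.unit_of_def\<close>)
  next
    fix v' assume "\<exists>t' u'. uniformizer emb \<xi> P t' \<and> u' \<noteq> 0 \<and> u' \<in> reg P \<and> inverse u' \<in> reg P \<and>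
        u * t powi v = u' * t' powi v'"
    then obtain t' u' where t': "uniformizer emb \<xi> P t'"
      and nz: "u' \<noteq> 0" "u' \<in> reg P" "inverse u' \<in> reg P"
      and eq: "u * t powi v = u' * t' powi v'"
      by (elim exE conjE) (rule that)
    have u': "T.unit_of u'" unfolding T.unit_of_def using nz by simp
    interpret T': uniformized_ring "reg P" t' by (rule uniformized_ring_reg[OF P t'])
    have "t \<in> max_ideal emb \<xi> P"
      unfolding max_ideal_multiple[OF t] by (rule bexI[OF _ reg_one[OF P]]) simp
    moreover have "t' \<in> max_ideal emb \<xi> P"
      unfolding max_ideal_multiple[OF t'] by (rule bexI[OF _ reg_one[OF P]]) simp
    ultimately obtain a b where a: "a \<in> reg P" "t = t' * a" and b: "b \<in> reg P" "t' = t * b"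
      unfolding max_ideal_multiple[OF t', of t] max_ideal_multiple[OF t, of t']
      by (elim bexE) (rule that)
    have "t * (b * a) = t * 1"
      unfolding mult.assoc[symmetric] b(2)[symmetric] a(2)[symmetric] by simp
    then have ba: "b * a = 1" by (rule iffD1[OF mult_left_cancel[OF T.t_nonzero]])
    then have "inverse b = a" by (rule inverse_unique)
    moreover have "b \<noteq> 0" using ba by auto
    ultimately have unit: "T.unit_of b" unfolding T.unit_of_def using a(1) b(1) by simp
    have "u * t powi v = (u' * b powi v') * t powi v'"
      unfolding eq b(2) power_int_mult_distrib by (simp only: mult_ac)
    then have "v = v'"
      by (rule T.order_unique[OF u T.unit_of_mult[OF u' T.unit_of_power_int[OF unit]]])
    then show "v' = v" ..
  qed
qed

lemma val_factorization:
  assumes P: "P \<in> C" and t: "uniformizer emb \<xi> P t" and f: "f \<in> K" "f \<noteq> 0"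
  obtains u where "uniformized_ring.unit_of (reg P) u" "f = u * t powi (val emb \<xi> P f)"
proof -
  interpret T: uniformized_ring "reg P" t by (rule uniformized_ring_reg[OF P t])
  obtain a b where ab: "a \<in> reg P" "b \<in> reg P" "b \<noteq> 0" "f = a / b"
    using K_fraction_of_regular[OF P f(1)] .
  have "a \<noteq> 0" using ab(4) f(2) by auto
  then obtain u v where u: "T.unit_of u" "a / b = u * t powi v"
    by (rule T.unit_factorization_fraction[OF ab(1,2) _ ab(3)]) (rule that)
  have f_eq: "f = u * t powi v" using ab(4) u(2) by (rule trans)
  then have "val emb \<xi> P f = v" using val_eq[OF P t u(1)] by (simp only:)
  then show thesis using that[OF u(1)] f_eq by (simp only:)
qed

lemma val_ge_iff:
  assumes P: "P \<in> C" and t: "uniformizer emb \<xi> P t" and f: "f \<in> K" "f \<noteq> 0"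
  shows "n \<le> val emb \<xi> P f \<longleftrightarrow> (\<exists>b\<in>reg P. f = t powi n * b)"
proof -
  interpret T: uniformized_ring "reg P" t by (rule uniformized_ring_reg[OF P t])
  obtain u where u: "T.unit_of u" "f = u * t powi (val emb \<xi> P f)"
    using val_factorization[OF assms] .
  define b where "b = u * t powi (val emb \<xi> P f - n)"
  have "t powi val emb \<xi> P f = t powi n * t powi (val emb \<xi> P f - n)"
    using T.t_nonzero by (simp flip: power_int_add)
  then have "u * t powi val emb \<xi> P f = t powi n * b"
    unfolding b_def by (simp only: mult.left_commute)
  then have fb: "f = t powi n * b"
    using u(2) by (rule trans[rotated])
  have nz: "t powi n \<noteq> 0" using T.t_nonzero by simp
  have "(\<exists>b\<in>reg P. f = t powi n * b) \<longleftrightarrow> b \<in> reg P"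
    unfolding fb mult_left_cancel[OF nz] by blast
  also have "\<dots> \<longleftrightarrow> n \<le> val emb \<xi> P f"
    unfolding b_def using T.unit_times_power_mem_iff[OF u(1)] by simp
  finally show ?thesis by simp
qed

lemma val_nonneg_iff:
  assumes "P \<in> C" "f \<in> K" "f \<noteq> 0"
  shows "0 \<le> val emb \<xi> P f \<longleftrightarrow> f \<in> reg P"
proof -
  obtain t where t: "uniformizer emb \<xi> P t" using exists_uniformizer[OF assms(1)] by blast
  show ?thesis unfolding val_ge_iff[OF assms(1) t assms(2,3)] by auto
qed

lemma val_ge_add:
  assumes P: "P \<in> C" and f: "f \<in> K" "f \<noteq> 0" "n \<le> val emb \<xi> P f"
    and g: "g \<in> K" "g \<noteq> 0" "n \<le> val emb \<xi> P g" and "f + g \<noteq> 0"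
  shows "n \<le> val emb \<xi> P (f + g)"
proof -
  obtain t where t: "uniformizer emb \<xi> P t" using exists_uniformizer[OF P] by blast
  obtain a where a: "a \<in> reg P" "f = t powi n * a" using val_ge_iff[OF P t f(1,2)] f(3) by blast
  obtain b where b: "b \<in> reg P" "g = t powi n * b" using val_ge_iff[OF P t g(1,2)] g(3) by blast
  have "f + g = t powi n * (a + b)" by (simp only: a(2) b(2) distrib_left)
  then show ?thesis
    using val_ge_iff[OF P t K_add[OF f(1) g(1)] assms(8)] reg_add[OF P a(1) b(1)] by blast
qed

lemma val_const_mult:
  assumes P: "P \<in> C" and f: "f \<in> K" "f \<noteq> 0" and c: "c \<noteq> 0"
  shows "val emb \<xi> P (emb c * f) = val emb \<xi> P f"
proof -
  obtain t where t: "uniformizer emb \<xi> P t" using exists_uniformizer[OF P] by blast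
  interpret T: uniformized_ring "reg P" t by (rule uniformized_ring_reg[OF P t])
  obtain u where u: "T.unit_of u" "f = u * t powi (val emb \<xi> P f)"
    using val_factorization[OF P t f] .
  have "T.unit_of (emb c)"
    unfolding T.unit_of_def field_hom_inverse[OF hom, symmetric]
    using field_hom_nonzero[OF hom c] reg_const[OF P] by blast
  then have "T.unit_of (emb c * u)" using u(1) by (rule T.unit_of_mult)
  then have "val emb \<xi> P ((emb c * u) * t powi (val emb \<xi> P f)) = val emb \<xi> P f"
    by (rule val_eq[OF P t])
  moreover have "emb c * f = (emb c * u) * t powi (val emb \<xi> P f)"
    unfolding mult.assoc using u(2) by (rule arg_cong)
  ultimately show ?thesis by (simp only:)
qed

lemma val_add_eq:
  assumes P: "P \<in> C" and f: "f \<in> K" "f \<noteq> 0" and g: "g \<in> K" "g \<noteq> 0"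
    and less: "val emb \<xi> P f < val emb \<xi> P g"
  shows "f + g \<noteq> 0" "val emb \<xi> P (f + g) = val emb \<xi> P f"
proof -
  have neg: "- h \<in> K" "val emb \<xi> P (- h) = val emb \<xi> P h" if "h \<in> K" "h \<noteq> 0" for h
    using K_const_mult[OF that(1), of "- 1"] val_const_mult[OF P that, of "- 1"]
    by (simp_all add: emb_ring)
  show nz: "f + g \<noteq> 0"
  proof
    assume "f + g = 0"
    then have "f = - g" by (simp add: eq_neg_iff_add_eq_0)
    then show False using neg(2)[OF g] less by simp
  qed
  have "val emb \<xi> P f \<le> val emb \<xi> P (f + g)"
    by (rule val_ge_add[OF P f order_refl g _ nz]) (use less in simp)
  moreover have "\<not> val emb \<xi> P f + 1 \<le> val emb \<xi> P (f + g)"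
  proof
    assume *: "val emb \<xi> P f + 1 \<le> val emb \<xi> P (f + g)"
    have "val emb \<xi> P f + 1 \<le> val emb \<xi> P (f + g + - g)"
    proof (rule val_ge_add[OF P K_add[OF f(1) g(1)] nz * neg(1)[OF g]])
      show "- g \<noteq> 0" "f + g + - g \<noteq> 0" using f(2) g(2) by simp_all
      show "val emb \<xi> P f + 1 \<le> val emb \<xi> P (- g)" unfolding neg(2)[OF g] using less by simp
    qed
    then show False by simp
  qed
  ultimately show "val emb \<xi> P (f + g) = val emb \<xi> P f" by simp
qed

text \<open>At a rational point, the value of a regular function is computed in the ground field.\<close>

lemma residue:
  assumes P: "P \<in> rational_points C" and f: "f \<in> reg P"
  obtains c where "f - emb c \<in> max_ideal emb \<xi> P"
proof -
  have PC: "P \<in> C" using P unfolding rational_points_def by blast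
  obtain x :: "'k ^ 'n" where x: "P = proj_point (\<chi> i. to_ac (x $ i))"
    using P unfolding rational_points_def by blast
  obtain d a b where ab: "homogeneous d a" "homogeneous d b" "\<not> vanishes b P" "f = ev a / ev b"
    using regE[OF f] .
  have eval: "eval_at to_ac g (\<chi> i. to_ac (x $ i)) = to_ac (eval_at id g x)" for g :: "('n, 'k) mpoly"
    unfolding eval_at_def by (simp add: to_ac_sum to_ac_prod)
  define c where "c = eval_at id a x / eval_at id b x"
  have b0: "eval_at id b x \<noteq> 0"
    using ab(3) unfolding x vanishes_at_proj_point[OF ab(2)] eval by simp
  have s: "homogeneous 0 (Poly_Mapping.single 0 c)"
    by (simp add: homogeneous_def)
  have cb: "homogeneous d (Poly_Mapping.single 0 c * b)"
    using homogeneous_mult[OF s ab(2)] by simp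
  have "eval_at to_ac (a - Poly_Mapping.single 0 c * b) (\<chi> i. to_ac (x $ i)) = 0"
    using b0 unfolding eval_at_diff[OF is_ring_hom_to_ac] eval_at_mult[OF is_ring_hom_to_ac]
      eval_at_single[OF is_ring_hom_to_ac] unfolding eval c_def by simp
  then have van: "vanishes (a - Poly_Mapping.single 0 c * b) P"
    unfolding x vanishes_at_proj_point[OF homogeneous_diff[OF ab(1) cb]] .
  have quot: "f - emb c = ev (a - Poly_Mapping.single 0 c * b) / ev b"
    using ev_nonzero[OF PC ab(2,3)] ab(4)
    by (simp add: eval_at_diff[OF hom] eval_at_mult[OF hom] eval_at_single[OF hom] diff_divide_distrib)
  have "f - emb c \<in> max_ideal emb \<xi> P"
    unfolding max_ideal_def mem_Collect_eq
    by (intro exI conjI) (rule quot homogeneous_diff[OF ab(1) cb] ab(2) van ab(3))+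
  then show thesis by (rule that)
qed

text \<open>The quotient of two functions of equal order is a unit; subtracting its residue leaves a multiple of the
  uniformizer.\<close>

lemma cancel_leading_term:
  assumes P: "P \<in> rational_points C" and f: "f \<in> K" "f \<noteq> 0" and h: "h \<in> K" "h \<noteq> 0"
    and eq: "val emb \<xi> P f = val emb \<xi> P h"
  obtains c where "c \<noteq> 0" "f = emb c * h \<or> val emb \<xi> P h < val emb \<xi> P (f - emb c * h)"
proof -
  have PC: "P \<in> C" using P unfolding rational_points_def by blast
  obtain t where t: "uniformizer emb \<xi> P t" using exists_uniformizer[OF PC] by blast
  interpret T: uniformized_ring "reg P" t by (rule uniformized_ring_reg[OF PC t])
  obtain u where u: "T.unit_of u" "f = u * t powi (val emb \<xi> P f)"
    using val_factorization[OF PC t f] .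
  obtain w where w: "T.unit_of w" "h = w * t powi (val emb \<xi> P h)"
    using val_factorization[OF PC t h] .
  define q where "q = u * inverse w"
  have q: "T.unit_of q" unfolding q_def by (rule T.unit_of_mult[OF u(1) T.unit_of_inverse[OF w(1)]])
  have "w \<noteq> 0" using w(1) unfolding T.unit_of_def by blast
  then have qw: "q * w = u" unfolding q_def by simp
  have "q * h = q * (w * t powi (val emb \<xi> P h))"
    using w(2) by (rule arg_cong)
  also have "\<dots> = u * t powi (val emb \<xi> P h)"
    unfolding mult.assoc[symmetric] qw ..
  also have "\<dots> = f"
    using u(2)[symmetric] unfolding eq .
  finally have fq: "f = q * h" ..
  have "q \<in> reg P" using q unfolding T.unit_of_def by blast
  then obtain c where c: "q - emb c \<in> max_ideal emb \<xi> P" using residue[OF P] by blast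
  then obtain b where b: "b \<in> reg P" "q - emb c = t * b"
    using max_ideal_multiple[OF t] by blast
  have "c \<noteq> 0"
  proof
    assume "c = 0"
    then have "q = t * b" using b(2) by (simp add: emb_ring)
    moreover have "q \<noteq> 0" using q unfolding T.unit_of_def by blast
    ultimately have "t * (b * inverse q) = 1"
      using right_inverse[of q] by (simp add: mult.assoc[symmetric])
    moreover have "b * inverse q \<in> reg P"
      using q reg_mult[OF PC b(1)] unfolding T.unit_of_def by blast
    ultimately show False using T.t_not_unit by blast
  qed
  moreover
  have "val emb \<xi> P h < val emb \<xi> P (f - emb c * h)" if ne: "f \<noteq> emb c * h"
  proof -
    have "f - emb c * h = (q - emb c) * h" by (simp only: fq left_diff_distrib)
    also have "\<dots> = (t * b) * (w * t powi (val emb \<xi> P h))"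
      unfolding b(2) using w(2) by (rule arg_cong)
    also have "\<dots> = (t powi (val emb \<xi> P h) * t) * (b * w)" by (simp only: mult_ac)
    also have "t powi (val emb \<xi> P h) * t = t powi (val emb \<xi> P h + 1)"
      using T.t_nonzero by (simp add: power_int_add_1)
    finally have "f - emb c * h = t powi (val emb \<xi> P h + 1) * (b * w)" .
    moreover have "b * w \<in> reg P"
      using w(1) reg_mult[OF PC b(1)] unfolding T.unit_of_def by blast
    moreover have "f - emb c * h \<in> K"
      using K_add[OF f(1) K_const_mult[OF h(1), of "- c"]] by (simp add: emb_ring)
    ultimately have "val emb \<xi> P h + 1 \<le> val emb \<xi> P (f - emb c * h)"
      using val_ge_iff[OF PC t, of "f - emb c * h"] ne unfolding right_minus_eq by blast
    then show ?thesis by simp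
  qed
  ultimately show thesis by (intro that[of c]) blast+
qed


section \<open>Functions without poles\<close>

text \<open>The lowest coefficient of an algebraic equation for \<open>f\<close> would be a multiple of \<open>f\<close>, although it is a
  nonzero constant.\<close>

lemma not_algebraic_of_zero:
  assumes P: "P \<in> C" and f: "f \<in> K" "f \<noteq> 0" "0 < val emb \<xi> P f"
    and p: "\<And>n. coeff p n \<in> range emb" "poly p f = 0"
  shows "p = 0"
proof (rule ccontr)
  assume "p \<noteq> 0"
  obtain t where t: "uniformizer emb \<xi> P t" using exists_uniformizer[OF P] by blast
  have "1 \<le> val emb \<xi> P f" using f(3) by simp
  then have "\<exists>b\<in>reg P. f = t * b"
    unfolding val_ge_iff[OF P t f(1,2)] power_int_1_right .
  then obtain b where b: "b \<in> reg P" "f = t * b" ..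
  have freg: "f \<in> reg P"
    using val_nonneg_iff[OF P f(1,2)] f(3) by simp
  have creg: "coeff p n \<in> reg P" for n
  proof -
    obtain c where "coeff p n = emb c" using p(1)[of n] by (rule rangeE)
    then show ?thesis using reg_const[OF P] by simp
  qed
  define k where "k = (LEAST k. coeff p k \<noteq> 0)"
  have lead: "coeff p (Polynomial.degree p) \<noteq> 0" using \<open>p \<noteq> 0\<close> by simp
  have k: "coeff p k \<noteq> 0"
    unfolding k_def by (rule LeastI[of _ "Polynomial.degree p"]) (rule lead)
  have k_le: "k \<le> Polynomial.degree p"
    unfolding k_def by (rule Least_le) (rule lead)
  have below: "coeff p i = 0" if "i < k" for i
    using not_less_Least[OF that[unfolded k_def]] by simp
  have "\<exists>Z\<in>reg P. (\<Sum>i\<le>Polynomial.degree p. f ^ i * coeff p i) = f ^ k * (coeff p k + f * Z)"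
    by (rule lowest_term) (simp_all add: reg_zero reg_add reg_mult reg_one P freg creg k_le below)
  then obtain Z where Z: "Z \<in> reg P"
    "(\<Sum>i\<le>Polynomial.degree p. f ^ i * coeff p i) = f ^ k * (coeff p k + f * Z)" ..
  have "poly p f = f ^ k * (coeff p k + f * Z)"
    unfolding poly_altdef Z(2)[symmetric] by (simp only: mult.commute)
  then have "coeff p k = - (f * Z)"
    using p(2) f(2) by (simp add: eq_neg_iff_add_eq_0)
  also have "\<dots> = t * (- (b * Z))" using b(2) by simp
  finally have eq: "coeff p k = t * (- (b * Z))" .
  obtain c where c: "coeff p k = emb c" using p(1)[of k] by blast
  then have "c \<noteq> 0" using k by (auto simp: emb_ring)
  moreover have "- (b * Z) \<in> reg P" by (intro reg_uminus reg_mult P b(1) Z(1))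
  ultimately have "emb c \<noteq> t * (- (b * Z))" by (rule const_not_multiple[OF P t])
  then show False using eq unfolding c by blast
qed

text \<open>A nonzero function with a zero is transcendental, so some place sends its inverse to \<open>0\<close>. The center
  of the place is a point \<open>P\<close> of the curve, and the domain of the place contains the local ring at
  \<open>P\<close>. If \<open>f\<close> were regular at \<open>P\<close>, it would have a residue, and \<open>1 = f * inverse f\<close> would have residue
  \<open>0\<close>.\<close>

lemma no_zero_without_pole:
  assumes P\<^sub>0: "P\<^sub>0 \<in> C" and f: "f \<in> K" "f \<noteq> 0" "0 < val emb \<xi> P\<^sub>0 f"
  shows "\<exists>P\<in>C. f \<notin> reg P"
proof (rule ccontr)
  assume "\<not> ?thesis"
  then have regular: "f \<in> reg P" if "P \<in> C" for P using that by blast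
  obtain G where G: "maximal_residue_graph emb G" and pole: "(inverse f, 0) \<in> G"
  proof (rule exists_place_at_pole[OF hom f(2)])
    show "p = 0" if "\<And>n. coeff p n \<in> range emb" "poly p f = 0" for p
      by (rule not_algebraic_of_zero[OF P\<^sub>0 f that])
  qed (rule that)
  interpret maximal_residue_graph emb G by (rule G)
  have "\<xi> \<noteq> 0" using generic unfolding generic_point_def by (rule conjunct1)
  obtain i x where x: "\<xi> $ i \<noteq> 0" "x \<noteq> 0" "\<And>j. (\<xi> $ j / \<xi> $ i, x $ j) \<in> G"
    by (rule center[OF \<open>\<xi> \<noteq> 0\<close>]) (rule that)
  \<comment> \<open>The rescaled generic point, all of whose coordinates have residues.\<close>
  define \<eta> where "\<eta> = inverse (\<xi> $ i) *s \<xi>"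
  have \<eta>: "(\<eta> $ j, x $ j) \<in> G" for j
    using x(3)[of j] unfolding \<eta>_def by (simp add: divide_inverse mult.commute)
  have scale: "eval_at emb g \<eta> = inverse (\<xi> $ i) ^ d * ev g" if "homogeneous d g" for d g
    unfolding \<eta>_def by (rule eval_at_scale[OF that])
  obtain S :: "('n, 'k) mpoly set" where S: "\<And>g. g \<in> S \<Longrightarrow> \<exists>d. homogeneous d g" "C = zero_locus to_ac S"
    using closed unfolding closed_over_ground_def by (elim exE conjE) (rule that; blast)
  define P where "P = proj_point x"
  have "vanishes g P" if g: "g \<in> S" for g
  proof -
    obtain d where d: "homogeneous d g" using S(1)[OF g] by blast
    have "\<forall>P\<in>C. vanishes g P"
      unfolding S(2) zero_locus_def using g by simp
    then have "ev g = 0" unfolding ev_eq_zero_iff[OF d] .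
    then have "eval_at emb g \<eta> = 0" using scale[OF d] by simp
    then have "(0, eval_at to_ac g x) \<in> G" using eval_at_mem[OF \<eta>, of g] by (simp only:)
    then have "eval_at to_ac g x = 0" by (rule value_zero)
    then show ?thesis unfolding P_def vanishes_at_proj_point[OF d] .
  qed
  moreover have "P \<in> proj_space" unfolding P_def proj_space_def using x(2) by blast
  ultimately have P: "P \<in> C" unfolding S(2) zero_locus_def by simp
  obtain d a b where ab: "homogeneous d a" "homogeneous d b" "\<not> vanishes b P" "f = ev a / ev b"
    using regE[OF regular[OF P]] .
  have "eval_at to_ac b x \<noteq> 0"
    using ab(3) unfolding P_def vanishes_at_proj_point[OF ab(2)] .
  then have "(inverse (eval_at emb b \<eta>), inverse (eval_at to_ac b x)) \<in> G"
    by (rule inverse_mem[OF eval_at_mem[OF \<eta>]])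
  from mult[OF eval_at_mem[OF \<eta>, of a] this]
  have "(eval_at emb a \<eta> * inverse (eval_at emb b \<eta>), eval_at to_ac a x * inverse (eval_at to_ac b x)) \<in> G" .
  moreover have "eval_at emb a \<eta> * inverse (eval_at emb b \<eta>) = f"
    unfolding scale[OF ab(1)] scale[OF ab(2)] ab(4) using x(1) by (simp add: field_simps)
  ultimately have "(f, eval_at to_ac a x * inverse (eval_at to_ac b x)) \<in> G" by (simp only:)
  from mult[OF this pole] have "(1, 0) \<in> G" using f(2) by simp
  then show False using value_unique[OF one] by fastforce
qed

end


locale pointed_curve = curve emb \<xi> C
  for emb :: "'k :: {field, finite} \<Rightarrow> 'l :: field"
    and \<xi> :: "'l ^ 'n :: finite"
    and C :: "('k, 'n) geom_point set" +
  fixes Q :: "'m :: finite \<Rightarrow> ('k, 'n) geom_point"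
  assumes inj_Q: "inj Q"
    and rational_Q: "\<And>j. Q j \<in> rational_points C"
begin

section \<open>Riemann-Roch spaces supported on the chosen points\<close>

abbreviation H where "H \<equiv> weierstrass_semigroup emb \<xi> C Q"
abbreviation RR where "RR \<beta> \<equiv> riemann_roch_space emb \<xi> C (divisor_of Q \<beta>)"
abbreviation poles :: "'l \<Rightarrow> int ^ 'm" where "poles f \<equiv> (\<chi> j. - val emb \<xi> (Q j) f)"

lemma Q_in_C: "Q j \<in> C"
  using rational_Q[of j] unfolding rational_points_def by simp

lemma divisor_of_Q: "divisor_of Q \<beta> (Q j) = \<beta> $ j"
proof -
  have "divisor_of Q \<beta> (Q j) = (\<Sum>i\<in>UNIV. if i = j then \<beta> $ i else 0)"
    unfolding divisor_of_def using inj_Q by (intro sum.cong) (auto simp: inj_eq)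
  then show ?thesis by simp
qed

lemma divisor_of_outside: "P \<notin> range Q \<Longrightarrow> divisor_of Q \<beta> P = 0"
  unfolding divisor_of_def by (intro sum.neutral) auto

lemma mem_RR_iff:
  assumes "f \<noteq> 0"
  shows "f \<in> RR \<beta> \<longleftrightarrow> f \<in> regular_outside emb \<xi> C Q \<and> (\<forall>j. poles f $ j \<le> \<beta> $ j)"
proof (cases "f \<in> K")
  case True
  have "(\<forall>P\<in>C. val emb \<xi> P f \<ge> - divisor_of Q \<beta> P) \<longleftrightarrow>
      (\<forall>P\<in>C - range Q. f \<in> reg P) \<and> (\<forall>j. val emb \<xi> (Q j) f \<ge> - \<beta> $ j)"
  proof (intro iffI conjI ballI allI)
    fix P assume all: "\<forall>P\<in>C. val emb \<xi> P f \<ge> - divisor_of Q \<beta> P" and P: "P \<in> C - range Q"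
    then have "0 \<le> val emb \<xi> P f" using divisor_of_outside[of P \<beta>] by force
    then show "f \<in> reg P" using val_nonneg_iff[OF _ True assms] P by simp
  next
    fix j assume "\<forall>P\<in>C. val emb \<xi> P f \<ge> - divisor_of Q \<beta> P"
    from bspec[OF this Q_in_C[of j]] show "val emb \<xi> (Q j) f \<ge> - \<beta> $ j"
      unfolding divisor_of_Q .
  next
    fix P assume *: "(\<forall>P\<in>C - range Q. f \<in> reg P) \<and> (\<forall>j. val emb \<xi> (Q j) f \<ge> - \<beta> $ j)" and P: "P \<in> C"
    show "val emb \<xi> P f \<ge> - divisor_of Q \<beta> P"
    proof (cases "P \<in> range Q")
      case True
      then obtain j where "P = Q j" by (rule rangeE)
      then show ?thesis using * by (simp add: divisor_of_Q)
    next
      case False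
      then have "f \<in> reg P" using * P by simp
      then show ?thesis
        using val_nonneg_iff[OF P \<open>f \<in> K\<close> assms] divisor_of_outside[OF False] by simp
    qed
  qed
  moreover have "poles f $ j \<le> \<beta> $ j \<longleftrightarrow> val emb \<xi> (Q j) f \<ge> - \<beta> $ j" for j by auto
  ultimately show ?thesis
    using True assms unfolding riemann_roch_space_def regular_outside_def by simp
next
  case False
  then show ?thesis unfolding riemann_roch_space_def regular_outside_def by simp
qed

lemma zero_in_K: "0 \<in> K"
  using reg_subset_K[OF Q_in_C reg_zero[OF Q_in_C]] .

lemma zero_in_RR: "0 \<in> RR \<beta>"
  unfolding riemann_roch_space_def using zero_in_K by simp

lemma regular_outside_K: "f \<in> regular_outside emb \<xi> C Q \<Longrightarrow> f \<in> K"
  unfolding regular_outside_def by simp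

lemma regular_outside_combination:
  assumes "f \<in> regular_outside emb \<xi> C Q" "h \<in> regular_outside emb \<xi> C Q"
  shows "f + emb c * h \<in> regular_outside emb \<xi> C Q"
  using assms unfolding regular_outside_def
  by (auto intro!: K_add K_const_mult reg_add reg_mult reg_const)

lemma RR_combination:
  assumes f: "f \<in> RR \<beta>" and h: "h \<in> RR \<beta>"
  shows "f + emb c * h \<in> RR \<beta>"
proof (cases "f = 0 \<or> h = 0 \<or> c = 0 \<or> f + emb c * h = 0")
  case False
  then have nz: "f \<noteq> 0" "h \<noteq> 0" "c \<noteq> 0" "f + emb c * h \<noteq> 0" by simp_all
  have f': "f \<in> regular_outside emb \<xi> C Q" "\<And>j. - val emb \<xi> (Q j) f \<le> \<beta> $ j"
    using f unfolding mem_RR_iff[OF nz(1)] by simp_all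
  have h': "h \<in> regular_outside emb \<xi> C Q" "\<And>j. - val emb \<xi> (Q j) h \<le> \<beta> $ j"
    using h unfolding mem_RR_iff[OF nz(2)] by simp_all
  have hK: "emb c * h \<in> K" "emb c * h \<noteq> 0"
    using K_const_mult[OF regular_outside_K[OF h'(1)]] field_hom_nonzero[OF hom nz(3)] nz(2) by simp_all
  have "- val emb \<xi> (Q j) (f + emb c * h) \<le> \<beta> $ j" for j
  proof -
    have "- \<beta> $ j \<le> val emb \<xi> (Q j) (f + emb c * h)"
    proof (rule val_ge_add[OF Q_in_C regular_outside_K[OF f'(1)] nz(1) _ hK _ nz(4)])
      show "- \<beta> $ j \<le> val emb \<xi> (Q j) f" using f'(2)[of j] by simp
      show "- \<beta> $ j \<le> val emb \<xi> (Q j) (emb c * h)"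
        unfolding val_const_mult[OF Q_in_C regular_outside_K[OF h'(1)] nz(2,3)] using h'(2)[of j] by simp
    qed
    then show ?thesis by simp
  qed
  then show ?thesis
    unfolding mem_RR_iff[OF nz(4)] using regular_outside_combination[OF f'(1) h'(1)] by simp
next
  case True
  then consider "f + emb c * h = 0" | "h = 0 \<or> c = 0" | "f = 0" by blast
  then show ?thesis
  proof cases
    case 1
    then show ?thesis using zero_in_RR by simp
  next
    case 2
    then have "emb c * h = 0" by (elim disjE) (simp_all add: emb_ring)
    then show ?thesis using f by (simp only: add_0_right)
  next
    case 3
    show ?thesis
    proof (cases "h = 0 \<or> c = 0")
      case True
      then have "f + emb c * h = 0" using 3 by (elim disjE) (simp_all add: emb_ring)
      then show ?thesis using zero_in_RR by simp
    next
      case False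
      then have nz: "h \<noteq> 0" "c \<noteq> 0" by simp_all
      have h': "h \<in> regular_outside emb \<xi> C Q" "\<And>j. - val emb \<xi> (Q j) h \<le> \<beta> $ j"
        using h unfolding mem_RR_iff[OF nz(1)] by simp_all
      have ne: "emb c * h \<noteq> 0" using field_hom_nonzero[OF hom nz(2)] nz(1) by simp
      have "0 \<in> regular_outside emb \<xi> C Q"
        unfolding regular_outside_def using zero_in_K reg_zero by simp
      from regular_outside_combination[OF this h'(1)]
      have "emb c * h \<in> regular_outside emb \<xi> C Q" by simp
      moreover have "poles (emb c * h) $ j \<le> \<beta> $ j" for j
        using h'(2)[of j] val_const_mult[OF Q_in_C regular_outside_K[OF h'(1)] nz] by simp
      ultimately have "emb c * h \<in> RR \<beta>" unfolding mem_RR_iff[OF ne] by simp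
      then show ?thesis using 3 by simp
    qed
  qed
qed

text \<open>One function with the maximal pole order at \<open>Q i\<close> generates the space modulo the functions of smaller
  pole order there; hence the dimension jumps by at most \<open>1\<close>.\<close>

lemma RR_step:
  assumes f: "f \<in> RR \<beta>" "f \<noteq> 0" "poles f $ i = \<beta> $ i" and h: "h \<in> RR \<beta>"
  obtains c where "h - emb c * f \<in> RR (\<beta> - axis i 1)"
proof (cases "h \<in> RR (\<beta> - axis i 1)")
  case True
  then show thesis using that[of 0] by (simp add: emb_ring)
next
  case False
  then have h0: "h \<noteq> 0" using zero_in_RR by blast
  have hp: "h \<in> regular_outside emb \<xi> C Q" "\<And>j. poles h $ j \<le> \<beta> $ j"
    using h unfolding mem_RR_iff[OF h0] by blast+
  have fp: "f \<in> regular_outside emb \<xi> C Q"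
    using f(1) unfolding mem_RR_iff[OF f(2)] by blast
  have "poles h $ i = \<beta> $ i"
  proof (rule ccontr)
    assume "poles h $ i \<noteq> \<beta> $ i"
    then have "poles h $ j \<le> (\<beta> - axis i 1) $ j" for j
      using hp(2)[of j] by (cases "j = i") (auto simp: axis_def)
    then show False using False hp(1) unfolding mem_RR_iff[OF h0] by blast
  qed
  then have "val emb \<xi> (Q i) h = val emb \<xi> (Q i) f" using f(3) by simp
  then obtain c where c: "h = emb c * f \<or> val emb \<xi> (Q i) f < val emb \<xi> (Q i) (h - emb c * f)"
    using cancel_leading_term[OF rational_Q regular_outside_K[OF hp(1)] h0 regular_outside_K[OF fp] f(2)]
    by metis
  show thesis
  proof (cases "h - emb c * f = 0")
    case True
    then show thesis using that[of c] zero_in_RR by (simp only:)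
  next
    case ne: False
    have mem: "h - emb c * f \<in> RR \<beta>"
      using RR_combination[OF h f(1), of "- c"] by (simp add: emb_ring)
    have "val emb \<xi> (Q i) f < val emb \<xi> (Q i) (h - emb c * f)" using c ne by auto
    then have "poles (h - emb c * f) $ j \<le> (\<beta> - axis i 1) $ j" for j
      using mem f(3) unfolding mem_RR_iff[OF ne] by (cases "j = i") (auto simp: axis_def)
    then have "h - emb c * f \<in> RR (\<beta> - axis i 1)"
      using mem unfolding mem_RR_iff[OF ne] by blast
    then show thesis by (rule that)
  qed
qed

lemma RR_mono: "(\<And>j. \<beta> $ j \<le> \<gamma> $ j) \<Longrightarrow> RR \<beta> \<subseteq> RR \<gamma>"
proof
  fix f assume le: "\<And>j. \<beta> $ j \<le> \<gamma> $ j" and f: "f \<in> RR \<beta>"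
  show "f \<in> RR \<gamma>"
  proof (cases "f = 0")
    case True
    then show ?thesis using zero_in_RR by simp
  next
    case False
    show ?thesis using f le unfolding mem_RR_iff[OF False] by (blast intro: order_trans)
  qed
qed

lemma RR_no_attained:
  assumes "\<not> attained H i \<beta>"
  shows "RR \<beta> = RR (\<beta> - axis i 1)"
proof
  show "RR (\<beta> - axis i 1) \<subseteq> RR \<beta>" by (rule RR_mono) (simp add: axis_def)
  show "RR \<beta> \<subseteq> RR (\<beta> - axis i 1)"
  proof
    fix f assume f: "f \<in> RR \<beta>"
    show "f \<in> RR (\<beta> - axis i 1)"
    proof (cases "f = 0")
      case True
      then show ?thesis using zero_in_RR by simp
    next
      case False
      have fp: "f \<in> regular_outside emb \<xi> C Q" "\<And>j. poles f $ j \<le> \<beta> $ j"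
        using f unfolding mem_RR_iff[OF False] by blast+
      have "poles f \<in> H" unfolding weierstrass_semigroup_def using fp(1) False by blast
      then have "poles f $ i \<noteq> \<beta> $ i" using assms fp(2) unfolding attained_def by blast
      then have "poles f $ j \<le> (\<beta> - axis i 1) $ j" for j
        using fp(2)[of j] by (cases "j = i") (auto simp: axis_def)
      then show ?thesis using fp(1) unfolding mem_RR_iff[OF False] by blast
    qed
  qed
qed

lemma attainedE:
  assumes "attained H i \<beta>"
  obtains f where "f \<in> RR \<beta>" "f \<noteq> 0" "poles f $ i = \<beta> $ i"
proof -
  obtain \<gamma> where \<gamma>: "\<gamma> \<in> H" "\<forall>j. \<gamma> $ j \<le> \<beta> $ j" "\<gamma> $ i = \<beta> $ i"
    using assms unfolding attained_def by blast
  obtain f where f: "\<gamma> = poles f" "f \<in> regular_outside emb \<xi> C Q - {0}"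
    using \<gamma>(1) unfolding weierstrass_semigroup_def mem_Collect_eq by (elim exE conjE) (rule that)
  then have f0: "f \<noteq> 0" by simp
  have "f \<in> RR \<beta>" unfolding mem_RR_iff[OF f0] using f \<gamma>(2) by simp
  then show thesis using that f0 \<gamma>(3) unfolding f(1) by blast
qed

text \<open>The ground field is finite, so adjoining one generator keeps the space finite.\<close>

lemma finite_RR_step:
  assumes "finite (RR (\<beta> - axis i 1))"
  shows "finite (RR \<beta>)"
proof (cases "attained H i \<beta>")
  case True
  then obtain f where f: "f \<in> RR \<beta>" "f \<noteq> 0" "poles f $ i = \<beta> $ i" by (rule attainedE)
  have "RR \<beta> \<subseteq> (\<lambda>(c, g). g + emb c * f) ` (UNIV \<times> RR (\<beta> - axis i 1))"
  proof
    fix h assume "h \<in> RR \<beta>"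
    then obtain c where "h - emb c * f \<in> RR (\<beta> - axis i 1)" by (rule RR_step[OF f])
    then show "h \<in> (\<lambda>(c, g). g + emb c * f) ` (UNIV \<times> RR (\<beta> - axis i 1))"
      by (intro image_eqI[of _ _ "(c, h - emb c * f)"]) simp_all
  qed
  then show ?thesis by (rule finite_subset) (intro finite_imageI finite_cartesian_product assms, rule finite)
next
  case False
  then show ?thesis using RR_no_attained assms by simp
qed

text \<open>A nonzero member would have zeros at all the chosen points and no poles.\<close>

lemma RR_negative: "RR (\<chi> j. - 1) = {0}"
proof -
  have "f = 0" if f: "f \<in> RR (\<chi> j. - 1)" for f
  proof (rule ccontr)
    assume f0: "f \<noteq> 0"
    have fp: "f \<in> regular_outside emb \<xi> C Q" "\<And>j. 0 < val emb \<xi> (Q j) f"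
      using f unfolding mem_RR_iff[OF f0] by (simp_all add: less_le_trans[OF zero_less_one])
    have fK: "f \<in> K" by (rule regular_outside_K[OF fp(1)])
    obtain P where P: "P \<in> C" "f \<notin> reg P"
      using no_zero_without_pole[OF Q_in_C fK f0 fp(2)] by blast
    have "P \<in> range Q" using fp(1) P unfolding regular_outside_def by blast
    then obtain j where "P = Q j" by (rule rangeE)
    then show False
      using val_nonneg_iff[OF P(1) fK f0] P(2) fp(2)[of j] by simp
  qed
  then show ?thesis using zero_in_RR by blast
qed

text \<open>Every tuple is reached, up to enlarging it, from \<open>(-1, \<dots>, -1)\<close> by raising one entry at a time.\<close>

lemma finite_RR: "finite (RR \<beta>)"
proof -
  have *: "finite (RR \<gamma>)" if "\<And>j. - 1 \<le> \<gamma> $ j" "(\<Sum>j\<in>UNIV. \<gamma> $ j + 1) = int n" for n and \<gamma> :: "int ^ 'm"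
    using that
  proof (induction n arbitrary: \<gamma>)
    case 0
    have "0 \<le> \<gamma> $ j + 1" for j using 0(1)[of j] by linarith
    then have "\<forall>j\<in>UNIV. \<gamma> $ j + 1 = 0"
      using 0(2) sum_nonneg_eq_0_iff[of UNIV "\<lambda>j. \<gamma> $ j + 1"] by simp
    then have "\<gamma> = (\<chi> j. - 1)" by (simp add: vec_eq_iff eq_neg_iff_add_eq_0)
    then show ?case using RR_negative by simp
  next
    case (Suc n)
    have "\<exists>i. \<gamma> $ i \<noteq> - 1"
    proof (rule ccontr)
      assume "\<not> ?thesis"
      then have "(\<Sum>j\<in>UNIV. \<gamma> $ j + 1) = 0" by simp
      then show False using Suc.prems(2) by simp
    qed
    then obtain i where i: "\<gamma> $ i \<noteq> - 1" by blast
    have "finite (RR (\<gamma> - axis i 1))"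
    proof (rule Suc.IH)
      show "- 1 \<le> (\<gamma> - axis i 1) $ j" for j
        using Suc.prems(1)[of j] i by (cases "j = i") (auto simp: axis_def)
      have "(\<Sum>j\<in>UNIV. (\<gamma> - axis i 1) $ j + 1) = (\<Sum>j\<in>UNIV. (\<gamma> $ j + 1) - (if j = i then 1 else 0))"
        by (intro sum.cong) (auto simp: axis_def)
      also have "\<dots> = int n" unfolding sum_subtractf Suc.prems(2) by simp
      finally show "(\<Sum>j\<in>UNIV. (\<gamma> - axis i 1) $ j + 1) = int n" .
    qed
    then show ?case by (rule finite_RR_step)
  qed
  define \<gamma> where "\<gamma> = (\<chi> j. max (- 1) (\<beta> $ j))"
  have ge: "- 1 \<le> \<gamma> $ j" for j by (simp add: \<gamma>_def)
  have "0 \<le> \<gamma> $ j + 1" for j using ge[of j] by linarith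
  then have "0 \<le> (\<Sum>j\<in>UNIV. \<gamma> $ j + 1)" by (intro sum_nonneg) simp
  then have "finite (RR \<gamma>)"
    by (intro *[of \<gamma> "nat (\<Sum>j\<in>UNIV. \<gamma> $ j + 1)"] ge) simp
  moreover have "RR \<beta> \<subseteq> RR \<gamma>" by (rule RR_mono) (simp add: \<gamma>_def)
  ultimately show ?thesis by (rule finite_subset[rotated])
qed

lemma ell_diff_eq:
  "ell_diff emb \<xi> C Q i \<beta> = (if attained H i \<beta> then 1 else 0)"
proof (cases "attained H i \<beta>")
  case False
  then show ?thesis
    unfolding ell_diff_def ell_def rr_dim_def RR_no_attained[OF False] by simp
next
  case True
  interpret V: vector_space "\<lambda>c x. emb c * x" by (rule vector_space_emb[OF hom])
  obtain f where f: "f \<in> RR \<beta>" "f \<noteq> 0" "poles f $ i = \<beta> $ i"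
    using True by (rule attainedE)
  let ?W = "RR (\<beta> - axis i 1)"
  have sub: "V.subspace (RR \<gamma>)" for \<gamma>
  proof (rule V.subspaceI)
    show "0 \<in> RR \<gamma>" by (rule zero_in_RR)
    show "x + y \<in> RR \<gamma>" if "x \<in> RR \<gamma>" "y \<in> RR \<gamma>" for x y
      using RR_combination[OF that, of 1] by (simp add: emb_ring)
    show "emb c * x \<in> RR \<gamma>" if "x \<in> RR \<gamma>" for c x
      using RR_combination[OF zero_in_RR that, of c] by simp
  qed
  obtain B where B: "B \<subseteq> ?W" "V.independent B" "?W \<subseteq> V.span B" "card B = V.dim ?W"
    by (rule V.basis_exists)
  have span_B: "V.span B \<subseteq> ?W" by (rule V.span_minimal[OF B(1) sub])
  have "f \<notin> ?W"
  proof
    assume "f \<in> ?W"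
    then have "poles f $ i \<le> (\<beta> - axis i 1) $ i" unfolding mem_RR_iff[OF f(2)] by blast
    then show False using f(3) by (simp add: axis_def)
  qed
  then have fB: "f \<notin> V.span B" using span_B by blast
  then have f_notin: "f \<notin> B" using V.span_base by blast
  have finB: "finite B" by (rule finite_subset[OF B(1) finite_RR])
  have mono: "?W \<subseteq> RR \<beta>" by (rule RR_mono) (simp add: axis_def)
  have "RR \<beta> \<subseteq> V.span (insert f B)"
  proof
    fix h assume "h \<in> RR \<beta>"
    then obtain c where "h - emb c * f \<in> ?W" by (rule RR_step[OF f])
    then have "h - emb c * f \<in> V.span B" using B(3) by blast
    then show "h \<in> V.span (insert f B)" unfolding V.span_insert by blast
  qed
  moreover have "insert f B \<subseteq> RR \<beta>" using f(1) B(1) mono by blast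
  moreover have "V.independent (insert f B)"
    using fB B(2) f_notin by (simp add: V.independent_insert)
  ultimately have "V.dim (RR \<beta>) = card (insert f B)"
    using V.basis_card_eq_dim by metis
  also have "\<dots> = V.dim ?W + 1" using f_notin finB B(4) by simp
  finally show ?thesis
    using True unfolding ell_diff_def ell_def rr_dim_def by simp
qed

section \<open>The semigroup\<close>

lemma finite_semigroup_below: "finite {\<gamma> \<in> H. \<forall>j. \<gamma> $ j \<le> \<alpha> $ j}"
proof (rule finite_subset[OF _ finite_imageI[OF finite_RR[of \<alpha>], of poles]], rule subsetI)
  fix \<gamma> assume \<gamma>: "\<gamma> \<in> {\<gamma> \<in> H. \<forall>j. \<gamma> $ j \<le> \<alpha> $ j}"
  then obtain f where f: "\<gamma> = poles f" "f \<in> regular_outside emb \<xi> C Q - {0}"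
    unfolding weierstrass_semigroup_def mem_Collect_eq by (elim exE conjE) (rule that)
  then have f0: "f \<noteq> 0" by simp
  have "f \<in> RR \<alpha>" unfolding mem_RR_iff[OF f0] using f \<gamma> by simp
  then show "\<gamma> \<in> poles ` RR \<alpha>" unfolding f(1) by (rule imageI)
qed

text \<open>The difference of one function and a scalar multiple of the other has smaller pole order at \<open>Q i\<close> and, by
  the ultrametric inequality, the larger of the two pole orders wherever these differ.\<close>

lemma semigroup_cancel:
  fixes \<gamma> \<delta> :: "int ^ 'm"
  assumes "\<gamma> \<in> H" "\<delta> \<in> H" "\<gamma> \<noteq> \<delta>" "\<gamma> $ i = \<delta> $ i"
  shows "\<exists>\<epsilon>\<in>H. \<epsilon> $ i < \<gamma> $ i \<and> (\<forall>j. \<epsilon> $ j \<le> max (\<gamma> $ j) (\<delta> $ j)) \<and>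
    (\<forall>j. \<gamma> $ j \<noteq> \<delta> $ j \<longrightarrow> \<epsilon> $ j = max (\<gamma> $ j) (\<delta> $ j))"
proof -
  obtain f where f: "\<gamma> = poles f" "f \<in> regular_outside emb \<xi> C Q - {0}"
    using assms(1) unfolding weierstrass_semigroup_def mem_Collect_eq by (elim exE conjE) (rule that)
  obtain h where h: "\<delta> = poles h" "h \<in> regular_outside emb \<xi> C Q - {0}"
    using assms(2) unfolding weierstrass_semigroup_def mem_Collect_eq by (elim exE conjE) (rule that)
  have fR: "f \<in> regular_outside emb \<xi> C Q" "f \<noteq> 0" "f \<in> K"
    using f(2) regular_outside_K by simp_all
  have hR: "h \<in> regular_outside emb \<xi> C Q" "h \<noteq> 0" "h \<in> K"
    using h(2) regular_outside_K by simp_all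
  have eq: "val emb \<xi> (Q i) f = val emb \<xi> (Q i) h" using assms(4) f(1) h(1) by simp
  obtain c where c: "c \<noteq> 0" "f = emb c * h \<or> val emb \<xi> (Q i) h < val emb \<xi> (Q i) (f - emb c * h)"
    by (rule cancel_leading_term[OF rational_Q fR(3,2) hR(3,2) eq])
  have ne: "f \<noteq> emb c * h"
  proof
    assume "f = emb c * h"
    then have "val emb \<xi> (Q j) f = val emb \<xi> (Q j) h" for j
      using val_const_mult[OF Q_in_C hR(3,2) c(1)] by simp
    then show False using assms(3) f(1) h(1) by simp
  qed
  define e where "e = f + emb (- c) * h"
  have e_diff: "e = f - emb c * h" by (simp add: e_def emb_ring)
  have e0: "e \<noteq> 0" using ne by (simp add: e_diff)
  have eR: "e \<in> regular_outside emb \<xi> C Q"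
    unfolding e_def by (rule regular_outside_combination[OF fR(1) hR(1)])
  have "- c \<noteq> 0" using c(1) by simp
  then have g: "emb (- c) * h \<in> K" "emb (- c) * h \<noteq> 0"
    and val_g: "val emb \<xi> (Q j) (emb (- c) * h) = val emb \<xi> (Q j) h" for j
    using K_const_mult[OF hR(3)] field_hom_nonzero[OF hom] hR(2) val_const_mult[OF Q_in_C hR(3,2)]
    by simp_all
  have "poles e \<in> H" unfolding weierstrass_semigroup_def using eR e0 by blast
  moreover have "poles e $ i < \<gamma> $ i"
    using c(2) ne eq f(1) by (simp add: e_diff)
  moreover have "poles e $ j \<le> max (\<gamma> $ j) (\<delta> $ j)" for j
  proof -
    have "min (val emb \<xi> (Q j) f) (val emb \<xi> (Q j) h) \<le> val emb \<xi> (Q j) e"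
      unfolding e_def
      by (rule val_ge_add[OF Q_in_C fR(3,2) _ g]) (use e0 in \<open>simp_all add: val_g e_def\<close>)
    then show ?thesis by (simp add: f(1) h(1) max_def min_def split: if_splits)
  qed
  moreover have "poles e $ j = max (\<gamma> $ j) (\<delta> $ j)" if "\<gamma> $ j \<noteq> \<delta> $ j" for j
  proof (cases "val emb \<xi> (Q j) f < val emb \<xi> (Q j) h")
    case True
    have "val emb \<xi> (Q j) e = val emb \<xi> (Q j) f"
      unfolding e_def by (rule val_add_eq(2)[OF Q_in_C fR(3,2) g]) (simp add: val_g True)
    then show ?thesis using True by (simp add: f(1) h(1))
  next
    case False
    then have less: "val emb \<xi> (Q j) h < val emb \<xi> (Q j) f" using that by (simp add: f(1) h(1))
    have "val emb \<xi> (Q j) (emb (- c) * h + f) = val emb \<xi> (Q j) (emb (- c) * h)"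
      by (rule val_add_eq(2)[OF Q_in_C g fR(3,2)]) (simp add: val_g less)
    then have "val emb \<xi> (Q j) e = val emb \<xi> (Q j) h"
      unfolding e_def val_g by (simp only: add.commute)
    then show ?thesis using less by (simp add: f(1) h(1))
  qed
  ultimately show ?thesis by (intro bexI[of _ "poles e"]) simp_all
qed

lemma poincare_series_dual:
  assumes "CARD('m) \<ge> 2" and dual: "\<And>\<beta>. \<beta> \<in> H \<longleftrightarrow> nabla H (\<sigma> - \<beta>) = {}"
  shows "poincare_series emb \<xi> C Q i \<alpha> = (-1) ^ CARD('m) * poincare_series emb \<xi> C Q i (\<sigma> - \<alpha>)"
proof -
  interpret self_dual_semigroup H \<sigma>
    by unfold_locales (rule semigroup_cancel, assumption+, rule finite_semigroup_below, rule dual)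
  have "ell_diff emb \<xi> C Q i \<beta> + ell_diff emb \<xi> C Q i (\<sigma> - \<beta> - ind_vec UNIV + axis i 1) = 1" for \<beta>
    unfolding ell_diff_eq using attained_dual[of i \<beta>] by simp
  note S = alternating_sum_dual[where d = "ell_diff emb \<xi> C Q i" and \<alpha> = \<alpha>, OF this assms(1)]
  show ?thesis
    unfolding poincare_series_def S by (rule mult.left_commute)
qed

end

theorem theorem4p10:
  fixes emb :: "'k :: {field, finite} \<Rightarrow> 'l :: field"
    and \<xi> :: "'l ^ 'n :: finite"
    and C :: "('k, 'n) geom_point set"
    and Q :: "'m :: finite \<Rightarrow> ('k, 'n) geom_point"
    and \<sigma> :: "int ^ 'm"
    and i :: 'm
  assumes "nonsingular_projective_curve emb \<xi> C"
    and "CARD('m) \<ge> 2"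
    and "CARD('k) \<ge> CARD('m)"
    and "inj Q"
    and "\<And>j. Q j \<in> rational_points C"
    and "symmetric_semigroup emb \<xi> C Q"
    and "\<sigma> \<in> maximal_elements (weierstrass_semigroup emb \<xi> C Q)"
    and "size_of \<sigma> = 2 * genus emb \<xi> C - 2 + int CARD('m)"
    and "\<And>\<beta>. \<beta> \<in> weierstrass_semigroup emb \<xi> C Q \<longleftrightarrow>
                nabla (weierstrass_semigroup emb \<xi> C Q) (\<sigma> - \<beta>) = {}"
  shows "poincare_series emb \<xi> C Q i =
           laurent_times (Poly_Mapping.single \<sigma> ((-1) ^ CARD('m)))
             (invert_vars (poincare_series emb \<xi> C Q i))"
proof
  fix \<alpha>
  interpret pointed_curve emb \<xi> C Q
    using assms(1,4,5) by unfold_locales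
  have "poincare_series emb \<xi> C Q i \<alpha> = (-1) ^ CARD('m) * poincare_series emb \<xi> C Q i (\<sigma> - \<alpha>)"
    by (rule poincare_series_dual[OF assms(2,9)])
  then show "poincare_series emb \<xi> C Q i \<alpha> =
      laurent_times (Poly_Mapping.single \<sigma> ((-1) ^ CARD('m)))
        (invert_vars (poincare_series emb \<xi> C Q i)) \<alpha>"
    unfolding laurent_times_def invert_vars_def by simp
qed

end
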